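(* Every constructible tropical linear space is series-parallel.
   Context: A function $p:\binom{[n]}{d}\to\mathbb{R}$ is a tropical Plücker vector if for every $S\in\binom{[n]}{d-2}$ and distinct $i,j,k,l\notin S$, the minimum of $p_{S\cup\{i,j\}}+p_{S\cup\{k,l\}}$, $p_{S\cup\{i,k\}}+p_{S\cup\{j,l\}}$, $p_{S\cup\{i,l\}}+p_{S\cup\{j,k\}}$ is attained at least twice. Its tropical linear space is $L(p)=\{x\in\mathbb{R}^n:$ for every $J\in\binom{[n]}{d+1}$ the minimum over $j\in J$ of $p_{J\setminus\{j\}}+x_j$ is attained at least twice$\}$ (a $d$-dimensional tropical linear space in $n$-space). For $w\in\mathbb{R}^n$ let $M_w$ be the set of $I$ minimizing $p_I-\sum_{i\in I}w_i$; faces of $L(p)$ are closures of the sets $\{w:M_w=\mathcal{M}\}$ contained in $L(p)$. Let $e_I=\sum_{i\in I}e_i$ and $\Delta(d,n)=\mathrm{conv}\{e_I:I\in\binom{[n]}{d}\}$. The regular subdivision $\mathcal{D}_p$ of $\Delta(d,n)$ is obtained by projecting to $\Delta(d,n)$ the lower faces (outward normal with negative last coordinate) of $\mathrm{conv}\{(e_I,p_I)\}\subset\mathbb{R}^n\times\mathbb{R}$. For a matroid $M$ on $[n]$, $P_M=\mathrm{conv}\{e_B: B \text{ a basis of } M\}$. A matroid is series-parallel if it is the cycle matroid of a graph obtained from a single edge joining two distinct vertices by repeatedly applying series extension (subdividing an edge into two edges) and parallel extension (adding an edge parallel to an existing edge). $L(p)$ is series-parallel if every maximal cell of $\mathcal{D}_p$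 is $P_M$ for a series-parallel matroid $M$. Dual: $p^\perp_I=p_{[n]\setminus I}$ on $\binom{[n]}{n-d}$ and $L(p)^\perp=L(p^\perp)$. Stable intersection: for $p$ on $\binom{[n]}{d}$, $p'$ on $\binom{[n]}{d'}$, $d+d'\ge n$, $q_J=\min\{p_I+p'_{I'}:|I|=d,|I'|=d',I\cap I'=J\}$ for $J\in\binom{[n]}{d+d'-n}$. Two tropical linear spaces $L,L'$ meet transversely if whenever faces $F$ of $L$ and $F'$ of $L'$ have intersecting relative interiors, the direction spaces of their affine hulls together span $\mathbb{R}^n$; then $L(p)\cap L(p')=L(q)$. A tropical hyperplane is an $(n-1)$-dimensional tropical linear space in $n$-space. The constructible tropical linear spaces form the smallest class containing all tropical hyperplanes and closed under $L\mapsto L^\perp$ and under $(L,L')\mapsto L\cap L'=L(q)$ for $L,L'$ in the same $\mathbb{R}^n$ with $d+d'\ge n$ meeting transversely.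
   Formalization: The tropical linear space is assumed to have dimension d > 0; for d = 0 (e.g. the stable intersection of the disjoint hyperplanes x1 = x2 and x1 = x2 + 1 in the plane) the only cell comes from a matroid of loops, which is not series-parallel, so the claim fails. *)

theory Defs
  imports "HOL-Analysis.Analysis"
begin

text \<open>The ground set \<open>[n]\<close> is a finite type \<open>'n\<close>, so \<open>n = CARD('n)\<close>. A function on the
  \<open>d\<close>-subsets of \<open>[n]\<close> is a function on all subsets whose values on sets of cardinality
  other than \<open>d\<close> are never used.\<close>

subsection \<open>Tropical linear spaces\<close>

definition min3_attained_twice :: "real \<Rightarrow> real \<Rightarrow> real \<Rightarrow> bool" where
  "min3_attained_twice a b c \<longleftrightarrow>
     (a = b \<and> a \<le> c) \<or> (a = c \<and> a \<le> b) \<or> (b = c \<and> b \<le> a)"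

definition min_attained_twice :: "'a set \<Rightarrow> ('a \<Rightarrow> real) \<Rightarrow> bool" where
  "min_attained_twice A f \<longleftrightarrow>
     (\<exists>a\<in>A. \<exists>b\<in>A. a \<noteq> b \<and> f a = f b \<and> (\<forall>c\<in>A. f a \<le> f c))"

definition tropical_plucker :: "nat \<Rightarrow> ('n::finite set \<Rightarrow> real) \<Rightarrow> bool" where
  "tropical_plucker d p \<longleftrightarrow> d \<le> CARD('n) \<and>
     (\<forall>S i j k l. card S + 2 = d \<longrightarrow> distinct [i, j, k, l] \<longrightarrow> {i, j, k, l} \<inter> S = {} \<longrightarrow>
        min3_attained_twice
          (p (S \<union> {i, j}) + p (S \<union> {k, l}))
          (p (S \<union> {i, k}) + p (S \<union> {j, l}))
          (p (S \<union> {i, l}) + p (S \<union> {j, k})))"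

definition tropical_linear_space :: "nat \<Rightarrow> ('n::finite set \<Rightarrow> real) \<Rightarrow> (real ^ 'n) set" where
  "tropical_linear_space d p =
     {x. \<forall>J. card J = d + 1 \<longrightarrow> min_attained_twice J (\<lambda>j. p (J - {j}) + x $ j)}"

definition minimizers :: "nat \<Rightarrow> ('n::finite set \<Rightarrow> real) \<Rightarrow> real ^ 'n \<Rightarrow> 'n set set" where
  "minimizers d p w =
     {I. card I = d \<and>
         (\<forall>I'. card I' = d \<longrightarrow> p I - (\<Sum>i\<in>I. w $ i) \<le> p I' - (\<Sum>i\<in>I'. w $ i))}"

definition tls_faces :: "nat \<Rightarrow> ('n::finite set \<Rightarrow> real) \<Rightarrow> (real ^ 'n) set set" where
  "tls_faces d p =
     {closure C | C. (\<exists>M. C = {w. minimizers d p w = M}) \<and> C \<noteq> {} \<and>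
                     C \<subseteq> tropical_linear_space d p}"

subsection \<open>Regular subdivisions of hypersimplices\<close>

definition indicator_vec :: "'n::finite set \<Rightarrow> real ^ 'n" where
  "indicator_vec I = (\<Sum>i\<in>I. axis i 1)"

definition lifted_hypersimplex ::
    "nat \<Rightarrow> ('n::finite set \<Rightarrow> real) \<Rightarrow> ((real ^ 'n) \<times> real) set" where
  "lifted_hypersimplex d p = convex hull {(indicator_vec I, p I) | I. card I = d}"

definition lower_face :: "((real ^ 'n::finite) \<times> real) set \<Rightarrow> ((real ^ 'n) \<times> real) set \<Rightarrow> bool" where
  "lower_face F P \<longleftrightarrow> F \<noteq> {} \<and>
     (\<exists>a b. snd a < 0 \<and> P \<subseteq> {x. a \<bullet> x \<le> b} \<and> F = P \<inter> {x. a \<bullet> x = b})"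

definition regular_subdivision :: "nat \<Rightarrow> ('n::finite set \<Rightarrow> real) \<Rightarrow> (real ^ 'n) set set" where
  "regular_subdivision d p = {fst ` F | F. lower_face F (lifted_hypersimplex d p)}"

definition maximal_cell :: "nat \<Rightarrow> ('n::finite set \<Rightarrow> real) \<Rightarrow> (real ^ 'n) set \<Rightarrow> bool" where
  "maximal_cell d p C \<longleftrightarrow> C \<in> regular_subdivision d p \<and>
     (\<forall>D\<in>regular_subdivision d p. C \<subseteq> D \<longrightarrow> D = C)"

subsection \<open>Series-parallel matroids\<close>

text \<open>A multigraph is given by a set \<open>E\<close> of edge labels and a function \<open>ends\<close> that maps each
  label in \<open>E\<close> to its set of end vertices (a singleton for a loop). Matroids are represented
  by their sets of bases.\<close>

text \<open>For length 1 a cycle is a loop, for length 2 a pair of parallel edges.\<close>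

definition graph_cycle :: "('e \<Rightarrow> 'v set) \<Rightarrow> 'e set \<Rightarrow> bool" where
  "graph_cycle ends C \<longleftrightarrow>
     (\<exists>es vs. es \<noteq> [] \<and> length vs = length es \<and> distinct es \<and> distinct vs \<and> set es = C \<and>
        (\<forall>i<length es. ends (es ! i) = {vs ! i, vs ! (Suc i mod length es)}))"

definition forest :: "('e \<Rightarrow> 'v set) \<Rightarrow> 'e set \<Rightarrow> bool" where
  "forest ends A \<longleftrightarrow> \<not> (\<exists>C\<subseteq>A. graph_cycle ends C)"

definition cycle_matroid_bases :: "'e set \<Rightarrow> ('e \<Rightarrow> 'v set) \<Rightarrow> 'e set set" where
  "cycle_matroid_bases E ends =
     {B. B \<subseteq> E \<and> forest ends B \<and> (\<forall>A. B \<subseteq> A \<longrightarrow> A \<subseteq> E \<longrightarrow> forest ends A \<longrightarrow> A = B)}"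

inductive series_parallel_graph :: "'e set \<Rightarrow> ('e \<Rightarrow> 'v set) \<Rightarrow> bool" where
  single_edge:
    "u \<noteq> v \<Longrightarrow> ends e = {u, v} \<Longrightarrow> series_parallel_graph {e} ends"
| parallel_extension:
    "series_parallel_graph E ends \<Longrightarrow> e \<in> E \<Longrightarrow> f \<notin> E \<Longrightarrow>
     series_parallel_graph (insert f E) (ends(f := ends e))"
| series_extension:
    "series_parallel_graph E ends \<Longrightarrow> e \<in> E \<Longrightarrow> f \<notin> E \<Longrightarrow> ends e = {u, v} \<Longrightarrow>
     w \<notin> \<Union>(ends ` E) \<Longrightarrow>
     series_parallel_graph (insert f E) (ends(e := {u, w}, f := {w, v}))"

definition series_parallel_matroid :: "'n::finite set set \<Rightarrow> bool" where
  "series_parallel_matroid M \<longleftrightarrow>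
     (\<exists>ends :: 'n \<Rightarrow> nat set. series_parallel_graph UNIV ends \<and>
        M = cycle_matroid_bases UNIV ends)"

definition matroid_polytope :: "'n::finite set set \<Rightarrow> (real ^ 'n) set" where
  "matroid_polytope M = convex hull (indicator_vec ` M)"

definition series_parallel_tls :: "nat \<Rightarrow> ('n::finite set \<Rightarrow> real) \<Rightarrow> bool" where
  "series_parallel_tls d p \<longleftrightarrow>
     (\<forall>C. maximal_cell d p C \<longrightarrow>
        (\<exists>M. series_parallel_matroid M \<and> C = matroid_polytope M))"

subsection \<open>Constructible tropical linear spaces\<close>

definition dual_plucker :: "('n::finite set \<Rightarrow> real) \<Rightarrow> 'n set \<Rightarrow> real" where
  "dual_plucker p I = p (UNIV - I)"

definition stable_intersection ::
    "nat \<Rightarrow> ('n::finite set \<Rightarrow> real) \<Rightarrow> nat \<Rightarrow> ('n set \<Rightarrow> real) \<Rightarrow> 'n set \<Rightarrow> real" where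
  "stable_intersection d p d' p' J =
     Min {p I + p' I' | I I'. card I = d \<and> card I' = d' \<and> I \<inter> I' = J}"

definition direction_space :: "(real ^ 'n::finite) set \<Rightarrow> (real ^ 'n) set" where
  "direction_space F = {x - y | x y. x \<in> affine hull F \<and> y \<in> affine hull F}"

definition meet_transversely ::
    "nat \<Rightarrow> ('n::finite set \<Rightarrow> real) \<Rightarrow> nat \<Rightarrow> ('n set \<Rightarrow> real) \<Rightarrow> bool" where
  "meet_transversely d p d' p' \<longleftrightarrow>
     (\<forall>F\<in>tls_faces d p. \<forall>F'\<in>tls_faces d' p'.
        rel_interior F \<inter> rel_interior F' \<noteq> {} \<longrightarrow>
        span (direction_space F \<union> direction_space F') = UNIV)"

inductive constructible :: "(real ^ 'n::finite) set \<Rightarrow> bool" where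
  hyperplane:
    "tropical_plucker (CARD('n) - 1) p \<Longrightarrow>
     constructible (tropical_linear_space (CARD('n) - 1) p)"
| dual:
    "tropical_plucker d p \<Longrightarrow> constructible (tropical_linear_space d p) \<Longrightarrow>
     constructible (tropical_linear_space (CARD('n) - d) (dual_plucker p))"
| transverse_intersection:
    "tropical_plucker d p \<Longrightarrow> constructible (tropical_linear_space d p) \<Longrightarrow>
     tropical_plucker d' p' \<Longrightarrow> constructible (tropical_linear_space d' p') \<Longrightarrow>
     CARD('n) \<le> d + d' \<Longrightarrow> meet_transversely d p d' p' \<Longrightarrow>
     constructible
       (tropical_linear_space (d + d' - CARD('n)) (stable_intersection d p d' p'))"

end

theory Submission
  imports Defs
begin

text \<open>The cells of the regular subdivision are the sets of minimizers of \<open>p\<^sub>I - \<Sum>\<^sub>i\<^sub>\<in>\<^sub>I w\<^sub>i\<close>, and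
  the maximal ones are the connected ones. Every cell of a series-parallel subdivision is a face of
  a connected series-parallel matroid, hence a direct sum of such matroids, loops and coloops.
  In the dual picture, stable intersection becomes the product \<open>{A \<union> B | A \<inter> B = {}}\<close> of set families.
  Suppose that a connected cell of the stable intersection of two transverse spaces comes from cells
  \<open>M\<close>, \<open>M'\<close>. Transversality says that the zero-sum vectors on the connected components of \<open>M\<close> and
  \<open>M'\<close> are jointly independent. So two components that meet share exactly one element, and their
  product is again a connected series-parallel matroid, with independence preserved. Merging
  components one pair at a time leaves a single connected series-parallel matroid.
  Since constructibility is a property of the set \<open>L(p)\<close>, one also needs that \<open>L(p)\<close> determines \<open>d\<close>, and
  \<open>p\<close> up to a constant.\<close>

subsection \<open>Products of set families and series-parallel networks\<close>

text \<open>Constructibility speaks of sets, whereas the argument needs valuations: the pair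
  \<open>d\<close>, \<open>p\<close> at hand must be compared with the one produced by duality or
  stable intersection. The comparison uses the exchange axiom, so a stable intersection has to be
  shown to be a valuated matroid. After complementation this is matroid union with costs, obtained
  from a direct sum on two copies of the ground set by identifying the copies of one element at a
  time.

  Two encodings replace most of matroid theory. A family of sets is read as a polynomial with
  Boolean coefficients in variables of square zero, with union as sum, so that direct sums,
  extensions and substitutions become identities in a semiring; the product of two blocks with one
  common element is the series connection of matroids. Connectedness says that only constant weights
  are constant on the family. This makes transversality linear algebra, since the directions of a
  stratum are weights that are constant on its cell.

  Rank n is exceptional: its only cell is \<open>{UNIV}\<close>, which is not connected for n \<ge>
  2, so it is treated apart.\<close>

definition dprod :: "'a set set \<Rightarrow> 'a set set \<Rightarrow> 'a set set" (infixl "\<otimes>" 70) where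
  "A \<otimes> B = {I \<union> J | I J. I \<in> A \<and> J \<in> B \<and> I \<inter> J = {}}"

lemma dprodI: "I \<in> A \<Longrightarrow> J \<in> B \<Longrightarrow> I \<inter> J = {} \<Longrightarrow> I \<union> J \<in> A \<otimes> B"
  unfolding dprod_def by blast

lemma dprodE:
  assumes "K \<in> A \<otimes> B"
  obtains I J where "K = I \<union> J" "I \<in> A" "J \<in> B" "I \<inter> J = {}"
  using assms unfolding dprod_def by blast

lemma dprod_commute: "A \<otimes> B = B \<otimes> A"
  unfolding dprod_def by (auto simp: Un_commute Int_commute)

lemma dprod_assoc: "(A \<otimes> B) \<otimes> C = A \<otimes> (B \<otimes> C)"
proof (intro equalityI subsetI)
  fix K assume "K \<in> (A \<otimes> B) \<otimes> C"
  then obtain I J L where "K = (I \<union> J) \<union> L" "I \<in> A" "J \<in> B" "L \<in> C" "I \<inter> J = {}" "(I \<union> J) \<inter> L = {}"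
    by (elim dprodE) blast
  then have "K = I \<union> (J \<union> L)" "J \<inter> L = {}" "I \<inter> (J \<union> L) = {}" by auto
  then show "K \<in> A \<otimes> (B \<otimes> C)"
    using \<open>I \<in> A\<close> \<open>J \<in> B\<close> \<open>L \<in> C\<close> by (auto intro!: dprodI)
next
  fix K assume "K \<in> A \<otimes> (B \<otimes> C)"
  then obtain I J L where "K = I \<union> (J \<union> L)" "I \<in> A" "J \<in> B" "L \<in> C" "J \<inter> L = {}" "I \<inter> (J \<union> L) = {}"
    by (elim dprodE) blast
  then have "K = (I \<union> J) \<union> L" "I \<inter> J = {}" "(I \<union> J) \<inter> L = {}" by auto
  then show "K \<in> (A \<otimes> B) \<otimes> C"
    using \<open>I \<in> A\<close> \<open>J \<in> B\<close> \<open>L \<in> C\<close> by (metis dprodI)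
qed

lemma dprod_left_commute: "A \<otimes> (B \<otimes> C) = B \<otimes> (A \<otimes> C)"
  by (metis dprod_assoc dprod_commute)

lemmas dprod_ac = dprod_assoc dprod_commute dprod_left_commute

lemma dprod_Un_left: "(A \<union> B) \<otimes> C = A \<otimes> C \<union> B \<otimes> C"
  and dprod_Un_right: "C \<otimes> (A \<union> B) = C \<otimes> A \<union> C \<otimes> B"
  unfolding dprod_def by blast+

lemmas dprod_Un = dprod_Un_left dprod_Un_right

lemma dprod_unit_left [simp]: "{{}} \<otimes> A = A"
  and dprod_unit_right [simp]: "A \<otimes> {{}} = A"
  and dprod_empty_left [simp]: "{} \<otimes> A = {}"
  and dprod_empty_right [simp]: "A \<otimes> {} = {}"
  unfolding dprod_def by auto

text \<open>The one relation beyond those of a commutative semiring with union as sum. It removes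
  the term of a product in which a shared edge would be taken twice.\<close>

lemma dprod_singleton_square: "{{e}} \<otimes> {{e}} = {}"
  unfolding dprod_def by auto

lemma dprod_subset_Pow: "A \<subseteq> Pow E \<Longrightarrow> B \<subseteq> Pow E' \<Longrightarrow> A \<otimes> B \<subseteq> Pow (E \<union> E')"
  unfolding dprod_def by blast

lemma dprod_nonempty:
  "A \<subseteq> Pow E \<Longrightarrow> B \<subseteq> Pow E' \<Longrightarrow> E \<inter> E' = {} \<Longrightarrow> A \<noteq> {} \<Longrightarrow> B \<noteq> {} \<Longrightarrow> A \<otimes> B \<noteq> {}"
proof -
  assume *: "A \<subseteq> Pow E" "B \<subseteq> Pow E'" "E \<inter> E' = {}" "A \<noteq> {}" "B \<noteq> {}"
  then obtain I J where "I \<in> A" "J \<in> B" by blast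
  moreover from this have "I \<inter> J = {}" using * by blast
  ultimately show ?thesis using dprodI by blast
qed

interpretation dprod: comm_monoid_set dprod "{{}}"
  by unfold_locales (simp_all add: dprod_ac)

lemma dprod_F_subset_Pow:
  assumes "finite K" "\<And>a. a \<in> K \<Longrightarrow> f a \<subseteq> Pow (g a)"
  shows "dprod.F f K \<subseteq> Pow (\<Union>(g ` K))"
  using assms
proof (induction K rule: finite_induct)
  case (insert a K)
  then show ?case
    using dprod_subset_Pow [of "f a" "g a" "dprod.F f K" "\<Union>(g ` K)"] by simp
qed simp

text \<open>Two-terminal series-parallel networks. \<open>trees\<close> collects the spanning trees, and \<open>cuts\<close>
  the spanning forests with two components that separate the terminals.\<close>

datatype 'a net = Edge 'a | Par "'a net" "'a net" | Ser "'a net" "'a net"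

primrec edges :: "'a net \<Rightarrow> 'a set" where
  "edges (Edge e) = {e}"
| "edges (Par a b) = edges a \<union> edges b"
| "edges (Ser a b) = edges a \<union> edges b"

primrec wf_net :: "'a net \<Rightarrow> bool" where
  "wf_net (Edge e) = True"
| "wf_net (Par a b) = (wf_net a \<and> wf_net b \<and> edges a \<inter> edges b = {})"
| "wf_net (Ser a b) = (wf_net a \<and> wf_net b \<and> edges a \<inter> edges b = {})"

fun trees :: "'a net \<Rightarrow> 'a set set" and cuts :: "'a net \<Rightarrow> 'a set set" where
  "trees (Edge e) = {{e}}"
| "trees (Par a b) = trees a \<otimes> cuts b \<union> cuts a \<otimes> trees b"
| "trees (Ser a b) = trees a \<otimes> trees b"
| "cuts (Edge e) = {{}}"
| "cuts (Par a b) = cuts a \<otimes> cuts b"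
| "cuts (Ser a b) = trees a \<otimes> cuts b \<union> cuts a \<otimes> trees b"

lemma edges_nonempty: "edges a \<noteq> {}"
  by (induction a) auto

lemma trees_cuts_subset: "trees a \<subseteq> Pow (edges a) \<and> cuts a \<subseteq> Pow (edges a)"
  by (induction a) (auto elim!: dprodE)

lemmas trees_subset = trees_cuts_subset [THEN conjunct1]
  and cuts_subset = trees_cuts_subset [THEN conjunct2]

lemma trees_cuts_nonempty: "wf_net a \<Longrightarrow> trees a \<noteq> {} \<and> cuts a \<noteq> {}"
  by (induction a) (simp_all add: dprod_nonempty [OF trees_subset trees_subset]
      dprod_nonempty [OF trees_subset cuts_subset] dprod_nonempty [OF cuts_subset cuts_subset])

text \<open>A cut lacks exactly the edge that would join its two components. The fixed size of trees
  is the rank of a summand, which makes an indicator weight constant in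
  \<open>connected_sum_single_block\<close>.\<close>

lemma trees_cuts_card:
  fixes a :: "'a::finite net"
  assumes "wf_net a"
  shows "\<exists>r. (\<forall>B\<in>trees a. card B = Suc r) \<and> (\<forall>B\<in>cuts a. card B = r)"
  using assms
proof (induction a)
  case (Edge e)
  then show ?case by simp
next
  case (Par a b)
  then obtain r s where "\<forall>B\<in>trees a. card B = Suc r" "\<forall>B\<in>cuts a. card B = r"
    "\<forall>B\<in>trees b. card B = Suc s" "\<forall>B\<in>cuts b. card B = s" by auto
  then show ?case
    by (intro exI [of _ "r + s"]) (auto elim!: dprodE simp: card_Un_disjoint)
next
  case (Ser a b)
  then obtain r s where "\<forall>B\<in>trees a. card B = Suc r" "\<forall>B\<in>cuts a. card B = r"
    "\<forall>B\<in>trees b. card B = Suc s" "\<forall>B\<in>cuts b. card B = s" by auto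
  then show ?case
    by (intro exI [of _ "Suc (r + s)"]) (auto elim!: dprodE simp: card_Un_disjoint)
qed

section \<open>Planar duality and the choice of a root edge\<close>

primrec dual_net :: "'a net \<Rightarrow> 'a net" where
  "dual_net (Edge e) = Edge e"
| "dual_net (Par a b) = Ser (dual_net a) (dual_net b)"
| "dual_net (Ser a b) = Par (dual_net a) (dual_net b)"

lemma edges_dual_net [simp]: "edges (dual_net a) = edges a"
  by (induction a) auto

lemma wf_dual_net [simp]: "wf_net (dual_net a) = wf_net a"
  by (induction a) auto

lemma dprod_image_Diff:
  assumes "A \<subseteq> Pow E" "B \<subseteq> Pow E'" "E \<inter> E' = {}"
  shows "(\<lambda>I. (E \<union> E') - I) ` (A \<otimes> B) = ((-) E ` A) \<otimes> ((-) E' ` B)"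
proof (intro equalityI subsetI)
  fix K assume "K \<in> (\<lambda>I. (E \<union> E') - I) ` (A \<otimes> B)"
  then obtain I J where "K = (E \<union> E') - (I \<union> J)" "I \<in> A" "J \<in> B" by (auto elim!: dprodE)
  moreover from this assms have "K = (E - I) \<union> (E' - J)" by blast
  moreover have "(E - I) \<inter> (E' - J) = {}" using assms(3) by blast
  ultimately show "K \<in> ((-) E ` A) \<otimes> ((-) E' ` B)"
    by (metis dprodI imageI)
next
  fix K assume "K \<in> ((-) E ` A) \<otimes> ((-) E' ` B)"
  then obtain I J where "K = (E - I) \<union> (E' - J)" "I \<in> A" "J \<in> B" by (auto elim!: dprodE)
  moreover from this assms have "K = (E \<union> E') - (I \<union> J)" "I \<inter> J = {}" by blast+
  ultimately show "K \<in> (\<lambda>I. (E \<union> E') - I) ` (A \<otimes> B)"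
    using dprodI [of I A J B] by blast
qed

text \<open>Exchanging \<open>Par\<close> with \<open>Ser\<close> exchanges the recursions of
  \<open>trees\<close> and \<open>cuts\<close>, and complementation is compatible with products over
  disjoint edge sets.\<close>

lemma dual_net_complement:
  "wf_net a \<Longrightarrow> (-) (edges a) ` trees a = cuts (dual_net a) \<and>
     (-) (edges a) ` cuts a = trees (dual_net a)"
  by (induction a)
    (simp_all add: image_Un dprod_image_Diff [OF trees_subset trees_subset]
      dprod_image_Diff [OF trees_subset cuts_subset] dprod_image_Diff [OF cuts_subset cuts_subset]
      dprod_image_Diff [OF cuts_subset trees_subset] Un_commute)

text \<open>The complements are the cuts of a series network, and \<open>cuts (Ser a b)\<close> has
  the same formula as \<open>trees (Par a b)\<close>. So the dual of a block can again be written
  with a parallel top node.\<close>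

lemma trees_Par_complement:
  "wf_net (Par a b) \<Longrightarrow>
     (-) (edges a \<union> edges b) ` trees (Par a b) = trees (Par (dual_net a) (dual_net b))"
  using dual_net_complement [of "Par a b"] by simp

text \<open>A parallel node closes its children up to a ring or a bundle, which can be opened at
  another pair of terminals: a sibling of the part containing \<open>e\<close> moves to the other
  side of the top node, by associativity and distributivity alone. Descending towards
  \<open>e\<close> leaves the bare edge on the left.\<close>

lemma trees_Par_reroot:
  assumes "wf_net (Par a b)" "e \<in> edges a"
  shows "\<exists>c. wf_net (Par (Edge e) c) \<and> edges (Par (Edge e) c) = edges (Par a b) \<and>
    trees (Par (Edge e) c) = trees (Par a b)"
  using assms
proof (induction a arbitrary: b)
  case (Edge x)
  then show ?case by auto
next
  case (Par x y)
  show ?case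
  proof (cases "e \<in> edges x")
    case True
    have "wf_net (Par x (Par y b))" using Par.prems by auto
    moreover have "edges (Par x (Par y b)) = edges (Par (Par x y) b)"
      "trees (Par x (Par y b)) = trees (Par (Par x y) b)" by (simp_all add: dprod_ac dprod_Un Un_ac)
    ultimately show ?thesis using Par.IH(1) True by metis
  next
    case False
    then have e: "e \<in> edges y" using Par.prems by auto
    have "wf_net (Par y (Par x b))" using Par.prems by auto
    moreover have "edges (Par y (Par x b)) = edges (Par (Par x y) b)"
      "trees (Par y (Par x b)) = trees (Par (Par x y) b)" by (simp_all add: dprod_ac dprod_Un Un_ac)
    ultimately show ?thesis using Par.IH(2) e by metis
  qed
next
  case (Ser x y)
  show ?case
  proof (cases "e \<in> edges x")
    case True
    have "wf_net (Par x (Ser y b))" using Ser.prems by auto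
    moreover have "edges (Par x (Ser y b)) = edges (Par (Ser x y) b)"
      "trees (Par x (Ser y b)) = trees (Par (Ser x y) b)" by (simp_all add: dprod_ac dprod_Un Un_ac)
    ultimately show ?thesis using Ser.IH(1) True by metis
  next
    case False
    then have e: "e \<in> edges y" using Ser.prems by auto
    have "wf_net (Par y (Ser x b))" using Ser.prems by auto
    moreover have "edges (Par y (Ser x b)) = edges (Par (Ser x y) b)"
      "trees (Par y (Ser x b)) = trees (Par (Ser x y) b)" by (simp_all add: dprod_ac dprod_Un Un_ac)
    ultimately show ?thesis using Ser.IH(2) e by metis
  qed
qed

text \<open>The parallel top node is what makes the matroid connected, see
  \<open>block_connected\<close>. A series top node would give a direct sum of the two children, and
  a single edge a coloop.\<close>

definition block :: "'a net \<Rightarrow> bool" where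
  "block x \<longleftrightarrow> wf_net x \<and> (\<exists>a b. x = Par a b)"

lemma block_reroot:
  assumes "block x" "e \<in> edges x"
  obtains c where "block (Par (Edge e) c)" "edges (Par (Edge e) c) = edges x"
    "trees (Par (Edge e) c) = trees x"
proof -
  obtain a b where x: "x = Par a b" "wf_net (Par a b)" using assms(1) by (auto simp: block_def)
  have comm: "wf_net (Par b a)" "edges (Par b a) = edges x" "trees (Par b a) = trees x"
    using x by (auto simp: dprod_ac Un_commute Int_commute)
  consider "e \<in> edges a" | "e \<in> edges b" using assms(2) x by auto
  then show thesis
  proof cases
    case 1
    then show ?thesis using trees_Par_reroot [OF x(2)] that x by (metis block_def)
  next
    case 2
    then show ?thesis using trees_Par_reroot [OF comm(1)] that comm by (metis block_def)
  qed
qed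

text \<open>Over the semiring of set families with \<open>x = {{e}}\<close> and \<open>x\<^sup>2 = 0\<close> the product of
  \<open>x F + T\<close> and \<open>x F' + T'\<close> is \<open>x (F T' + T F') + T T'\<close>.\<close>

lemma block_merge:
  assumes "block x" "block y" "edges x \<inter> edges y = {e}"
  obtains z where "block z" "edges z = edges x \<union> edges y" "trees z = trees x \<otimes> trees y"
proof -
  obtain a where a: "block (Par (Edge e) a)" "edges (Par (Edge e) a) = edges x"
    "trees (Par (Edge e) a) = trees x"
    using block_reroot [OF assms(1)] assms(3) by blast
  obtain b where b: "block (Par (Edge e) b)" "edges (Par (Edge e) b) = edges y"
    "trees (Par (Edge e) b) = trees y"
    using block_reroot [OF assms(2)] assms(3) by blast
  have "wf_net (Par (Edge e) (Ser a b))"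
    using a(1,2) b(1,2) assms(3) by (auto simp: block_def)
  moreover have "edges (Par (Edge e) (Ser a b)) = edges x \<union> edges y"
    using a(2) b(2) by auto
  moreover have "trees (Par (Edge e) (Ser a b)) = trees x \<otimes> trees y"
    unfolding a(3) [symmetric] b(3) [symmetric]
    by (simp add: dprod_Un dprod_ac Un_ac dprod_singleton_square)
  ultimately show thesis using that [of "Par (Edge e) (Ser a b)"] unfolding block_def by blast
qed

section \<open>Connectedness of blocks in terms of weights\<close>

definition weight_constant :: "('a \<Rightarrow> real) \<Rightarrow> 'a set set \<Rightarrow> bool" where
  "weight_constant u A \<longleftrightarrow> (\<forall>I\<in>A. \<forall>J\<in>A. sum u I = sum u J)"

lemma weight_constantD: "weight_constant u A \<Longrightarrow> I \<in> A \<Longrightarrow> J \<in> A \<Longrightarrow> sum u I = sum u J"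
  unfolding weight_constant_def by blast

lemma weight_constant_mono: "weight_constant u B \<Longrightarrow> A \<subseteq> B \<Longrightarrow> weight_constant u A"
  unfolding weight_constant_def by blast

lemma weight_constant_dprod:
  fixes A B :: "'a::finite set set"
  assumes "weight_constant u (A \<otimes> B)" "A \<subseteq> Pow E" "B \<subseteq> Pow E'" "E \<inter> E' = {}" "A \<noteq> {}" "B \<noteq> {}"
  shows "weight_constant u A" "weight_constant u B"
proof -
  have s: "sum u (I \<union> J) = sum u I + sum u J" "I \<union> J \<in> A \<otimes> B" if "I \<in> A" "J \<in> B" for I J
  proof -
    have "I \<inter> J = {}" using that assms by blast
    then show "sum u (I \<union> J) = sum u I + sum u J" "I \<union> J \<in> A \<otimes> B"
      using that by (auto intro: sum.union_disjoint dprodI)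
  qed
  show "weight_constant u A"
    unfolding weight_constant_def
  proof (intro ballI)
    fix I I' assume "I \<in> A" "I' \<in> A"
    moreover obtain J where "J \<in> B" using assms by blast
    ultimately show "sum u I = sum u I'"
      using s weight_constantD [OF assms(1)] by (metis add_right_cancel)
  qed
  show "weight_constant u B"
    unfolding weight_constant_def
  proof (intro ballI)
    fix I I' assume "I \<in> B" "I' \<in> B"
    moreover obtain J where "J \<in> A" using assms by blast
    ultimately show "sum u I = sum u I'"
      using s weight_constantD [OF assms(1)] by (metis add_left_cancel)
  qed
qed

text \<open>Constancy on a product over disjoint edge sets passes to its factors. Comparing the two
  products with each other equates the tree-minus-cut difference of \<open>a\<close> with that of
  \<open>b\<close>; their common value is \<open>t\<close>.\<close>

lemma weight_constant_trees_cuts: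
  fixes a b :: "'a::finite net"
  assumes "weight_constant u (trees a \<otimes> cuts b \<union> cuts a \<otimes> trees b)"
    and "wf_net a" "wf_net b" "edges a \<inter> edges b = {}"
  obtains t where "weight_constant u (trees a)" "weight_constant u (cuts a)"
    "weight_constant u (trees b)" "weight_constant u (cuts b)"
    "\<And>I J. I \<in> trees a \<Longrightarrow> J \<in> cuts a \<Longrightarrow> sum u I - sum u J = t"
    "\<And>I J. I \<in> trees b \<Longrightarrow> J \<in> cuts b \<Longrightarrow> sum u I - sum u J = t"
proof -
  note ne = trees_cuts_nonempty [OF assms(2)] trees_cuts_nonempty [OF assms(3)]
  have "weight_constant u (trees a \<otimes> cuts b)" "weight_constant u (cuts a \<otimes> trees b)"
    using assms(1) by (auto intro: weight_constant_mono)
  then have c: "weight_constant u (trees a)" "weight_constant u (cuts b)"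
    "weight_constant u (cuts a)" "weight_constant u (trees b)"
    using weight_constant_dprod [OF _ trees_subset cuts_subset assms(4)]
      weight_constant_dprod [OF _ cuts_subset trees_subset assms(4)] ne by blast+
  have eq: "sum u I + sum u J' = sum u J + sum u I'"
    if "I \<in> trees a" "J \<in> cuts a" "I' \<in> trees b" "J' \<in> cuts b" for I J I' J'
  proof -
    have d: "I \<inter> J' = {}" "J \<inter> I' = {}" using that trees_subset cuts_subset assms(4) by blast+
    then have "sum u (I \<union> J') = sum u (J \<union> I')"
      using that by (intro weight_constantD [OF assms(1)]) (auto intro: dprodI)
    then show ?thesis using d by (simp add: sum.union_disjoint)
  qed
  obtain I0 J0 where "I0 \<in> trees a" "J0 \<in> cuts a" using ne by blast
  moreover obtain I1 J1 where "I1 \<in> trees b" "J1 \<in> cuts b" using ne by blast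
  note wit = calculation this
  show thesis
  proof (rule that [OF c(1,3,4,2), of "sum u I0 - sum u J0"])
    fix I J assume "I \<in> trees a" "J \<in> cuts a"
    then show "sum u I - sum u J = sum u I0 - sum u J0"
      using weight_constantD [OF c(1), of I I0] weight_constantD [OF c(3), of J J0] wit by simp
  next
    fix I J assume "I \<in> trees b" "J \<in> cuts b"
    then show "sum u I - sum u J = sum u I0 - sum u J0"
      using eq [of I0 J0 I J] wit by simp
  qed
qed

text \<open>The difference \<open>t\<close> descends unchanged to both children, because a tree and
  a cut of the node can be chosen to agree on the other child. At a leaf the tree is
  \<open>{e}\<close> and the cut is empty, so \<open>t\<close> is the weight of the edge.\<close>

lemma weight_constant_net:
  fixes a :: "'a::finite net"
  assumes "wf_net a" "weight_constant u (trees a)" "weight_constant u (cuts a)"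
    and "\<And>I J. I \<in> trees a \<Longrightarrow> J \<in> cuts a \<Longrightarrow> sum u I - sum u J = t"
    and "e \<in> edges a"
  shows "u e = t"
  using assms
proof (induction a arbitrary: t)
  case (Edge x)
  then show ?case by force
next
  case (Par a b)
  have wf: "wf_net a" "wf_net b" "edges a \<inter> edges b = {}" using Par.prems by auto
  note ne = trees_cuts_nonempty [OF wf(1)] trees_cuts_nonempty [OF wf(2)]
  obtain s where s: "weight_constant u (trees a)" "weight_constant u (cuts a)"
    "weight_constant u (trees b)" "weight_constant u (cuts b)"
    "\<And>I J. I \<in> trees a \<Longrightarrow> J \<in> cuts a \<Longrightarrow> sum u I - sum u J = s"
    "\<And>I J. I \<in> trees b \<Longrightarrow> J \<in> cuts b \<Longrightarrow> sum u I - sum u J = s"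
    by (rule weight_constant_trees_cuts [OF _ wf, of u]) (use Par.prems(2) in simp_all)
  obtain I J K where ijk: "I \<in> trees a" "J \<in> cuts a" "K \<in> cuts b" using ne by blast
  then have d: "I \<inter> K = {}" "J \<inter> K = {}" using trees_subset cuts_subset wf(3) by blast+
  then have "sum u (I \<union> K) - sum u (J \<union> K) = t"
    using ijk by (intro Par.prems(4)) (auto intro: dprodI)
  then have "s = t" using s(5) ijk d by (simp add: sum.union_disjoint)
  then show ?case using Par.IH(1) [OF wf(1) s(1,2,5)] Par.IH(2) [OF wf(2) s(3,4,6)] Par.prems(5)
    by auto
next
  case (Ser a b)
  have wf: "wf_net a" "wf_net b" "edges a \<inter> edges b = {}" using Ser.prems by auto
  note ne = trees_cuts_nonempty [OF wf(1)] trees_cuts_nonempty [OF wf(2)]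
  obtain s where s: "weight_constant u (trees a)" "weight_constant u (cuts a)"
    "weight_constant u (trees b)" "weight_constant u (cuts b)"
    "\<And>I J. I \<in> trees a \<Longrightarrow> J \<in> cuts a \<Longrightarrow> sum u I - sum u J = s"
    "\<And>I J. I \<in> trees b \<Longrightarrow> J \<in> cuts b \<Longrightarrow> sum u I - sum u J = s"
    by (rule weight_constant_trees_cuts [OF _ wf, of u]) (use Ser.prems(3) in simp_all)
  obtain I J K where ijk: "I \<in> trees a" "J \<in> cuts a" "K \<in> trees b" using ne by blast
  then have d: "I \<inter> K = {}" "J \<inter> K = {}" using trees_subset cuts_subset wf(3) by blast+
  then have "sum u (I \<union> K) - sum u (J \<union> K) = t"
    using ijk by (intro Ser.prems(4)) (auto intro: dprodI)
  then have "s = t" using s(5) ijk d by (simp add: sum.union_disjoint)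
  then show ?case using Ser.IH(1) [OF wf(1) s(1,2,5)] Ser.IH(2) [OF wf(2) s(3,4,6)] Ser.prems(5)
    by auto
qed

lemma block_connected:
  fixes x :: "'a::finite net"
  assumes "block x" "weight_constant u (trees x)" "e \<in> edges x" "f \<in> edges x"
  shows "u e = u f"
proof -
  obtain a b where x: "x = Par a b" and wf: "wf_net a" "wf_net b" "edges a \<inter> edges b = {}"
    using assms(1) by (auto simp: block_def)
  obtain s where s: "weight_constant u (trees a)" "weight_constant u (cuts a)"
    "weight_constant u (trees b)" "weight_constant u (cuts b)"
    "\<And>I J. I \<in> trees a \<Longrightarrow> J \<in> cuts a \<Longrightarrow> sum u I - sum u J = s"
    "\<And>I J. I \<in> trees b \<Longrightarrow> J \<in> cuts b \<Longrightarrow> sum u I - sum u J = s"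
    by (rule weight_constant_trees_cuts [OF _ wf, of u]) (use assms(2) x in simp_all)
  have "u g = s" if "g \<in> edges x" for g
    using that x weight_constant_net [OF wf(1) s(1,2,5)] weight_constant_net [OF wf(2) s(3,4,6)]
    by auto
  then show ?thesis using assms by simp
qed

subsection \<open>Faces\<close>

text \<open>These are the vertices of the face of the polytope of \<open>A\<close> on which the
  linear functional \<open>u\<close> is maximal.\<close>

definition argmax_weight :: "('a \<Rightarrow> real) \<Rightarrow> 'a set set \<Rightarrow> 'a set set" where
  "argmax_weight u A = {I \<in> A. \<forall>J\<in>A. sum u J \<le> sum u I}"

lemma argmax_weight_nonempty:
  fixes A :: "'a::finite set set"
  assumes "A \<noteq> {}"
  obtains I where "I \<in> argmax_weight u A"
proof -
  have "Max (sum u ` A) \<in> sum u ` A" using assms by (intro Max_in) auto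
  then obtain I where "I \<in> A" "sum u I = Max (sum u ` A)" by auto
  then have "I \<in> argmax_weight u A" by (simp add: argmax_weight_def)
  then show thesis by (rule that)
qed

lemma argmax_weight_dprod:
  fixes A B :: "'a::finite set set"
  assumes "A \<subseteq> Pow E" "B \<subseteq> Pow E'" "E \<inter> E' = {}" "A \<noteq> {}" "B \<noteq> {}"
  shows "argmax_weight u (A \<otimes> B) = argmax_weight u A \<otimes> argmax_weight u B"
proof -
  have s: "sum u (I \<union> J) = sum u I + sum u J" "I \<union> J \<in> A \<otimes> B" "I \<inter> J = {}" if "I \<in> A" "J \<in> B" for I J
  proof -
    show "I \<inter> J = {}" using that assms by blast
    then show "sum u (I \<union> J) = sum u I + sum u J" "I \<union> J \<in> A \<otimes> B"
      using that by (auto intro: sum.union_disjoint dprodI)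
  qed
  show ?thesis
  proof (intro equalityI subsetI)
    fix K assume K: "K \<in> argmax_weight u (A \<otimes> B)"
    then obtain I J where ij: "K = I \<union> J" "I \<in> A" "J \<in> B" "I \<inter> J = {}"
      by (auto simp: argmax_weight_def elim!: dprodE)
    have max: "sum u L \<le> sum u K" if "L \<in> A \<otimes> B" for L
      using K that by (auto simp: argmax_weight_def)
    have "sum u I' \<le> sum u I" if "I' \<in> A" for I'
      using max [OF s(2) [OF that ij(3)]] s(1) [OF that ij(3)] s(1) [OF ij(2,3)] ij(1) by simp
    then have "I \<in> argmax_weight u A" using ij by (simp add: argmax_weight_def)
    moreover have "sum u J' \<le> sum u J" if "J' \<in> B" for J'
      using max [OF s(2) [OF ij(2) that]] s(1) [OF ij(2) that] s(1) [OF ij(2,3)] ij(1) by simp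
    then have "J \<in> argmax_weight u B" using ij by (simp add: argmax_weight_def)
    ultimately show "K \<in> argmax_weight u A \<otimes> argmax_weight u B"
      using dprodI ij(1,4) by blast
  next
    fix K assume "K \<in> argmax_weight u A \<otimes> argmax_weight u B"
    then obtain I J where ij: "K = I \<union> J" "I \<in> argmax_weight u A" "J \<in> argmax_weight u B"
      by (auto elim!: dprodE)
    then have "I \<in> A" "J \<in> B" by (auto simp: argmax_weight_def)
    moreover have "sum u L \<le> sum u K" if "L \<in> A \<otimes> B" for L
    proof -
      obtain I' J' where "L = I' \<union> J'" "I' \<in> A" "J' \<in> B" using \<open>L \<in> A \<otimes> B\<close> by (auto elim: dprodE)
      then show ?thesis using s ij \<open>I \<in> A\<close> \<open>J \<in> B\<close> by (auto simp: argmax_weight_def intro: add_mono)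
    qed
    ultimately show "K \<in> argmax_weight u (A \<otimes> B)"
      using s ij by (simp add: argmax_weight_def)
  qed
qed

lemma argmax_weightD:
  "I \<in> argmax_weight u A \<Longrightarrow> I \<in> A"
  "I \<in> argmax_weight u A \<Longrightarrow> J \<in> A \<Longrightarrow> sum u J \<le> sum u I"
  by (simp_all add: argmax_weight_def)

lemma argmax_weightI: "I \<in> A \<Longrightarrow> (\<And>J. J \<in> A \<Longrightarrow> sum u J \<le> sum u I) \<Longrightarrow> I \<in> argmax_weight u A"
  by (simp add: argmax_weight_def)

lemma argmax_weight_Un_less:
  assumes "I \<in> argmax_weight u A" "J \<in> argmax_weight u B" "sum u J < sum u I"
  shows "argmax_weight u (A \<union> B) = argmax_weight u A"
proof (intro equalityI subsetI)
  fix K assume K: "K \<in> argmax_weight u (A \<union> B)"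
  have "sum u I \<le> sum u K" using argmax_weightD(2) [OF K] argmax_weightD(1) [OF assms(1)] by blast
  then have "K \<notin> B" using argmax_weightD(2) [OF assms(2), of K] assms(3) by linarith
  then show "K \<in> argmax_weight u A"
    using argmax_weightD [OF K] by (intro argmax_weightI) auto
next
  fix K assume K: "K \<in> argmax_weight u A"
  have "sum u I \<le> sum u K" using argmax_weightD(2) [OF K] argmax_weightD(1) [OF assms(1)] by blast
  then have "sum u L \<le> sum u K" if "L \<in> B" for L
    using argmax_weightD(2) [OF assms(2) that] assms(3) by linarith
  then show "K \<in> argmax_weight u (A \<union> B)"
    using argmax_weightD [OF K] by (intro argmax_weightI) auto
qed

lemma argmax_weight_Un_eq:
  assumes "I \<in> argmax_weight u A" "J \<in> argmax_weight u B" "sum u J = sum u I"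
  shows "argmax_weight u (A \<union> B) = argmax_weight u A \<union> argmax_weight u B"
proof (intro equalityI subsetI)
  fix K assume K: "K \<in> argmax_weight u (A \<union> B)"
  show "K \<in> argmax_weight u A \<union> argmax_weight u B"
    using argmax_weightD [OF K] by (auto simp: argmax_weight_def)
next
  fix K assume K: "K \<in> argmax_weight u A \<union> argmax_weight u B"
  then have "sum u I \<le> sum u K"
    using argmax_weightD [OF assms(1)] argmax_weightD [OF assms(2)] assms(3)
    by (metis Un_iff argmax_weightD(2))
  then have "sum u L \<le> sum u K" if "L \<in> A \<union> B" for L
    using that argmax_weightD(2) [OF assms(1), of L] argmax_weightD(2) [OF assms(2), of L] assms(3)
    by auto
  then show "K \<in> argmax_weight u (A \<union> B)"
    using K argmax_weightD(1) by (intro argmax_weightI) blast+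
qed

text \<open>A direct sum of connected series-parallel matroids and coloops. The elements of
  \<open>E\<close> covered by no summand are the loops, which is why the edge sets need not exhaust
  \<open>E\<close>.\<close>

definition sp_sum :: "'a set \<Rightarrow> 'a set set \<Rightarrow> bool" where
  "sp_sum E M \<longleftrightarrow> (\<exists>K. finite K \<and> (\<forall>a\<in>K. block a \<or> (\<exists>e. a = Edge e)) \<and>
     (\<forall>a\<in>K. \<forall>b\<in>K. a \<noteq> b \<longrightarrow> edges a \<inter> edges b = {}) \<and> \<Union>(edges ` K) \<subseteq> E \<and>
     M = dprod.F trees K)"

lemma sp_sum_mono: "sp_sum E M \<Longrightarrow> E \<subseteq> E' \<Longrightarrow> sp_sum E' M"
  unfolding sp_sum_def by (elim exE conjE, intro exI conjI) (assumption | erule (1) subset_trans)+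

lemma sp_sum_unit: "sp_sum E {{}}"
  unfolding sp_sum_def by (rule exI [of _ "{}"]) simp

lemma sp_sum_single: "block a \<or> (\<exists>e. a = Edge e) \<Longrightarrow> sp_sum (edges a) (trees a)"
  unfolding sp_sum_def by (rule exI [of _ "{a}"]) simp

lemma sp_sum_dprod:
  assumes "sp_sum E M" "sp_sum E' M'" "E \<inter> E' = {}"
  shows "sp_sum (E \<union> E') (M \<otimes> M')"
proof -
  obtain K where K: "finite K" "\<forall>a\<in>K. block a \<or> (\<exists>e. a = Edge e)"
    "\<forall>a\<in>K. \<forall>b\<in>K. a \<noteq> b \<longrightarrow> edges a \<inter> edges b = {}" "\<Union>(edges ` K) \<subseteq> E" "M = dprod.F trees K"
    using assms(1) unfolding sp_sum_def by blast
  obtain K' where K': "finite K'" "\<forall>a\<in>K'. block a \<or> (\<exists>e. a = Edge e)"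
    "\<forall>a\<in>K'. \<forall>b\<in>K'. a \<noteq> b \<longrightarrow> edges a \<inter> edges b = {}" "\<Union>(edges ` K') \<subseteq> E'" "M' = dprod.F trees K'"
    using assms(2) unfolding sp_sum_def by blast
  have dis: "edges a \<inter> edges b = {}" if "a \<in> K" "b \<in> K'" for a b
    using that K(4) K'(4) assms(3) by blast
  then have "K \<inter> K' = {}" by (metis Int_absorb disjoint_iff edges_nonempty)
  then have "dprod.F trees (K \<union> K') = M \<otimes> M'"
    using K K' by (simp add: dprod.union_disjoint)
  moreover have "edges a \<inter> edges b = {}" if "a \<in> K \<union> K'" "b \<in> K \<union> K'" "a \<noteq> b" for a b
    using that K(3) K'(3) dis by (metis Int_commute Un_iff)
  moreover have "\<Union>(edges ` (K \<union> K')) \<subseteq> E \<union> E'" using K(4) K'(4) by blast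
  ultimately show ?thesis
    unfolding sp_sum_def using K(1,2) K'(1,2) by (intro exI [of _ "K \<union> K'"]) auto
qed

text \<open>Of the two families of a node, one is a direct sum of families of the children, and the
  other is a block: \<open>cuts (Ser a b)\<close> is the family
  \<open>trees (Par a b)\<close>.\<close>

lemma sp_sum_trees_cuts: "wf_net a \<Longrightarrow> sp_sum (edges a) (trees a) \<and> sp_sum (edges a) (cuts a)"
proof (induction a)
  case (Edge e)
  then show ?case using sp_sum_single [of "Edge e"] sp_sum_unit by auto
next
  case (Par a b)
  then show ?case using sp_sum_single [of "Par a b"] sp_sum_dprod by (auto simp: block_def)
next
  case (Ser a b)
  then show ?case using sp_sum_single [of "Par a b"] sp_sum_dprod by (auto simp: block_def)
qed

text \<open>Parallel and series composition are exchanged by swapping \<open>trees\<close> and \<open>cuts\<close>, so \<open>t\<close>, \<open>c\<close>, \<open>join\<close>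
  stand for \<open>trees\<close>, \<open>cuts\<close>, \<open>Par\<close> or for \<open>cuts\<close>, \<open>trees\<close>, \<open>Ser\<close>.\<close>

lemma net_face_join:
  fixes a b :: "'a::finite net" and u :: "'a \<Rightarrow> real"
  assumes join: "\<And>x y. t (join x y) = t x \<otimes> c y \<union> c x \<otimes> t y" "\<And>x y. c (join x y) = c x \<otimes> c y"
      "\<And>x y. edges (join x y) = edges x \<union> edges y"
      "\<And>x y. wf_net (join x y) \<longleftrightarrow> wf_net x \<and> wf_net y \<and> edges x \<inter> edges y = {}"
    and sub: "\<And>x. t x \<subseteq> Pow (edges x)" "\<And>x. c x \<subseteq> Pow (edges x)"
    and net: "\<And>x. wf_net x \<Longrightarrow> t x \<noteq> {} \<and> c x \<noteq> {}" "\<And>x. wf_net x \<Longrightarrow> sp_sum (edges x) (c x)"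
    and wf: "wf_net a" "wf_net b" and dis: "edges a \<inter> edges b = {}"
    and a': "wf_net a'" "edges a' \<subseteq> edges a" "sp_sum (edges a - edges a') C"
      "argmax_weight u (t a) = C \<otimes> t a'" "argmax_weight u (c a) = C \<otimes> c a'"
    and b': "wf_net b'" "edges b' \<subseteq> edges b" "sp_sum (edges b - edges b') D"
      "argmax_weight u (t b) = D \<otimes> t b'" "argmax_weight u (c b) = D \<otimes> c b'"
  shows "\<exists>C' z. wf_net z \<and> edges z \<subseteq> edges (join a b) \<and> sp_sum (edges (join a b) - edges z) C' \<and>
    argmax_weight u (t (join a b)) = C' \<otimes> t z \<and> argmax_weight u (c (join a b)) = C' \<otimes> c z"
proof -
  note ne = net(1) [OF wf(1)] net(1) [OF wf(2)]
  have CD: "sp_sum ((edges a - edges a') \<union> (edges b - edges b')) (C \<otimes> D)"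
    using dis by (intro sp_sum_dprod a' b') auto
  have tc: "argmax_weight u (t a \<otimes> c b) = C \<otimes> t a' \<otimes> (D \<otimes> c b')"
    and ct: "argmax_weight u (c a \<otimes> t b) = C \<otimes> c a' \<otimes> (D \<otimes> t b')"
    and cc: "argmax_weight u (c a \<otimes> c b) = C \<otimes> c a' \<otimes> (D \<otimes> c b')"
    using argmax_weight_dprod [OF sub(1,2) dis, of u] argmax_weight_dprod [OF sub(2,1) dis, of u]
      argmax_weight_dprod [OF sub(2,2) dis, of u] ne a' b' by simp_all
  obtain I where I: "I \<in> argmax_weight u (t a \<otimes> c b)"
    using argmax_weight_nonempty dprod_nonempty [OF sub(1,2) dis] ne by metis
  obtain J where J: "J \<in> argmax_weight u (c a \<otimes> t b)"
    using argmax_weight_nonempty dprod_nonempty [OF sub(2,1) dis] ne by metis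
  consider "sum u J = sum u I" | "sum u J < sum u I" | "sum u I < sum u J" by linarith
  then show ?thesis
  proof cases
    case 1
    have "argmax_weight u (t (join a b)) = (C \<otimes> D) \<otimes> t (join a' b')"
      using argmax_weight_Un_eq [OF I J 1] tc ct by (simp add: join dprod_ac dprod_Un)
    moreover have "argmax_weight u (c (join a b)) = (C \<otimes> D) \<otimes> c (join a' b')"
      using cc by (simp add: join dprod_ac)
    moreover have "sp_sum (edges (join a b) - edges (join a' b')) (C \<otimes> D)"
      using CD by (rule sp_sum_mono) (use a'(2) b'(2) dis in \<open>auto simp: join\<close>)
    moreover have "wf_net (join a' b')" using a'(1,2) b'(1,2) dis by (auto simp: join)
    moreover have "edges (join a' b') \<subseteq> edges (join a b)" using a'(2) b'(2) by (auto simp: join)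
    ultimately show ?thesis by blast
  next
    case 2
    have "argmax_weight u (t (join a b)) = (C \<otimes> D \<otimes> c b') \<otimes> t a'"
      using argmax_weight_Un_less [OF I J 2] tc by (simp add: join dprod_ac)
    moreover have "argmax_weight u (c (join a b)) = (C \<otimes> D \<otimes> c b') \<otimes> c a'"
      using cc by (simp add: join dprod_ac)
    moreover have "sp_sum ((edges a - edges a') \<union> (edges b - edges b') \<union> edges b') (C \<otimes> D \<otimes> c b')"
      by (rule sp_sum_dprod [OF CD net(2) [OF b'(1)]]) (use a'(2) b'(2) dis in blast)
    then have "sp_sum (edges (join a b) - edges a') (C \<otimes> D \<otimes> c b')"
      by (rule sp_sum_mono) (use a'(2) b'(2) dis in \<open>auto simp: join\<close>)
    moreover have "edges a' \<subseteq> edges (join a b)" using a'(2) by (auto simp: join)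
    ultimately show ?thesis using a'(1) by blast
  next
    case 3
    have "argmax_weight u (t (join a b)) = (C \<otimes> D \<otimes> c a') \<otimes> t b'"
      using argmax_weight_Un_less [OF J I 3] ct by (simp add: join dprod_ac Un_commute)
    moreover have "argmax_weight u (c (join a b)) = (C \<otimes> D \<otimes> c a') \<otimes> c b'"
      using cc by (simp add: join dprod_ac)
    moreover have "sp_sum ((edges a - edges a') \<union> (edges b - edges b') \<union> edges a') (C \<otimes> D \<otimes> c a')"
      by (rule sp_sum_dprod [OF CD net(2) [OF a'(1)]]) (use a'(2) b'(2) dis in blast)
    then have "sp_sum (edges (join a b) - edges b') (C \<otimes> D \<otimes> c a')"
      by (rule sp_sum_mono) (use a'(2) b'(2) dis in \<open>auto simp: join\<close>)
    moreover have "edges b' \<subseteq> edges (join a b)" using b'(2) by (auto simp: join)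
    ultimately show ?thesis using b'(1) by blast
  qed
qed

text \<open>Trees and cuts are treated together, with the same split-off factor \<open>C\<close> and
  the same remaining network, because the recursion mixes them. If the two terms of a node tie, the
  node survives; otherwise one child survives as network and a family of the other is absorbed into
  \<open>C\<close>.\<close>

lemma net_face:
  fixes a :: "'a::finite net" and u :: "'a \<Rightarrow> real"
  assumes "wf_net a"
  shows "\<exists>C a'. wf_net a' \<and> edges a' \<subseteq> edges a \<and> sp_sum (edges a - edges a') C \<and>
    argmax_weight u (trees a) = C \<otimes> trees a' \<and> argmax_weight u (cuts a) = C \<otimes> cuts a'"
  using assms
proof (induction a)
  case (Edge e)
  have "argmax_weight u {{e}} = {{e}}" "argmax_weight u {{}} = {{}}" by (auto simp: argmax_weight_def)
  then show ?case using sp_sum_unit by (intro exI [of _ "{{}}"] exI [of _ "Edge e"]) auto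
next
  case (Par a b)
  then have wf: "wf_net a" "wf_net b" and dis: "edges a \<inter> edges b = {}" by auto
  obtain C a' where a': "wf_net a'" "edges a' \<subseteq> edges a" "sp_sum (edges a - edges a') C"
    "argmax_weight u (trees a) = C \<otimes> trees a'" "argmax_weight u (cuts a) = C \<otimes> cuts a'"
    using Par.IH(1) wf by blast
  obtain D b' where b': "wf_net b'" "edges b' \<subseteq> edges b" "sp_sum (edges b - edges b') D"
    "argmax_weight u (trees b) = D \<otimes> trees b'" "argmax_weight u (cuts b) = D \<otimes> cuts b'"
    using Par.IH(2) wf by blast
  show ?case
    by (rule net_face_join [OF _ _ _ _ trees_subset cuts_subset _ _ wf dis a' b'])
      (simp_all add: trees_cuts_nonempty sp_sum_trees_cuts)
next
  case (Ser a b)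
  then have wf: "wf_net a" "wf_net b" and dis: "edges a \<inter> edges b = {}" by auto
  obtain C a' where a': "wf_net a'" "edges a' \<subseteq> edges a" "sp_sum (edges a - edges a') C"
    "argmax_weight u (trees a) = C \<otimes> trees a'" "argmax_weight u (cuts a) = C \<otimes> cuts a'"
    using Ser.IH(1) wf by blast
  obtain D b' where b': "wf_net b'" "edges b' \<subseteq> edges b" "sp_sum (edges b - edges b') D"
    "argmax_weight u (trees b) = D \<otimes> trees b'" "argmax_weight u (cuts b) = D \<otimes> cuts b'"
    using Ser.IH(2) wf by blast
  have "\<exists>C z. wf_net z \<and> edges z \<subseteq> edges (Ser a b) \<and> sp_sum (edges (Ser a b) - edges z) C \<and>
      argmax_weight u (cuts (Ser a b)) = C \<otimes> cuts z \<and> argmax_weight u (trees (Ser a b)) = C \<otimes> trees z"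
    by (rule net_face_join [OF _ _ _ _ cuts_subset trees_subset _ _ wf dis a'(1-3,5,4) b'(1-3,5,4)])
      (simp_all add: trees_cuts_nonempty sp_sum_trees_cuts Un_commute)
  then show ?case by (elim exE conjE) (intro exI conjI)
qed

lemma sp_sum_face:
  fixes a :: "'a::finite net"
  assumes "wf_net a"
  shows "sp_sum (edges a) (argmax_weight u (trees a))"
proof -
  obtain C a' where a': "wf_net a'" "edges a' \<subseteq> edges a" "sp_sum (edges a - edges a') C"
    "argmax_weight u (trees a) = C \<otimes> trees a'"
    using net_face [OF assms] by blast
  have "sp_sum ((edges a - edges a') \<union> edges a') (C \<otimes> trees a')"
    by (rule sp_sum_dprod [OF a'(3) conjunct1 [OF sp_sum_trees_cuts [OF a'(1)]]]) auto
  then show ?thesis using a' by (simp add: Un_absorb2)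
qed

subsection \<open>Merging of blocks\<close>

definition zero_sum :: "'a set \<Rightarrow> ('a \<Rightarrow> real) \<Rightarrow> bool" where
  "zero_sum E w \<longleftrightarrow> (\<forall>x. x \<notin> E \<longrightarrow> w x = 0) \<and> sum w E = 0"

text \<open>The zero-sum spaces of the blocks form a direct sum; equivalently, the incidence graph
  between indices and elements has no cycle. The family is indexed because a priori the two cells
  may have a block in common.\<close>

definition independent_blocks :: "'i set \<Rightarrow> ('i \<Rightarrow> 'a set) \<Rightarrow> bool" where
  "independent_blocks K E \<longleftrightarrow> (\<forall>w. (\<forall>i\<in>K. zero_sum (E i) (w i)) \<longrightarrow> (\<forall>x. (\<Sum>i\<in>K. w i x) = 0) \<longrightarrow>
     (\<forall>i\<in>K. \<forall>x. w i x = 0))"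

lemma independent_blocksD:
  assumes "independent_blocks K E" "\<And>i. i \<in> K \<Longrightarrow> zero_sum (E i) (w i)" "\<And>x. (\<Sum>i\<in>K. w i x) = 0" "i \<in> K"
  shows "w i x = 0"
  using assms unfolding independent_blocks_def by blast

text \<open>A second common element \<open>f\<close> would give a dependency: the difference of the
  unit vectors at \<open>e\<close> and \<open>f\<close> on one block, and its negative on the
  other.\<close>

lemma independent_blocks_Int:
  fixes E :: "'i \<Rightarrow> 'a::finite set"
  assumes "independent_blocks K E" "finite K" "i \<in> K" "j \<in> K" "i \<noteq> j" "e \<in> E i \<inter> E j"
  shows "E i \<inter> E j = {e}"
proof (rule ccontr)
  assume "E i \<inter> E j \<noteq> {e}"
  then obtain f where f: "f \<in> E i" "f \<in> E j" "f \<noteq> e" using assms(6) by blast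
  define v :: "'a \<Rightarrow> real" where "v x = of_bool (x = e) - of_bool (x = f)" for x
  define w where "w k = (if k = i then v else if k = j then (\<lambda>x. - v x) else (\<lambda>_. 0))" for k
  have v: "sum v A = 0" if "e \<in> A" "f \<in> A" for A
    using that by (simp add: v_def sum_subtractf sum.delta of_bool_def)
  have "zero_sum (E k) (w k)" if "k \<in> K" for k
    using v [of "E i"] v [of "E j"] f assms(6) unfolding zero_sum_def w_def
    by (auto simp: sum_negf) (auto simp: v_def)
  moreover have "(\<Sum>k\<in>K. w k x) = 0" for x
  proof -
    have "(\<Sum>k\<in>K. w k x) = w i x + (\<Sum>k\<in>K - {i}. w k x)"
      using assms by (simp add: sum.remove)
    also have "(\<Sum>k\<in>K - {i}. w k x) = w j x + (\<Sum>k\<in>K - {i} - {j}. w k x)"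
      using assms by (intro sum.remove) auto
    also have "(\<Sum>k\<in>K - {i} - {j}. w k x) = 0"
      by (intro sum.neutral) (auto simp: w_def)
    finally show ?thesis using assms(5) by (simp add: w_def)
  qed
  ultimately have "w i e = 0" using independent_blocksD [OF assms(1)] assms(3) by blast
  then show False using f by (simp add: w_def v_def)
qed

text \<open>A zero-sum vector on the union of two blocks splits into zero-sum vectors on each, the
  coordinate at the common element \<open>e\<close> absorbing the imbalance. A dependency after the
  merge thus lifts to one before it.\<close>

lemma independent_blocks_merge:
  fixes E :: "'i \<Rightarrow> 'a::finite set"
  assumes "independent_blocks K E" "finite K" "i \<in> K" "j \<in> K" "i \<noteq> j" "E i \<inter> E j = {e}"
  shows "independent_blocks (K - {j}) (E(i := E i \<union> E j))"
  unfolding independent_blocks_def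
proof (intro allI impI)
  fix w
  assume z: "\<forall>k\<in>K - {j}. zero_sum ((E(i := E i \<union> E j)) k) (w k)"
    and s: "\<forall>x. (\<Sum>k\<in>K - {j}. w k x) = 0"
  define v1 where "v1 x = (if x \<in> E i - {e} then w i x else if x = e then - sum (w i) (E i - {e}) else 0)" for x
  define v2 where "v2 x = w i x - v1 x" for x
  have e: "e \<in> E i" "e \<in> E j" using assms(6) by auto
  have zi: "zero_sum (E i \<union> E j) (w i)" using z assms(3,5) by force
  have sum_v1: "sum v1 (E i) = 0"
    using e by (simp add: sum.remove [of "E i" e] v1_def)
  then have z1: "zero_sum (E i) v1" using e by (auto simp: zero_sum_def v1_def)
  have sum_v1': "sum v1 (E i \<union> E j) = sum v1 (E i)"
    using e by (intro sum.mono_neutral_right) (auto simp: v1_def)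
  have "v2 x = 0" if "x \<notin> E j" for x
    using that e zi by (auto simp: v2_def v1_def zero_sum_def)
  moreover from this have "sum v2 (E j) = sum v2 (E i \<union> E j)"
    by (intro sum.mono_neutral_left) auto
  ultimately have z2: "zero_sum (E j) v2"
    using sum_v1' sum_v1 zi by (simp add: zero_sum_def v2_def sum_subtractf)
  define w' where "w' = w(i := v1, j := v2)"
  have 1: "zero_sum (E k) (w' k)" if "k \<in> K" for k
    using z1 z2 that z [rule_format, of k] by (auto simp: w'_def)
  have 2: "(\<Sum>k\<in>K. w' k x) = 0" for x
  proof -
    have "(\<Sum>k\<in>K. w' k x) = w' j x + (\<Sum>k\<in>K - {j}. w' k x)"
      using assms by (intro sum.remove) auto
    also have "(\<Sum>k\<in>K - {j}. w' k x) = w' i x + (\<Sum>k\<in>K - {j} - {i}. w' k x)"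
      using assms by (intro sum.remove) auto
    also have "(\<Sum>k\<in>K - {j} - {i}. w' k x) = (\<Sum>k\<in>K - {j} - {i}. w k x)"
      by (intro sum.cong) (auto simp: w'_def)
    also have "w' j x + (w' i x + (\<Sum>k\<in>K - {j} - {i}. w k x)) = w i x + (\<Sum>k\<in>K - {j} - {i}. w k x)"
      using assms(5) by (simp add: w'_def v2_def)
    also have "\<dots> = (\<Sum>k\<in>K - {j}. w k x)"
      using assms by (intro sum.remove [symmetric]) auto
    finally show ?thesis using s by simp
  qed
  have 3: "w' k x = 0" if "k \<in> K" for k x
    using independent_blocksD [OF assms(1) 1 2 that] .
  show "\<forall>k\<in>K - {j}. \<forall>x. w k x = 0"
  proof (intro ballI allI)
    fix k x assume "k \<in> K - {j}"
    then show "w k x = 0"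
      using 3 [of k x] 3 [of i x] 3 [of j x] assms(3,4,5) by (cases "k = i") (auto simp: w'_def v2_def)
  qed
qed

text \<open>Induction on the number of indices, with two meeting blocks replaced by their series
  connection. Once no two blocks meet, nonempty edge sets make the indexing injective, so the
  indexed product becomes a product over a set of networks.\<close>

lemma independent_blocks_dprod:
  fixes a :: "'i \<Rightarrow> 'a::finite net"
  assumes "finite K" "\<And>i. i \<in> K \<Longrightarrow> block (a i)" "independent_blocks K (\<lambda>i. edges (a i))"
  shows "\<exists>K'. finite K' \<and> (\<forall>x\<in>K'. block x) \<and> (\<forall>x\<in>K'. \<forall>y\<in>K'. x \<noteq> y \<longrightarrow> edges x \<inter> edges y = {}) \<and>
     dprod.F trees K' = dprod.F (\<lambda>i. trees (a i)) K"
  using assms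
proof (induction "card K" arbitrary: K a)
  case 0
  then show ?case by (intro exI [of _ "{}"]) auto
next
  case (Suc n)
  show ?case
  proof (cases "\<forall>i\<in>K. \<forall>j\<in>K. i \<noteq> j \<longrightarrow> edges (a i) \<inter> edges (a j) = {}")
    case True
    then have "inj_on a K" using edges_nonempty by (metis Int_absorb inj_onI)
    then have "dprod.F trees (a ` K) = dprod.F (\<lambda>i. trees (a i)) K"
      by (simp add: dprod.reindex)
    moreover have "\<forall>x\<in>a ` K. \<forall>y\<in>a ` K. x \<noteq> y \<longrightarrow> edges x \<inter> edges y = {}"
    proof (intro ballI impI)
      fix x y assume "x \<in> a ` K" "y \<in> a ` K" "x \<noteq> y"
      then obtain i j where "i \<in> K" "j \<in> K" "x = a i" "y = a j" by blast
      then show "edges x \<inter> edges y = {}" using True \<open>x \<noteq> y\<close> by metis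
    qed
    ultimately show ?thesis using Suc.prems by (intro exI [of _ "a ` K"]) auto
  next
    case False
    then obtain i j e where ij: "i \<in> K" "j \<in> K" "i \<noteq> j" "e \<in> edges (a i) \<inter> edges (a j)" by blast
    then have e: "edges (a i) \<inter> edges (a j) = {e}"
      using independent_blocks_Int [OF Suc.prems(3) Suc.prems(1)] by blast
    obtain z where z: "block z" "edges z = edges (a i) \<union> edges (a j)"
      "trees z = trees (a i) \<otimes> trees (a j)"
      using block_merge [OF Suc.prems(2) [OF ij(1)] Suc.prems(2) [OF ij(2)] e] by blast
    let ?a = "a(i := z)" and ?K = "K - {j}"
    have "(\<lambda>k. edges (?a k)) = (\<lambda>k. edges (a k))(i := edges (a i) \<union> edges (a j))"
      using z by (simp add: fun_eq_iff)
    then have "independent_blocks ?K (\<lambda>k. edges (?a k))"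
      using independent_blocks_merge [OF Suc.prems(3,1) ij(1-3) e] by simp
    moreover have "n = card ?K" "finite ?K" "\<And>k. k \<in> ?K \<Longrightarrow> block (?a k)"
      using Suc.hyps(2) Suc.prems ij z by auto
    ultimately obtain K' where K': "finite K'" "\<forall>x\<in>K'. block x"
      "\<forall>x\<in>K'. \<forall>y\<in>K'. x \<noteq> y \<longrightarrow> edges x \<inter> edges y = {}"
      "dprod.F trees K' = dprod.F (\<lambda>k. trees (?a k)) ?K"
      using Suc.hyps(1) [of ?K ?a] by blast
    have "dprod.F (\<lambda>k. trees (?a k)) ?K = trees z \<otimes> dprod.F (\<lambda>k. trees (?a k)) (?K - {i})"
      using ij Suc.prems(1) by (subst dprod.remove [of _ i]) auto
    also have "dprod.F (\<lambda>k. trees (?a k)) (?K - {i}) = dprod.F (\<lambda>k. trees (a k)) (?K - {i})"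
      by (intro dprod.cong) auto
    also have "trees z \<otimes> dprod.F (\<lambda>k. trees (a k)) (?K - {i}) =
        trees (a j) \<otimes> (trees (a i) \<otimes> dprod.F (\<lambda>k. trees (a k)) (?K - {i}))"
      using z by (simp add: dprod_ac)
    also have "trees (a i) \<otimes> dprod.F (\<lambda>k. trees (a k)) (?K - {i}) = dprod.F (\<lambda>k. trees (a k)) ?K"
      using ij Suc.prems(1) by (intro dprod.remove [symmetric]) auto
    also have "trees (a j) \<otimes> dprod.F (\<lambda>k. trees (a k)) ?K = dprod.F (\<lambda>k. trees (a k)) K"
      using ij Suc.prems(1) by (intro dprod.remove [symmetric]) auto
    finally show ?thesis using K' by auto
  qed
qed

subsection \<open>Valuated matroids\<close>

text \<open>The exchange axiom of Dress and Wenzel in its version for minima. The three-term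
  relations are its local form, for sets that differ in two elements.\<close>

definition valuated_matroid :: "nat \<Rightarrow> ('n::finite set \<Rightarrow> real) \<Rightarrow> bool" where
  "valuated_matroid d p \<longleftrightarrow> (\<forall>I B i. card I = d \<longrightarrow> card B = d \<longrightarrow> i \<in> I - B \<longrightarrow>
     (\<exists>j\<in>B - I. p (insert j (I - {i})) + p (insert i (B - {j})) \<le> p I + p B))"

lemma valuated_exchange:
  assumes "valuated_matroid d p" "card I = d" "card B = d" "i \<in> I" "i \<notin> B"
  obtains j where "j \<in> B" "j \<notin> I" "p (insert j (I - {i})) + p (insert i (B - {j})) \<le> p I + p B"
  using assms unfolding valuated_matroid_def by blast

lemma finite_obtains_min:
  fixes g :: "'a \<Rightarrow> real"
  assumes "finite A" "A \<noteq> {}"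
  obtains a where "a \<in> A" "\<And>b. b \<in> A \<Longrightarrow> g a \<le> g b"
proof -
  have "Min (g ` A) \<in> g ` A" using assms by simp
  then obtain a where "a \<in> A" "g a = Min (g ` A)" by auto
  then show thesis using that [of a] assms(1) by simp
qed

lemma card_insert_Diff:
  fixes I :: "'n::finite set"
  shows "i \<in> I \<Longrightarrow> j \<notin> I \<Longrightarrow> card (insert j (I - {i})) = card I"
  by (metis Diff_iff card_Suc_Diff1 card_insert_disjoint finite)

lemma card_complement: "card (- I) = CARD('n) - card (I :: 'n::finite set)"
  by (simp add: Compl_eq_Diff_UNIV card_Diff_subset)

text \<open>Local to global, by induction on the distance of \<open>I\<close> and \<open>B\<close>.
  If the exchange fails, then \<open>B\<close> is moved one step towards \<open>I\<close> without
  touching \<open>i\<close>; an exchange for the new set \<open>B'\<close> and one three-term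
  relation around \<open>B\<close> contradict the failure.\<close>

lemma tropical_plucker_valuated:
  assumes "tropical_plucker d p"
  shows "valuated_matroid d p"
proof -
  have "\<exists>j\<in>B - I. p (insert j (I - {i})) + p (insert i (B - {j})) \<le> p I + p B"
    if "card I = d" "card B = d" "i \<in> I" "i \<notin> B" for I B i
    using that
  proof (induction "card (I - B)" arbitrary: B rule: less_induct)
    case less
    show ?case
    proof (rule ccontr)
      assume "\<not> ?thesis"
      then have viol: "p I + p B < p (insert v (I - {i})) + p (insert i (B - {v}))"
        if "v \<in> B - I" for v using that by (meson not_le)
      define w where "w v = p (insert v (I - {i})) - p I" for v
      have card_eq: "card (I - B) = card (B - I)"
        using less.prems by (metis card_le_sym_Diff finite le_antisym order_refl)
      have ne: "B - I \<noteq> {}"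
        using card_eq less.prems by (metis Diff_iff card_0_eq empty_iff finite)
      have "\<exists>u. u \<in> I - B \<and> u \<noteq> i"
      proof (rule ccontr)
        assume "\<not> ?thesis"
        then have IB: "I - B = {i}" using less.prems by blast
        then obtain v where BI: "B - I = {v}" using card_eq by (metis card_1_singletonE card.empty card_insert_disjoint empty_iff finite.emptyI One_nat_def)
        have "insert v (I - {i}) = B" "insert i (B - {v}) = I" using IB BI by blast+
        then show False using viol [of v] BI by simp
      qed
      then obtain u where u: "u \<in> I" "u \<notin> B" "u \<noteq> i" by blast
      \<comment> \<open>Minimality of \<open>v0\<close> refutes the alternative of the three-term
        relation that contains \<open>p (insert u (B - {v}))\<close>. The alternative that contains
        \<open>p B'\<close> is refuted by the failure at \<open>v\<close> alone.\<close>
      obtain v0 where v0: "v0 \<in> B - I"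
        and min: "\<And>v. v \<in> B - I \<Longrightarrow> p (insert u (B - {v0})) + w v0 \<le> p (insert u (B - {v})) + w v"
        using finite_obtains_min [OF _ ne, of "\<lambda>v. p (insert u (B - {v})) + w v"] by auto
      define B' where "B' = insert u (B - {v0})"
      have "card (I - B') < card (I - B)"
        using u v0 by (intro psubset_card_mono) (auto simp: B'_def)
      moreover have "card B' = d" using card_insert_Diff [of v0 B u] u v0 less.prems by (simp add: B'_def)
      moreover have "i \<notin> B'" using u less.prems by (auto simp: B'_def)
      ultimately obtain v where v: "v \<in> B' - I"
        and ex: "p (insert v (I - {i})) + p (insert i (B' - {v})) \<le> p I + p B'"
        using less.hyps less.prems by blast
      have vB: "v \<in> B" "v \<noteq> v0" "v \<notin> I" using v u by (auto simp: B'_def)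
      define S where "S = B - {v0, v}"
      have "B = insert v0 (insert v S)" "v0 \<notin> insert v S" "v \<notin> S"
        using vB v0 by (auto simp: S_def)
      then have "card B = card S + 2" by (metis Suc_1 add_Suc_right add_2_eq_Suc' card_insert_disjoint finite)
      then have S: "card S + 2 = d" using less.prems by simp
      have "distinct [v0, v, u, i]" "{v0, v, u, i} \<inter> S = {}"
        using vB v0 u less.prems by (auto simp: S_def)
      then have m: "min3_attained_twice (p (S \<union> {v0, v}) + p (S \<union> {u, i}))
          (p (S \<union> {v0, u}) + p (S \<union> {v, i})) (p (S \<union> {v0, i}) + p (S \<union> {v, u}))"
        using assms S unfolding tropical_plucker_def by blast
      have eqs: "S \<union> {v0, v} = B" "S \<union> {u, i} = insert i (B' - {v})" "S \<union> {v0, u} = insert u (B - {v})"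
        "S \<union> {v, i} = insert i (B - {v0})" "S \<union> {v0, i} = insert i (B - {v})" "S \<union> {v, u} = B'"
        using vB v0 u less.prems by (auto simp: S_def B'_def)
      have "p (insert u (B - {v})) + p (insert i (B - {v0})) \<le> p B + p (insert i (B' - {v})) \<or>
          p (insert i (B - {v})) + p B' \<le> p B + p (insert i (B' - {v}))"
        using m unfolding eqs min3_attained_twice_def by linarith
      moreover have "p I + p B < p (insert v (I - {i})) + p (insert i (B - {v}))"
        using viol vB by blast
      moreover have "p I + p B < p (insert v0 (I - {i})) + p (insert i (B - {v0}))"
        using viol v0 by blast
      moreover have "p B' + w v0 \<le> p (insert u (B - {v})) + w v"
        using min vB by (simp add: B'_def)
      ultimately show False using ex unfolding w_def by linarith
    qed
  qed
  then show ?thesis unfolding valuated_matroid_def by blast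
qed

lemma valuated_shift:
  fixes p :: "'n::finite set \<Rightarrow> real"
  assumes "valuated_matroid d p"
  shows "valuated_matroid d (\<lambda>I. p I - (\<Sum>i\<in>I. w $ i))"
  unfolding valuated_matroid_def
proof (intro allI impI)
  fix I B :: "'n set" and i assume *: "card I = d" "card B = d" "i \<in> I - B"
  then obtain j where j: "j \<in> B" "j \<notin> I" "p (insert j (I - {i})) + p (insert i (B - {j})) \<le> p I + p B"
    using valuated_exchange [OF assms] by blast
  have "(\<Sum>k\<in>insert j (I - {i}). w $ k) = (\<Sum>k\<in>I. w $ k) - w $ i + w $ j"
    using * j by (simp add: sum_diff1)
  moreover have "(\<Sum>k\<in>insert i (B - {j}). w $ k) = (\<Sum>k\<in>B. w $ k) - w $ j + w $ i"
    using * j by (simp add: sum_diff1)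
  ultimately show "\<exists>j\<in>B - I. (p (insert j (I - {i})) - (\<Sum>k\<in>insert j (I - {i}). w $ k)) +
      (p (insert i (B - {j})) - (\<Sum>k\<in>insert i (B - {j}). w $ k)) \<le>
      (p I - (\<Sum>k\<in>I. w $ k)) + (p B - (\<Sum>k\<in>B. w $ k))"
    using j by (intro bexI [of _ j]) auto
qed

text \<open>An element of \<open>I - B\<close> lies in \<open>- B\<close> and not in
  \<open>- I\<close>, so complementation swaps the roles of the two sets.\<close>

lemma valuated_dual:
  assumes "valuated_matroid d p" "d \<le> CARD('n)"
  shows "valuated_matroid (CARD('n::finite) - d) (dual_plucker (p :: 'n set \<Rightarrow> real))"
  unfolding valuated_matroid_def
proof (intro allI impI)
  fix I B :: "'n set" and i assume *: "card I = CARD('n) - d" "card B = CARD('n) - d" "i \<in> I - B"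
  then have "card (- I) = d" "card (- B) = d" using assms(2) by (simp_all add: card_complement)
  then obtain j where j: "j \<in> - I" "j \<notin> - B"
    "p (insert j (- B - {i})) + p (insert i (- I - {j})) \<le> p (- B) + p (- I)"
    using valuated_exchange [OF assms(1), of "- B" "- I" i] * by auto
  moreover have "UNIV - insert j (I - {i}) = insert i (- I - {j})"
    "UNIV - insert i (B - {j}) = insert j (- B - {i})" using j * by auto
  ultimately show "\<exists>j\<in>B - I. dual_plucker p (insert j (I - {i})) + dual_plucker p (insert i (B - {j}))
      \<le> dual_plucker p I + dual_plucker p B"
    by (intro bexI [of _ j]) (auto simp: dual_plucker_def Compl_eq_Diff_UNIV)
qed

section \<open>Union of valuated matroids by identification of elements\<close>

definition exchange_closed :: "('a set \<times> real) set \<Rightarrow> bool" where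
  "exchange_closed R \<longleftrightarrow> (\<forall>X s Y t i. (X, s) \<in> R \<longrightarrow> (Y, t) \<in> R \<longrightarrow> i \<in> X \<longrightarrow> i \<notin> Y \<longrightarrow>
     (\<exists>j s' t'. j \<in> Y \<and> j \<notin> X \<and> (insert j (X - {i}), s') \<in> R \<and> (insert i (Y - {j}), t') \<in> R \<and>
       s' + t' \<le> s + t))"

lemma exchange_closedE:
  assumes "exchange_closed R" "(X, s) \<in> R" "(Y, t) \<in> R" "i \<in> X" "i \<notin> Y"
  obtains j s' t' where "j \<in> Y" "j \<notin> X" "(insert j (X - {i}), s') \<in> R" "(insert i (Y - {j}), t') \<in> R"
    "s' + t' \<le> s + t"
  using assms unfolding exchange_closed_def by blast

text \<open>Induction of a matroid along a map of ground sets, restricted to the sets that are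
  mapped injectively. A set may receive several costs, one for each preimage; keeping all of them
  instead of their minimum is the reason for working with relations.\<close>

definition push_family :: "('a \<Rightarrow> 'b) \<Rightarrow> ('a set \<times> real) set \<Rightarrow> ('b set \<times> real) set" where
  "push_family h R = {(h ` Z, s) | Z s. (Z, s) \<in> R \<and> inj_on h Z}"

lemma push_familyI: "(Z, s) \<in> R \<Longrightarrow> inj_on h Z \<Longrightarrow> X = h ` Z \<Longrightarrow> (X, s) \<in> push_family h R"
  unfolding push_family_def by blast

lemma push_familyE:
  assumes "(X, s) \<in> push_family h R"
  obtains Z where "X = h ` Z" "(Z, s) \<in> R" "inj_on h Z"
  using assms unfolding push_family_def by blast

lemma push_family_comp: "push_family g (push_family h R) = push_family (g \<circ> h) R"
proof (intro equalityI subrelI)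
  fix X s assume "(X, s) \<in> push_family g (push_family h R)"
  then obtain Z where "X = g ` h ` Z" "(Z, s) \<in> R" "inj_on h Z" "inj_on g (h ` Z)"
    by (metis push_familyE)
  then show "(X, s) \<in> push_family (g \<circ> h) R"
    by (intro push_familyI [of Z]) (auto simp: comp_inj_on image_comp)
next
  fix X s assume "(X, s) \<in> push_family (g \<circ> h) R"
  then obtain Z where Z: "X = (g \<circ> h) ` Z" "(Z, s) \<in> R" "inj_on (g \<circ> h) Z" by (rule push_familyE)
  then show "(X, s) \<in> push_family g (push_family h R)"
    by (intro push_familyI [of "h ` Z" s] push_familyI [of Z s])
      (auto simp: image_comp intro: inj_on_imageI inj_on_imageI2)
qed

text \<open>Identifying the elements \<open>a\<close> and \<open>b\<close>. The only delicate case has \<open>a\<close> in the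
  representative of one set and \<open>b\<close> in that of the other: if exchanging leads back to the same two
  sets, then with representatives swapped, one of the swapped representatives is at
  least as good as the original, so one may assume that both sets use \<open>a\<close> or both use \<open>b\<close>.\<close>

lemma exchange_closed_identify:
  fixes a b :: 'a
  assumes R: "exchange_closed R" and "a \<noteq> b"
  shows "exchange_closed (push_family (id(b := a)) R)"
proof -
  define h where "h = id(b := a)"
  have h: "h b = a" "\<And>x. x \<noteq> b \<Longrightarrow> h x = x" by (auto simp: h_def)
  have inj: "inj_on h Z \<longleftrightarrow> \<not> (a \<in> Z \<and> b \<in> Z)" for Z
    using \<open>a \<noteq> b\<close> by (auto simp: inj_on_def h_def)
  have img: "x \<in> h ` Z \<longleftrightarrow> x \<noteq> b \<and> (x \<in> Z \<or> x = a \<and> b \<in> Z)" for x Z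
    using \<open>a \<noteq> b\<close> by (auto simp: h_def image_iff)
  note mem = push_familyI [of _ _ R h]
  define good where "good X Y i s t \<longleftrightarrow> (\<exists>j s' t'. j \<in> Y \<and> j \<notin> X \<and>
     (insert j (X - {i}), s') \<in> push_family h R \<and> (insert i (Y - {j}), t') \<in> push_family h R \<and>
     s' + t' \<le> s + t)" for X Y i s t
  have goodI: "good X Y i s t"
    if "j \<in> Y" "j \<notin> X" "(Z, s') \<in> R" "\<not> (a \<in> Z \<and> b \<in> Z)" "insert j (X - {i}) = h ` Z"
      "(W, t') \<in> R" "\<not> (a \<in> W \<and> b \<in> W)" "insert i (Y - {j}) = h ` W" "s' + t' \<le> s + t"
    for X Y i s t j Z s' W t'
    unfolding good_def using that mem inj by blast
  have easy: "good (h ` Z) (h ` W) i s t"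
    if Z: "(Z, s) \<in> R" "\<not> (a \<in> Z \<and> b \<in> Z)" and W: "(W, t) \<in> R" "\<not> (a \<in> W \<and> b \<in> W)"
      and i: "i \<in> h ` Z" "i \<notin> h ` W"
      and same: "\<not> (a \<in> Z \<and> b \<in> W)" "\<not> (b \<in> Z \<and> a \<in> W)" for Z W i s t
  proof -
    obtain i' where i': "i' \<in> Z" "h i' = i" using i by blast
    then have "i' \<notin> W" using i by blast
    then obtain j' s' t' where j: "j' \<in> W" "j' \<notin> Z" "(insert j' (Z - {i'}), s') \<in> R"
      "(insert i' (W - {j'}), t') \<in> R" "s' + t' \<le> s + t"
      using exchange_closedE [OF R Z(1) W(1) i'(1)] by blast
    have hj: "h j' \<in> h ` W" "h j' \<notin> h ` Z"
      using j same \<open>a \<noteq> b\<close> by (auto simp: img h_def split: if_splits)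
    show ?thesis
    proof (rule goodI [OF hj j(3) _ _ j(4) _ _ j(5)])
      show "\<not> (a \<in> insert j' (Z - {i'}) \<and> b \<in> insert j' (Z - {i'}))"
        using j Z same \<open>a \<noteq> b\<close> by auto
      show "\<not> (a \<in> insert i' (W - {j'}) \<and> b \<in> insert i' (W - {j'}))"
        using j W i' i same \<open>a \<noteq> b\<close> by (auto simp: img)
      show "insert (h j') (h ` Z - {i}) = h ` insert j' (Z - {i'})"
        using inj [of Z] Z(2) i' by (auto simp: inj_on_def)
      show "insert i (h ` W - {h j'}) = h ` insert i' (W - {j'})"
        using inj [of W] W(2) i' j by (auto simp: inj_on_def)
    qed
  qed
  have hard: "good (h ` Z) (h ` W) i s t"
    if ab: "c \<in> Z" "c' \<in> W" "{c, c'} = {a, b}" and Z: "(Z, s) \<in> R" "\<not> (a \<in> Z \<and> b \<in> Z)"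
      and W: "(W, t) \<in> R" "\<not> (a \<in> W \<and> b \<in> W)"
      and i: "i \<in> h ` Z" "i \<notin> h ` W" for Z W i s t c c'
  proof -
    have cc: "c \<noteq> c'" "c' \<notin> Z" "c \<notin> W" "c = a \<and> c' = b \<or> c = b \<and> c' = a"
      using ab Z W \<open>a \<noteq> b\<close> by (auto simp: doubleton_eq_iff)
    have ia: "i \<noteq> a" "i \<noteq> b" using i ab cc by (auto simp: img)
    then have iZ: "i \<in> Z" "i \<notin> W" using i by (auto simp: img)
    obtain j s' t' where j: "j \<in> W" "j \<notin> Z" "(insert j (Z - {i}), s') \<in> R"
      "(insert i (W - {j}), t') \<in> R" "s' + t' \<le> s + t"
      using exchange_closedE [OF R Z(1) W(1) iZ] .
    show ?thesis
    proof (cases "j = c'")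
      case False
      then have jab: "j \<noteq> a" "j \<noteq> b" using j cc ab by blast+
      show ?thesis
      proof (rule goodI [OF _ _ j(3) _ _ j(4) _ _ j(5)])
        show "j \<in> h ` W" "j \<notin> h ` Z" using j jab by (auto simp: img)
        show "\<not> (a \<in> insert j (Z - {i}) \<and> b \<in> insert j (Z - {i}))"
          "\<not> (a \<in> insert i (W - {j}) \<and> b \<in> insert i (W - {j}))" using jab ia Z W by auto
        show "insert j (h ` Z - {i}) = h ` insert j (Z - {i})"
          "insert i (h ` W - {j}) = h ` insert i (W - {j})"
          using jab ia by (auto simp: img set_eq_iff simp del: image_insert)
      qed
    next
      case True
      \<comment> \<open>The exchange has put both \<open>a\<close> and \<open>b\<close> into
        \<open>?Z\<close>, which is therefore not mapped injectively. A second exchange moves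
        \<open>c\<close> over to \<open>?W\<close>.\<close>
      let ?Z = "insert c' (Z - {i})" and ?W = "insert i (W - {c'})"
      have "c \<in> ?Z" "c \<notin> ?W" using ab cc ia by auto
      moreover have "(?Z, s') \<in> R" "(?W, t') \<in> R" using j True by auto
      ultimately obtain k s'' t'' where k: "k \<in> ?W" "k \<notin> ?Z" "(insert k (?Z - {c}), s'') \<in> R"
        "(insert c (?W - {k}), t'') \<in> R" "s'' + t'' \<le> s' + t'"
        using exchange_closedE [OF R, of ?Z s' ?W t' c] by metis
      have kab: "k \<noteq> a" "k \<noteq> b" using k ia cc by auto
      show ?thesis
      proof (cases "k = i")
        case False
        show ?thesis
        proof (rule goodI [OF _ _ k(3) _ _ k(4)])
          show "k \<in> h ` W" "k \<notin> h ` Z" using k kab False by (auto simp: img)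
          show "\<not> (a \<in> insert k (?Z - {c}) \<and> b \<in> insert k (?Z - {c}))"
            "\<not> (a \<in> insert c (?W - {k}) \<and> b \<in> insert c (?W - {k}))" using kab ia ab cc by auto
          show "insert k (h ` Z - {i}) = h ` insert k (?Z - {c})"
            using kab ia ab cc by (auto simp: img set_eq_iff simp del: image_insert)
          show "insert i (h ` W - {k}) = h ` insert c (?W - {k})"
            using kab ia ab cc False by (auto simp: img set_eq_iff simp del: image_insert)
          show "s'' + t'' \<le> s + t" using k j by linarith
        qed
      next
        case True
        have Z': "insert k (?Z - {c}) = insert c' (Z - {c})" "h ` insert c' (Z - {c}) = h ` Z"
          using True iZ ab cc ia by (auto simp: img set_eq_iff simp del: image_insert)
        have W': "insert c (?W - {k}) = insert c (W - {c'})" "h ` insert c (W - {c'}) = h ` W"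
          using True iZ ab cc ia by (auto simp: img set_eq_iff simp del: image_insert)
        have "s'' \<le> s \<or> t'' \<le> t" using k j by linarith
        then show ?thesis
        proof
          assume "s'' \<le> s"
          moreover have "good (h ` insert c' (Z - {c})) (h ` W) i s'' t"
            using k(3) Z' W Z i ab cc by (intro easy) auto
          ultimately show ?thesis unfolding Z' good_def by (meson add_mono order_refl order_trans)
        next
          assume "t'' \<le> t"
          moreover have "good (h ` Z) (h ` insert c (W - {c'})) i s t''"
            using k(4) W' W Z i ab cc by (intro easy) auto
          ultimately show ?thesis unfolding W' good_def by (meson add_mono order_refl order_trans)
        qed
      qed
    qed
  qed
  have "good X Y i s t" if XY: "(X, s) \<in> push_family h R" "(Y, t) \<in> push_family h R" "i \<in> X" "i \<notin> Y" for X Y i s t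
  proof -
    obtain Z where Z: "X = h ` Z" "(Z, s) \<in> R" "inj_on h Z" using XY(1) by (rule push_familyE)
    obtain W where W: "Y = h ` W" "(W, t) \<in> R" "inj_on h W" using XY(2) by (rule push_familyE)
    note ZW = Z(2) Z(3) [unfolded inj] W(2) W(3) [unfolded inj]
      XY(3) [unfolded Z(1)] XY(4) [unfolded W(1)]
    show ?thesis
    proof (cases "a \<in> Z \<and> b \<in> W \<or> b \<in> Z \<and> a \<in> W")
      case True
      then show ?thesis unfolding Z(1) W(1)
        using hard [OF _ _ _ ZW, of a b] hard [OF _ _ _ ZW, of b a] by (auto simp: insert_commute)
    next
      case False
      then show ?thesis unfolding Z(1) W(1) using easy [OF ZW] by blast
    qed
  qed
  then show ?thesis unfolding exchange_closed_def good_def h_def by blast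
qed

lemma exchange_closed_direct_sum:
  fixes p p' :: "'n::finite set \<Rightarrow> real"
  assumes "valuated_matroid d p" "valuated_matroid d' p'"
  shows "exchange_closed {(Inl ` A \<union> Inr ` A', p A + p' A') | A A'. card A = d \<and> card A' = d'}"
    (is "exchange_closed ?R")
  unfolding exchange_closed_def
proof (intro allI impI)
  fix X s Y t i assume XR: "(X, s) \<in> ?R" and YR: "(Y, t) \<in> ?R" and i: "i \<in> X" "i \<notin> Y"
  obtain A A' where X: "X = Inl ` A \<union> Inr ` A'" "s = p A + p' A'" "card A = d" "card A' = d'"
    using XR by blast
  obtain B B' where Y: "Y = Inl ` B \<union> Inr ` B'" "t = p B + p' B'" "card B = d" "card B' = d'"
    using YR by blast
  have mem: "(Z, r) \<in> ?R" if "Z = Inl ` C \<union> Inr ` C'" "r = p C + p' C'" "card C = d" "card C' = d'" for Z r C C'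
    using that by blast
  show "\<exists>j s' t'. j \<in> Y \<and> j \<notin> X \<and> (insert j (X - {i}), s') \<in> ?R \<and> (insert i (Y - {j}), t') \<in> ?R \<and> s' + t' \<le> s + t"
  proof (cases i)
    case (Inl x)
    then have x: "x \<in> A" "x \<notin> B" using i X Y by auto
    obtain y where y: "y \<in> B" "y \<notin> A" "p (insert y (A - {x})) + p (insert x (B - {y})) \<le> p A + p B"
      using valuated_exchange [OF assms(1) X(3) Y(3) x] .
    have c: "card (insert y (A - {x})) = d" "card (insert x (B - {y})) = d"
      using card_insert_Diff x y X Y by metis+
    have "(insert (Inl y) (X - {i}), p (insert y (A - {x})) + p' A') \<in> ?R"
      by (rule mem [OF _ refl c(1) X(4)]) (use X Inl in auto)
    moreover have "(insert i (Y - {Inl y}), p (insert x (B - {y})) + p' B') \<in> ?R"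
      by (rule mem [OF _ refl c(2) Y(4)]) (use Y Inl in auto)
    moreover have "Inl y \<in> Y" "Inl y \<notin> X" using X Y y by auto
    moreover have "p (insert y (A - {x})) + p' A' + (p (insert x (B - {y})) + p' B') \<le> s + t"
      using y X Y by linarith
    ultimately show ?thesis by blast
  next
    case (Inr x)
    then have x: "x \<in> A'" "x \<notin> B'" using i X Y by auto
    obtain y where y: "y \<in> B'" "y \<notin> A'" "p' (insert y (A' - {x})) + p' (insert x (B' - {y})) \<le> p' A' + p' B'"
      using valuated_exchange [OF assms(2) X(4) Y(4) x] .
    have c: "card (insert y (A' - {x})) = d'" "card (insert x (B' - {y})) = d'"
      using card_insert_Diff x y X Y by metis+
    have "(insert (Inr y) (X - {i}), p A + p' (insert y (A' - {x}))) \<in> ?R"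
      by (rule mem [OF _ refl X(3) c(1)]) (use X Inr in auto)
    moreover have "(insert i (Y - {Inr y}), p B + p' (insert x (B' - {y}))) \<in> ?R"
      by (rule mem [OF _ refl Y(3) c(2)]) (use Y Inr in auto)
    moreover have "Inr y \<in> Y" "Inr y \<notin> X" using X Y y by auto
    moreover have "p A + p' (insert y (A' - {x})) + (p B + p' (insert x (B' - {y}))) \<le> s + t"
      using y X Y by linarith
    ultimately show ?thesis by blast
  qed
qed

lemma exchange_closed_push_id: "exchange_closed R \<Longrightarrow> exchange_closed (push_family id R)"
  unfolding push_family_def by simp

text \<open>On two disjoint copies of the ground set the exchange takes place inside one summand.
  Identifying the copies of each element in turn keeps the exchange property, and a pair of sets is
  mapped injectively by the full identification exactly if it is disjoint. The costs belong to the
  given decompositions, no minimum being taken.\<close>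

lemma disjoint_union_exchange:
  fixes p p' :: "'n::finite set \<Rightarrow> real"
  assumes "valuated_matroid d p" "valuated_matroid d' p'"
    and A: "card A = d" "card A' = d'" "A \<inter> A' = {}" and B: "card B = d" "card B' = d'" "B \<inter> B' = {}"
    and i: "i \<in> A \<union> A'" "i \<notin> B \<union> B'"
  obtains j C C' D D' where "j \<in> B \<union> B'" "j \<notin> A \<union> A'"
    "card C = d" "card C' = d'" "C \<inter> C' = {}" "C \<union> C' = insert j (A \<union> A' - {i})"
    "card D = d" "card D' = d'" "D \<inter> D' = {}" "D \<union> D' = insert i (B \<union> B' - {j})"
    "p C + p' C' + (p D + p' D') \<le> p A + p' A' + (p B + p' B')"
proof -
  define R where "R = {(Inl ` A \<union> Inr ` A', p A + p' A') | A A'. card A = d \<and> card A' = d'}"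
  define h :: "'n set \<Rightarrow> 'n + 'n \<Rightarrow> 'n + 'n" where
    "h E z = (case z of Inl y \<Rightarrow> Inl y | Inr y \<Rightarrow> if y \<in> E then Inl y else Inr y)" for E z
  have "exchange_closed (push_family (h E) R)" for E
  proof (induction E rule: finite_induct [OF finite])
    case 1
    have "h {} = id" by (auto simp: h_def fun_eq_iff split: sum.splits)
    moreover have "exchange_closed R"
      unfolding R_def by (rule exchange_closed_direct_sum [OF assms(1,2)])
    ultimately show ?case using exchange_closed_push_id by metis
  next
    case (2 e E)
    have "id(Inr e := Inl e) \<circ> h E = h (insert e E)"
      by (auto simp: h_def fun_eq_iff split: sum.splits)
    then show ?case
      using exchange_closed_identify [OF 2(3), of "Inl e" "Inr e"] unfolding push_family_comp by simp
  qed
  note ex = this [of UNIV]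
  have img: "h UNIV ` (Inl ` C \<union> Inr ` C') = Inl ` (C \<union> C')" for C C'
    by (simp add: h_def image_Un image_image)
  have inj: "inj_on (h UNIV) (Inl ` C \<union> Inr ` C') \<longleftrightarrow> C \<inter> C' = {}" for C C'
    by (auto simp: h_def inj_on_def ball_Un)
  have mem: "(Inl ` X, s) \<in> push_family (h UNIV) R \<longleftrightarrow>
      (\<exists>C C'. card C = d \<and> card C' = d' \<and> C \<inter> C' = {} \<and> X = C \<union> C' \<and> s = p C + p' C')" for X s
  proof
    assume "(Inl ` X, s) \<in> push_family (h UNIV) R"
    then obtain C C' where "card C = d" "card C' = d'" "s = p C + p' C'" "C \<inter> C' = {}"
      "(Inl :: 'n \<Rightarrow> 'n + 'n) ` X = Inl ` (C \<union> C')"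
      unfolding R_def by (elim push_familyE) (auto simp: img inj)
    then show "\<exists>C C'. card C = d \<and> card C' = d' \<and> C \<inter> C' = {} \<and> X = C \<union> C' \<and> s = p C + p' C'"
      by (metis inj_image_eq_iff inj_Inl)
  next
    assume "\<exists>C C'. card C = d \<and> card C' = d' \<and> C \<inter> C' = {} \<and> X = C \<union> C' \<and> s = p C + p' C'"
    then obtain C C' where C: "card C = d" "card C' = d'" "C \<inter> C' = {}" "X = C \<union> C'" "s = p C + p' C'" by blast
    show "(Inl ` X, s) \<in> push_family (h UNIV) R"
      by (rule push_familyI [of "Inl ` C \<union> Inr ` C'"]) (use C img inj in \<open>auto simp: R_def\<close>)
  qed
  have "(Inl ` (A \<union> A'), p A + p' A') \<in> push_family (h UNIV) R"
    "(Inl ` (B \<union> B'), p B + p' B') \<in> push_family (h UNIV) R" using A B mem by blast+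
  moreover have "Inl i \<in> (Inl :: 'n \<Rightarrow> 'n + 'n) ` (A \<union> A')" "Inl i \<notin> (Inl :: 'n \<Rightarrow> 'n + 'n) ` (B \<union> B')"
    using i by auto
  ultimately obtain z s' t' where z: "z \<in> (Inl :: 'n \<Rightarrow> 'n + 'n) ` (B \<union> B')" "z \<notin> Inl ` (A \<union> A')"
    "(insert z (Inl ` (A \<union> A') - {Inl i}), s') \<in> push_family (h UNIV) R"
    "(insert (Inl i) (Inl ` (B \<union> B') - {z}), t') \<in> push_family (h UNIV) R"
    "s' + t' \<le> p A + p' A' + (p B + p' B')"
    by (rule exchange_closedE [OF ex])
  from z(1) obtain j where j: "z = Inl j" "j \<in> B \<union> B'" by blast
  have eq: "insert (Inl x) (Inl ` X - {Inl y}) = (Inl :: 'n \<Rightarrow> 'n + 'n) ` insert x (X - {y})" for x y X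
    by auto
  obtain C C' where "card C = d" "card C' = d'" "C \<inter> C' = {}" "insert j (A \<union> A' - {i}) = C \<union> C'" "s' = p C + p' C'"
    using z(3) unfolding j eq mem by blast
  moreover obtain D D' where "card D = d" "card D' = d'" "D \<inter> D' = {}" "insert i (B \<union> B' - {j}) = D \<union> D'" "t' = p D + p' D'"
    using z(4) unfolding j eq mem by blast
  moreover have "j \<notin> A \<union> A'" using z(2) j by blast
  ultimately show thesis using that [of j C C' D D'] j(2) z(5) by simp
qed

section \<open>Exchange for stable intersections\<close>

lemma finite_pair_costs:
  fixes p p' :: "'n::finite set \<Rightarrow> real"
  shows "finite {p I + p' I' | I I'. P I I'}"
  by (rule finite_subset [of _ "(\<lambda>(I, I'). p I + p' I') ` UNIV"]) auto

lemma stable_intersection_le: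
  "card I = d \<Longrightarrow> card I' = d' \<Longrightarrow> I \<inter> I' = J \<Longrightarrow>
     stable_intersection d p d' p' J \<le> p I + p' (I' :: 'n::finite set)"
  unfolding stable_intersection_def
  by (intro Min_le finite_pair_costs) blast

text \<open>The size prescribed for the intersection forces the pair to cover the ground set. So the
  complements are disjoint and stable intersection is dual to disjoint union.\<close>

lemma Un_eq_UNIV:
  fixes I I' :: "'n::finite set"
  assumes "CARD('n) \<le> card I + card I'" "card (I \<inter> I') = card I + card I' - CARD('n)"
  shows "I \<union> I' = UNIV"
proof -
  have "card (I \<union> I') = CARD('n)" using card_Un_Int [of I I'] assms by simp
  then show ?thesis by (simp add: card_subset_eq)
qed

lemma stable_intersection_attained:
  fixes p p' :: "'n::finite set \<Rightarrow> real"
  assumes "d \<le> CARD('n)" "d' \<le> CARD('n)" "CARD('n) \<le> d + d'" "card J = d + d' - CARD('n)"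
  obtains I I' where "card I = d" "card I' = d'" "I \<inter> I' = J" "I \<union> I' = UNIV"
    "stable_intersection d p d' p' J = p I + p' I'"
proof -
  let ?A = "{p I + p' I' | I I'. card I = d \<and> card I' = d' \<and> I \<inter> I' = J}"
  have "CARD('n) - d \<le> card (- J)" using assms by (simp add: card_complement)
  \<comment> \<open>A feasible pair arises by splitting the complement of \<open>J\<close> into
    parts of sizes n - d and n - d', whose complements meet in \<open>J\<close>.\<close>
  then obtain K where K: "K \<subseteq> - J" "card K = CARD('n) - d" by (meson obtain_subset_with_card_n)
  define K' where "K' = - J - K"
  have "card K' = CARD('n) - d'"
    using K assms by (simp add: K'_def card_Diff_subset card_complement)
  then have "card (- K) = d" "card (- K') = d'" using K assms by (simp_all add: card_complement)
  moreover have "(- K) \<inter> (- K') = J" using K by (auto simp: K'_def)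
  ultimately have "?A \<noteq> {}" by blast
  moreover have "finite ?A" by (rule finite_pair_costs)
  ultimately have "Min ?A \<in> ?A" by (rule Min_in [rotated])
  then obtain I I' where I: "card I = d" "card I' = d'" "I \<inter> I' = J"
    "stable_intersection d p d' p' J = p I + p' I'"
    unfolding stable_intersection_def by auto
  then have "I \<union> I' = UNIV" using assms by (intro Un_eq_UNIV) auto
  then show thesis using that I by blast
qed

text \<open>The exchange for disjoint unions is applied to the complements of optimal pairs for
  \<open>J1\<close> and \<open>J2\<close>, in reversed order. The pairs obtained are feasible for
  the exchanged sets, and the stable intersection is at most their cost.\<close>

lemma stable_intersection_valuated:
  fixes p p' :: "'n::finite set \<Rightarrow> real"
  assumes "valuated_matroid d p" "valuated_matroid d' p'"
    "d \<le> CARD('n)" "d' \<le> CARD('n)" "CARD('n) \<le> d + d'"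
  shows "valuated_matroid (d + d' - CARD('n)) (stable_intersection d p d' p')"
  unfolding valuated_matroid_def
proof (intro allI impI)
  let ?q = "stable_intersection d p d' p'"
  fix J1 J2 :: "'n set" and i
  assume J: "card J1 = d + d' - CARD('n)" "card J2 = d + d' - CARD('n)" and i: "i \<in> J1 - J2"
  obtain A A' where A: "card A = d" "card A' = d'" "A \<inter> A' = J1" "A \<union> A' = UNIV" "?q J1 = p A + p' A'"
    using stable_intersection_attained [OF assms(3-5) J(1)] by metis
  obtain B B' where B: "card B = d" "card B' = d'" "B \<inter> B' = J2" "B \<union> B' = UNIV" "?q J2 = p B + p' B'"
    using stable_intersection_attained [OF assms(3-5) J(2)] by metis
  let ?p = "dual_plucker p" and ?p' = "dual_plucker p'"
  have c: "card (- A) = CARD('n) - d" "card (- A') = CARD('n) - d'" "(- A) \<inter> (- A') = {}"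
    "card (- B) = CARD('n) - d" "card (- B') = CARD('n) - d'" "(- B) \<inter> (- B') = {}"
    using A B by (auto simp: card_complement)
  have "i \<in> - B \<union> - B'" "i \<notin> - A \<union> - A'" using i A B by auto
  then obtain k C C' D D' where k: "k \<in> - A \<union> - A'" "k \<notin> - B \<union> - B'"
    and D: "card D = CARD('n) - d" "card D' = CARD('n) - d'" "D \<union> D' = insert k (- B \<union> - B' - {i})"
    and C: "card C = CARD('n) - d" "card C' = CARD('n) - d'" "C \<union> C' = insert i (- A \<union> - A' - {k})"
    and le: "?p D + ?p' D' + (?p C + ?p' C') \<le> ?p (- B) + ?p' (- B') + (?p (- A) + ?p' (- A'))"
    by (rule disjoint_union_exchange [OF valuated_dual [OF assms(1,3)] valuated_dual [OF assms(2,4)]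
          c(4-6) c(1-3)])
  have k: "k \<in> J2 - J1" using k A B by auto
  have C': "card (- C) = d" "card (- C') = d'" "(- C) \<inter> (- C') = insert k (J1 - {i})"
    using C A assms k i by (auto simp: card_complement)
  have D': "card (- D) = d" "card (- D') = d'" "(- D) \<inter> (- D') = insert i (J2 - {k})"
    using D B assms k i by (auto simp: card_complement)
  have le: "p (- C) + p' (- C') + (p (- D) + p' (- D')) \<le> p A + p' A' + (p B + p' B')"
    using le by (simp add: dual_plucker_def Compl_eq_Diff_UNIV [symmetric])
  have "?q (insert k (J1 - {i})) + ?q (insert i (J2 - {k})) \<le> ?q J1 + ?q J2"
    using stable_intersection_le [OF C', of p p'] stable_intersection_le [OF D', of p p'] le A(5) B(5)
    by linarith
  then show "\<exists>k\<in>J2 - J1. ?q (insert k (J1 - {i})) + ?q (insert i (J2 - {k})) \<le> ?q J1 + ?q J2"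
    using k by blast
qed

subsection \<open>Tropical linear spaces and their minimizers\<close>

text \<open>The vector with entries \<open>p (insert i S)\<close> outside \<open>S\<close> and
  infinity on \<open>S\<close> is a valuated cocircuit; large finite entries do as well. That a
  minimum is attained twice is the exchange between \<open>insert j S\<close> and
  \<open>J - {j}\<close>, where \<open>j\<close> is one minimizer and the exchanged element the
  other.\<close>

lemma cocircuit_point:
  fixes p :: "'n::finite set \<Rightarrow> real"
  assumes "valuated_matroid d p" "card S + 1 = d"
  obtains T where "\<And>x. (\<And>i. i \<notin> S \<Longrightarrow> x $ i = p (insert i S)) \<Longrightarrow> (\<And>i. i \<in> S \<Longrightarrow> T \<le> x $ i) \<Longrightarrow>
     x \<in> tropical_linear_space d p"
proof -
  \<comment> \<open>A bound for all absolute values of \<open>p\<close>: terms of the minimum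
    outside \<open>S\<close> are at most 2 K, and entries of at least 3 K on \<open>S\<close> keep
    the remaining terms at or above that.\<close>
  define K where "K = (\<Sum>I\<in>UNIV. \<bar>p I\<bar>)"
  have K: "\<bar>p I\<bar> \<le> K" for I unfolding K_def by (rule member_le_sum) auto
  show thesis
  proof (rule that [of "3 * K"])
    fix x :: "real ^ 'n"
    assume x: "\<And>i. i \<notin> S \<Longrightarrow> x $ i = p (insert i S)" and T: "\<And>i. i \<in> S \<Longrightarrow> 3 * K \<le> x $ i"
    have "min_attained_twice J (\<lambda>j. p (J - {j}) + x $ j)" if J: "card J = d + 1" for J
    proof -
      let ?g = "\<lambda>j. p (J - {j}) + x $ j"
      have "\<not> J \<subseteq> S" using card_mono [of S J] J assms(2) by auto
      then have "J - S \<noteq> {}" by blast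
      then obtain j where j: "j \<in> J - S" and min: "\<And>k. k \<in> J - S \<Longrightarrow> ?g j \<le> ?g k"
        using finite_obtains_min [of "J - S" ?g] by auto
      have "card (insert j S) = d" "card (J - {j}) = d" using j J assms(2) by auto
      then obtain f where f: "f \<in> J - {j}" "f \<notin> insert j S"
        "p (insert f (insert j S - {j})) + p (insert j (J - {j} - {f})) \<le> p (insert j S) + p (J - {j})"
        using valuated_exchange [OF assms(1), of "insert j S" "J - {j}" j] j by blast
      have "insert j S - {j} = S" "insert j (J - {j} - {f}) = J - {f}" using j f by auto
      then have "?g f \<le> ?g j" using f j x by simp
      moreover have "?g j \<le> ?g f" using min f by blast
      moreover have "?g j \<le> ?g k" if "k \<in> J" for k
      proof (cases "k \<in> S")
        case True
        have "?g j \<le> 2 * K" using K [of "J - {j}"] K [of "insert j S"] x j by auto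
        moreover have "2 * K \<le> ?g k" using K [of "J - {k}"] T [OF True] by auto
        ultimately show ?thesis by linarith
      qed (use that min in blast)
      ultimately show ?thesis
        unfolding min_attained_twice_def using j f by (intro bexI [of _ j] bexI [of _ f]) auto
    qed
    then show "x \<in> tropical_linear_space d p" by (simp add: tropical_linear_space_def)
  qed
qed

lemma cocircuit_point_large:
  fixes p :: "'n::finite set \<Rightarrow> real"
  assumes "valuated_matroid d p" "card S + 1 = d"
  obtains x where "x \<in> tropical_linear_space d p" "\<And>i. i \<notin> S \<Longrightarrow> x $ i = p (insert i S)"
    "\<And>i. i \<in> S \<Longrightarrow> c \<le> x $ i"
proof -
  obtain T where T: "\<And>x. (\<And>i. i \<notin> S \<Longrightarrow> x $ i = p (insert i S)) \<Longrightarrow> (\<And>i. i \<in> S \<Longrightarrow> T \<le> x $ i) \<Longrightarrow>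
     x \<in> tropical_linear_space d p" using cocircuit_point [OF assms] by blast
  let ?x = "\<chi> i. if i \<in> S then max T c else p (insert i S)"
  have "?x \<in> tropical_linear_space d p" by (rule T) auto
  then show thesis by (rule that) auto
qed

lemma exists_set_of_card: "k \<le> CARD('n) \<Longrightarrow> \<exists>S :: 'n::finite set. card S = k"
  by (metis obtain_subset_with_card_n)

text \<open>If d exceeded d', some \<open>S\<close> of size d - 1 would contain a set
  \<open>S'\<close> of size d'. A cocircuit point that is huge on \<open>S\<close> violates the
  condition of the second space for \<open>insert i S'\<close>, where the minimum is attained at
  \<open>i\<close> only.\<close>

lemma tropical_linear_space_rank:
  fixes p p' :: "'n::finite set \<Rightarrow> real"
  assumes "valuated_matroid d p" "d \<le> CARD('n)"
    and "tropical_linear_space d p \<subseteq> tropical_linear_space d' p'"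
  shows "d \<le> d'"
proof (rule ccontr)
  assume "\<not> d \<le> d'"
  have "d - 1 \<le> CARD('n)" using assms(2) by simp
  then obtain S :: "'n set" where "card S = d - 1" using exists_set_of_card by blast
  then have S: "card S + 1 = d" using \<open>\<not> d \<le> d'\<close> by simp
  then have "d' \<le> card S" using \<open>\<not> d \<le> d'\<close> by simp
  then obtain S' where S': "S' \<subseteq> S" "card S' = d'" by (meson obtain_subset_with_card_n)
  have "S \<noteq> UNIV" using S assms(2) by auto
  then obtain i where i: "i \<notin> S" by blast
  define K where "K = (\<Sum>I\<in>UNIV. \<bar>p' I\<bar>)"
  have K: "\<bar>p' I\<bar> \<le> K" for I unfolding K_def by (rule member_le_sum) auto
  obtain x where x: "x \<in> tropical_linear_space d p" "\<And>i. i \<notin> S \<Longrightarrow> x $ i = p (insert i S)"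
    and big: "\<And>j. j \<in> S \<Longrightarrow> p (insert i S) + 2 * K + 1 \<le> x $ j"
    using cocircuit_point_large [OF assms(1) S, of "p (insert i S) + 2 * K + 1"] by blast
  have "card (insert i S') = d' + 1" using S' i by (subst card_insert_disjoint) auto
  then have "min_attained_twice (insert i S') (\<lambda>j. p' (insert i S' - {j}) + x $ j)"
    using x(1) assms(3) unfolding tropical_linear_space_def by blast
  then obtain a where a: "a \<in> S'" "p' (insert i S' - {a}) + x $ a \<le> p' (insert i S' - {i}) + x $ i"
    unfolding min_attained_twice_def by (metis insertE insertI1)
  then show False
    using K [of "insert i S' - {a}"] K [of "insert i S' - {i}"] big [of a] x(2) [OF i] S' by auto
qed

text \<open>Any two sets of size \<open>d\<close> are linked by exchanges of single elements, each
  of which stays among the supersets of a common set of size d - 1.\<close>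

lemma constant_by_exchange:
  fixes f :: "'n::finite set \<Rightarrow> real"
  assumes "\<And>S i j. card S + 1 = d \<Longrightarrow> i \<notin> S \<Longrightarrow> j \<notin> S \<Longrightarrow> f (insert i S) = f (insert j S)"
    and "card I = d" "card J = d"
  shows "f I = f J"
  using assms(2)
proof (induction "card (I - J)" arbitrary: I rule: less_induct)
  case less
  show ?case
  proof (cases "I - J = {}")
    case True
    then show ?thesis using less.prems assms(3) card_subset_eq [of J I] by auto
  next
    case False
    then obtain i where i: "i \<in> I" "i \<notin> J" by blast
    have "\<not> J \<subseteq> I" using less.prems assms(3) i card_subset_eq [of I J] by auto
    then obtain j where j: "j \<in> J" "j \<notin> I" by blast
    have "card (insert j (I - {i}) - J) < card (I - J)"
      using i j by (intro psubset_card_mono) auto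
    moreover have "card (insert j (I - {i})) = d" using i j less.prems card_insert_Diff by metis
    ultimately have "f (insert j (I - {i})) = f J" using less.hyps by blast
    moreover have "f (insert j (I - {i})) = f (insert i (I - {i}))"
      using i j less.prems card_Suc_Diff1 [of I i] by (intro assms(1)) auto
    ultimately show ?thesis using i by (simp add: insert_absorb)
  qed
qed

text \<open>A cocircuit point of \<open>S\<close> with huge entries on \<open>S\<close> is tested on
  \<open>insert i (insert j S)\<close>. The minimum can only be attained at \<open>i\<close> and
  \<open>j\<close>, and the resulting equation compares \<open>p'\<close> with \<open>p\<close>
  across one exchange.\<close>

lemma tropical_linear_space_determines:
  fixes p p' :: "'n::finite set \<Rightarrow> real"
  assumes "valuated_matroid d p"
    and "tropical_linear_space d p \<subseteq> tropical_linear_space d p'"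
    and "card I = d" "card J = d"
  shows "p' I - p I = p' J - p J"
proof (rule constant_by_exchange [where f = "\<lambda>I. p' I - p I", OF _ assms(3,4)])
  fix S :: "'n set" and i j
  assume S: "card S + 1 = d" "i \<notin> S" "j \<notin> S"
  show "p' (insert i S) - p (insert i S) = p' (insert j S) - p (insert j S)"
  proof (cases "i = j")
    case False
    define K where "K = (\<Sum>I\<in>UNIV. \<bar>p' I\<bar>)"
    have K: "\<bar>p' I\<bar> \<le> K" for I unfolding K_def by (rule member_le_sum) auto
    obtain x where x: "x \<in> tropical_linear_space d p" "\<And>i. i \<notin> S \<Longrightarrow> x $ i = p (insert i S)"
      and big: "\<And>j. j \<in> S \<Longrightarrow> p (insert i S) + 2 * K + 1 \<le> x $ j"
      using cocircuit_point_large [OF assms(1) S(1), of "p (insert i S) + 2 * K + 1"] by blast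
    let ?J = "insert i (insert j S)"
    let ?g = "\<lambda>k. p' (?J - {k}) + x $ k"
    have "card ?J = d + 1" using S False by simp
    then have "min_attained_twice ?J ?g"
      using x(1) assms(2) unfolding tropical_linear_space_def by blast
    then obtain a b where ab: "a \<in> ?J" "b \<in> ?J" "a \<noteq> b" "?g a = ?g b" "\<And>c. c \<in> ?J \<Longrightarrow> ?g a \<le> ?g c"
      unfolding min_attained_twice_def by blast
    have "?g i < ?g k" if "k \<in> S" for k
      using K [of "?J - {k}"] K [of "?J - {i}"] big [OF that] x(2) [OF S(2)] by auto
    then have "a \<notin> S" "b \<notin> S" using ab by (metis insertI1 linorder_not_less)+
    then have "?g i = ?g j" using ab by auto
    moreover have "?J - {i} = insert j S" "?J - {j} = insert i S" using S False by auto
    ultimately show ?thesis using x(2) [OF S(2)] x(2) [OF S(3)] by simp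
  qed simp
qed

section \<open>Minimizers of reduced costs and their stable intersections\<close>

definition reduced_cost :: "('n::finite set \<Rightarrow> real) \<Rightarrow> real ^ 'n \<Rightarrow> 'n set \<Rightarrow> real" where
  "reduced_cost p w I = p I - (\<Sum>i\<in>I. w $ i)"

lemma minimizers_iff:
  "I \<in> minimizers d p w \<longleftrightarrow> card I = d \<and> (\<forall>J. card J = d \<longrightarrow> reduced_cost p w I \<le> reduced_cost p w J)"
  by (simp add: minimizers_def reduced_cost_def)

lemma minimizersD:
  "I \<in> minimizers d p w \<Longrightarrow> card I = d"
  "I \<in> minimizers d p w \<Longrightarrow> card J = d \<Longrightarrow> reduced_cost p w I \<le> reduced_cost p w J"
  by (simp_all add: minimizers_iff)

lemma minimizers_nonempty:
  fixes p :: "'n::finite set \<Rightarrow> real"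
  assumes "d \<le> CARD('n)"
  obtains I where "I \<in> minimizers d p w"
proof -
  obtain I :: "'n set" where "card I = d" using exists_set_of_card [OF assms] by blast
  then have "{I :: 'n set. card I = d} \<noteq> {}" by blast
  then obtain I where "I \<in> {I. card I = d}" "\<And>J. J \<in> {I. card I = d} \<Longrightarrow> reduced_cost p w I \<le> reduced_cost p w J"
    using finite_obtains_min [of "{I. card I = d}" "reduced_cost p w"] by auto
  then show thesis using that by (auto simp: minimizers_iff)
qed

lemma minimizers_le:
  assumes "I \<in> minimizers d p w" "card J = d" "reduced_cost p w J \<le> reduced_cost p w I"
  shows "J \<in> minimizers d p w"
  using assms unfolding minimizers_iff by (meson order_trans)

lemma minimizers_cong:
  assumes "\<And>I J. card I = d \<Longrightarrow> card J = d \<Longrightarrow> p' I - p I = p' J - p J"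
  shows "minimizers d p' w = minimizers d p w"
proof -
  have "reduced_cost p' w I \<le> reduced_cost p' w J \<longleftrightarrow> reduced_cost p w I \<le> reduced_cost p w J"
    if "card I = d" "card J = d" for I J
    using assms [OF that] by (auto simp: reduced_cost_def)
  then show ?thesis by (auto simp: set_eq_iff minimizers_iff)
qed

lemma reduced_cost_valuated: "valuated_matroid d p \<Longrightarrow> valuated_matroid d (reduced_cost p w)"
  using valuated_shift [of d p w] by (simp add: reduced_cost_def [abs_def])

text \<open>Let \<open>j\<close> give the minimum over \<open>J\<close> and let \<open>B\<close> be
  a minimizer containing \<open>j\<close>. Exchanging \<open>j\<close> out of \<open>B\<close>
  cannot make \<open>B\<close> cheaper, so bringing \<open>j\<close> into \<open>J - {j}\<close> in
  place of some \<open>f\<close> is at no cost, and \<open>f\<close> attains the minimum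
  too.\<close>

lemma loopless_imp_mem:
  fixes p :: "'n::finite set \<Rightarrow> real"
  assumes "valuated_matroid d p" and loopless: "\<And>e. \<exists>I\<in>minimizers d p w. e \<in> I"
  shows "w \<in> tropical_linear_space d p"
  unfolding tropical_linear_space_def
proof (intro CollectI allI impI)
  fix J :: "'n set" assume J: "card J = d + 1"
  let ?c = "reduced_cost p w"
  have g: "p (J - {j}) + w $ j = ?c (J - {j}) + (\<Sum>i\<in>J. w $ i)" if "j \<in> J" for j
    using that by (simp add: reduced_cost_def sum_diff1)
  have "J \<noteq> {}" using J by auto
  then obtain j where j: "j \<in> J" and min: "\<And>k. k \<in> J \<Longrightarrow> ?c (J - {j}) \<le> ?c (J - {k})"
    using finite_obtains_min [of J "\<lambda>j. ?c (J - {j})"] by auto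
  obtain B where B: "B \<in> minimizers d p w" "j \<in> B" using loopless by blast
  have cJ: "card (J - {j}) = d" using j J by simp
  have "j \<notin> J - {j}" by simp
  then obtain f where f: "f \<in> J - {j}" "f \<notin> B"
    "?c (insert f (B - {j})) + ?c (insert j (J - {j} - {f})) \<le> ?c B + ?c (J - {j})"
    using valuated_exchange [OF reduced_cost_valuated [OF assms(1)] minimizersD(1) [OF B(1)] cJ B(2)] by metis
  have "?c B \<le> ?c (insert f (B - {j}))"
    using card_insert_Diff [OF B(2) f(2)] minimizersD [OF B(1)] by simp
  moreover have "insert j (J - {j} - {f}) = J - {f}" using j f by auto
  ultimately have "?c (J - {f}) \<le> ?c (J - {j})" using f by simp
  then have "?c (J - {f}) = ?c (J - {j})" using min [of f] f by simp
  then show "min_attained_twice J (\<lambda>j. p (J - {j}) + w $ j)"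
    unfolding min_attained_twice_def using j f min g by (intro bexI [of _ j] bexI [of _ f]) auto
qed

lemma reduced_cost_Int:
  fixes I I' :: "'n::finite set"
  assumes "I \<union> I' = UNIV"
  shows "(\<Sum>i\<in>I \<inter> I'. w $ i) = (\<Sum>i\<in>I. w $ i) + (\<Sum>i\<in>I'. w $ i) - (\<Sum>i\<in>UNIV. w $ i :: real)"
  using sum.union_inter [of I I' "\<lambda>i. w $ i"] assms by simp

context
  fixes p p' q :: "'n::finite set \<Rightarrow> real" and d d' :: nat
  assumes dims: "d \<le> CARD('n)" "d' \<le> CARD('n)" "CARD('n) \<le> d + d'"
  defines "q \<equiv> stable_intersection d p d' p'"
begin

text \<open>For a pair that covers the ground set, the two reduced costs add up to the reduced cost
  of the intersection up to the constant total of \<open>w\<close>. So an optimal \<open>J\<close>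
  comes from an optimal pair of the joint problem.\<close>

lemma stable_minimizers_attained:
  assumes "J \<in> minimizers (d + d' - CARD('n)) q w"
  obtains I I' where "card I = d" "card I' = d'" "I \<inter> I' = J" "I \<union> I' = UNIV"
    "\<And>A A'. card A = d \<Longrightarrow> card A' = d' \<Longrightarrow> A \<union> A' = UNIV \<Longrightarrow>
       reduced_cost p w I + reduced_cost p' w I' \<le> reduced_cost p w A + reduced_cost p' w A'"
proof -
  obtain I I' where I: "card I = d" "card I' = d'" "I \<inter> I' = J" "I \<union> I' = UNIV" "q J = p I + p' I'"
    using stable_intersection_attained [OF dims minimizersD(1) [OF assms]] unfolding q_def by metis
  have "reduced_cost p w I + reduced_cost p' w I' \<le> reduced_cost p w A + reduced_cost p' w A'"
    if A: "card A = d" "card A' = d'" "A \<union> A' = UNIV" for A A'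
  proof -
    have "card (A \<inter> A') = d + d' - CARD('n)" using card_Un_Int [of A A'] A by simp
    then have "reduced_cost q w J \<le> reduced_cost q w (A \<inter> A')" using minimizersD [OF assms] by blast
    moreover have "q (A \<inter> A') \<le> p A + p' A'" unfolding q_def using stable_intersection_le A by blast
    ultimately show ?thesis
      using reduced_cost_Int [OF I(4), of w] reduced_cost_Int [OF A(3), of w] I(3,5)
      by (simp add: reduced_cost_def)
  qed
  then show thesis using that I by blast
qed

text \<open>Suppose that \<open>e\<close> lies in \<open>I\<close> and \<open>I'\<close>. An
  exchange with a minimizer \<open>B\<close>, which avoids \<open>e\<close>, makes \<open>I\<close>
  strictly cheaper since every set containing \<open>e\<close> costs more than \<open>B\<close>. The
  element \<open>e\<close> is still covered by \<open>I'\<close>, so the cheaper pair is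
  feasible.\<close>

lemma loop_stable_intersection:
  assumes "valuated_matroid d p" and loop: "\<And>I. I \<in> minimizers d p w \<Longrightarrow> e \<notin> I"
    and J: "J \<in> minimizers (d + d' - CARD('n)) q w"
  shows "e \<notin> J"
proof
  assume "e \<in> J"
  obtain I I' where I: "card I = d" "card I' = d'" "I \<inter> I' = J" "I \<union> I' = UNIV"
    and opt: "\<And>A A'. card A = d \<Longrightarrow> card A' = d' \<Longrightarrow> A \<union> A' = UNIV \<Longrightarrow>
       reduced_cost p w I + reduced_cost p' w I' \<le> reduced_cost p w A + reduced_cost p' w A'"
    using stable_minimizers_attained [OF J] by blast
  obtain B where B: "B \<in> minimizers d p w" using minimizers_nonempty [OF dims(1)] by blast
  then have eB: "e \<notin> B" using loop by blast
  have eI: "e \<in> I" "e \<in> I'" using I(3) \<open>e \<in> J\<close> by auto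
  obtain f where f: "f \<in> B" "f \<notin> I"
    "reduced_cost p w (insert f (I - {e})) + reduced_cost p w (insert e (B - {f})) \<le>
       reduced_cost p w I + reduced_cost p w B"
    using valuated_exchange [OF reduced_cost_valuated [OF assms(1)] I(1) minimizersD(1) [OF B] eI(1) eB]
    by blast
  have "card (insert e (B - {f})) = d" using card_insert_Diff [OF f(1) eB] minimizersD(1) [OF B] by simp
  then have "reduced_cost p w B < reduced_cost p w (insert e (B - {f}))"
    using loop [of "insert e (B - {f})"] minimizers_le [OF B] by (metis insertI1 linorder_not_less)
  moreover have "card (insert f (I - {e})) = d" using card_insert_Diff [OF eI(1) f(2)] I(1) by simp
  then have "reduced_cost p w I + reduced_cost p' w I' \<le>
      reduced_cost p w (insert f (I - {e})) + reduced_cost p' w I'"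
    using I eI by (intro opt) auto
  ultimately show False using f(3) by linarith
qed

text \<open>As soon as one pair of separate minimizers covers the ground set, the joint problem
  decouples: its optimum is the sum of the two separate optima, attained exactly by covering pairs
  of minimizers.\<close>

lemma minimizers_stable_intersection:
  assumes "I0 \<in> minimizers d p w" "I0' \<in> minimizers d' p' w" "I0 \<union> I0' = UNIV"
  shows "minimizers (d + d' - CARD('n)) q w =
    {I \<inter> I' | I I'. I \<in> minimizers d p w \<and> I' \<in> minimizers d' p' w \<and> I \<union> I' = UNIV}" (is "_ = ?M")
proof (intro equalityI subsetI)
  fix J assume J: "J \<in> minimizers (d + d' - CARD('n)) q w"
  obtain I I' where I: "card I = d" "card I' = d'" "I \<inter> I' = J" "I \<union> I' = UNIV"
    and opt: "\<And>A A'. card A = d \<Longrightarrow> card A' = d' \<Longrightarrow> A \<union> A' = UNIV \<Longrightarrow>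
       reduced_cost p w I + reduced_cost p' w I' \<le> reduced_cost p w A + reduced_cost p' w A'"
    using stable_minimizers_attained [OF J] by blast
  have le: "reduced_cost p w I + reduced_cost p' w I' \<le> reduced_cost p w I0 + reduced_cost p' w I0'"
    using opt minimizersD(1) assms by blast
  moreover have "reduced_cost p w I0 \<le> reduced_cost p w I" "reduced_cost p' w I0' \<le> reduced_cost p' w I'"
    using minimizersD(2) assms I by blast+
  ultimately have "I \<in> minimizers d p w" "I' \<in> minimizers d' p' w"
    using minimizers_le [OF assms(1) I(1)] minimizers_le [OF assms(2) I(2)] by linarith+
  then show "J \<in> ?M" using I by blast
next
  fix J assume "J \<in> ?M"
  then obtain I I' where I: "J = I \<inter> I'" "I \<in> minimizers d p w" "I' \<in> minimizers d' p' w" "I \<union> I' = UNIV"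
    by blast
  note c = minimizersD(1) [OF I(2)] minimizersD(1) [OF I(3)]
  have cJ: "card J = d + d' - CARD('n)" using card_Un_Int [of I I'] I c by simp
  have "q J \<le> p I + p' I'" unfolding q_def using stable_intersection_le c I by blast
  then have ub: "reduced_cost q w J \<le> reduced_cost p w I + reduced_cost p' w I' + (\<Sum>i\<in>UNIV. w $ i)"
    using reduced_cost_Int [OF I(4), of w] I(1) by (simp add: reduced_cost_def)
  have "reduced_cost q w J \<le> reduced_cost q w J'" if J': "card J' = d + d' - CARD('n)" for J'
  proof -
    obtain A A' where A: "card A = d" "card A' = d'" "A \<inter> A' = J'" "A \<union> A' = UNIV" "q J' = p A + p' A'"
      using stable_intersection_attained [OF dims J'] unfolding q_def by metis
    have "reduced_cost q w J' = reduced_cost p w A + reduced_cost p' w A' + (\<Sum>i\<in>UNIV. w $ i)"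
      using reduced_cost_Int [OF A(4), of w] A(3,5) by (simp add: reduced_cost_def)
    moreover have "reduced_cost p w I \<le> reduced_cost p w A" "reduced_cost p' w I' \<le> reduced_cost p' w A'"
      using minimizersD(2) I A by blast+
    ultimately show ?thesis using ub by linarith
  qed
  then show "J \<in> minimizers (d + d' - CARD('n)) q w" using cJ by (simp add: minimizers_iff)
qed

end

lemma stable_intersection_commute:
  "stable_intersection d p d' p' = stable_intersection d' p' d p"
  unfolding stable_intersection_def fun_eq_iff
  by (intro allI arg_cong [where f = Min]) (auto simp: Int_commute add.commute)

lemma minimizers_dual:
  fixes p :: "'n::finite set \<Rightarrow> real"
  assumes "d \<le> CARD('n)"
  shows "minimizers (CARD('n) - d) (dual_plucker p) w = uminus ` minimizers d p (- w)"
proof -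
  have rc: "reduced_cost (dual_plucker p) w I = reduced_cost p (- w) (- I) - (\<Sum>i\<in>UNIV. w $ i)" for I
  proof -
    have "(\<Sum>i\<in>UNIV. w $ i) = (\<Sum>i\<in>I. w $ i) + (\<Sum>i\<in>- I. w $ i)"
      using sum.union_disjoint [of I "- I" "\<lambda>i. w $ i"] by simp
    then show ?thesis
      by (simp add: reduced_cost_def dual_plucker_def sum_negf Compl_eq_Diff_UNIV [symmetric])
  qed
  have c: "card (- I) = d \<longleftrightarrow> card I = CARD('n) - d" for I :: "'n set"
    using assms card_mono [of UNIV I] by (auto simp: card_complement)
  have iff: "I \<in> minimizers (CARD('n) - d) (dual_plucker p) w \<longleftrightarrow> - I \<in> minimizers d p (- w)" for I
    unfolding minimizers_iff rc c by (auto simp: c [symmetric]) (metis c double_complement)+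
  show ?thesis
  proof (intro equalityI subsetI)
    fix I assume "I \<in> minimizers (CARD('n) - d) (dual_plucker p) w"
    then have "- (- I) \<in> uminus ` minimizers d p (- w)" using iff by (intro imageI) blast
    then show "I \<in> uminus ` minimizers d p (- w)" by simp
  next
    fix I assume "I \<in> uminus ` minimizers d p (- w)"
    then obtain K where "I = - K" "K \<in> minimizers d p (- w)" by blast
    then show "I \<in> minimizers (CARD('n) - d) (dual_plucker p) w" using iff [of I] by simp
  qed
qed

subsection \<open>Connected cells and transversality\<close>

text \<open>For the bases of a matroid this is connectedness, in the form that the matroid polytope
  has dimension n - 1.\<close>

definition connected_family :: "'a set set \<Rightarrow> bool" where
  "connected_family M \<longleftrightarrow> (\<forall>u :: 'a \<Rightarrow> real. weight_constant u M \<longrightarrow> (\<forall>e f. u e = u f))"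

lemma connected_familyD: "connected_family M \<Longrightarrow> weight_constant u M \<Longrightarrow> u e = u f"
  unfolding connected_family_def by blast

lemma minimizers_reduced_cost_eq:
  assumes "I \<in> minimizers d p w" "J \<in> minimizers d p w"
  shows "reduced_cost p w I = reduced_cost p w J"
  using minimizersD(2) [OF assms(1) minimizersD(1) [OF assms(2)]]
    minimizersD(2) [OF assms(2) minimizersD(1) [OF assms(1)]] by simp

text \<open>The ratio test of linear programming: \<open>w\<close> moves in direction
  \<open>v\<close>, which keeps the present minimizers tied, up to the first moment \<open>t\<close>
  at which a further set becomes optimal.\<close>

lemma minimizers_enlarge:
  fixes p :: "'n::finite set \<Rightarrow> real" and v :: "'n \<Rightarrow> real"
  assumes v: "weight_constant v (minimizers d p w)"
    and B: "B \<in> minimizers d p w" and I0: "card I0 = d" "sum v B < sum v I0"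
  obtains w' where "minimizers d p w \<subset> minimizers d p w'"
proof -
  let ?G = "{I. card I = d \<and> sum v B < sum v I}"
  let ?r = "\<lambda>I. (reduced_cost p w I - reduced_cost p w B) / (sum v I - sum v B)"
  have "?G \<noteq> {}" using I0 by blast
  then obtain I where I: "I \<in> ?G" and min: "\<And>J. J \<in> ?G \<Longrightarrow> ?r I \<le> ?r J"
    using finite_obtains_min [of ?G ?r] by auto
  define t where "t = ?r I"
  define w' where "w' = (\<chi> i. w $ i + t * v i)"
  have t: "0 \<le> t" using I minimizersD(2) [OF B] by (auto simp: t_def intro: divide_nonneg_nonneg)
  have rc: "reduced_cost p w' J = reduced_cost p w J - t * sum v J" for J
    by (simp add: w'_def reduced_cost_def sum.distrib sum_distrib_left)
  have low: "reduced_cost p w' B \<le> reduced_cost p w' J" if J: "card J = d" for J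
  proof (cases "sum v B < sum v J")
    case True
    then have "t \<le> ?r J" using min J by (simp add: t_def)
    then have "t * (sum v J - sum v B) \<le> reduced_cost p w J - reduced_cost p w B"
      using True by (simp add: pos_le_divide_eq)
    then show ?thesis by (simp add: rc algebra_simps)
  next
    case False
    then have "t * sum v J \<le> t * sum v B" using t by (intro mult_left_mono) auto
    then show ?thesis using minimizersD(2) [OF B J] by (simp add: rc)
  qed
  then have B': "B \<in> minimizers d p w'" using minimizersD(1) [OF B] by (simp add: minimizers_iff)
  have "minimizers d p w \<subseteq> minimizers d p w'"
  proof
    fix J assume J: "J \<in> minimizers d p w"
    have "sum v J = sum v B" using weight_constantD [OF v J B] .
    moreover have "reduced_cost p w J \<le> reduced_cost p w B"
      using minimizersD J B by metis
    ultimately show "J \<in> minimizers d p w'"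
      using minimizers_le [OF B'] minimizersD(1) [OF J] by (simp add: rc)
  qed
  moreover have "t * (sum v I - sum v B) = reduced_cost p w I - reduced_cost p w B"
    using I by (simp add: t_def)
  then have "reduced_cost p w' I = reduced_cost p w' B" by (simp add: rc algebra_simps)
  then have "I \<in> minimizers d p w'" using minimizers_le [OF B'] I by simp
  moreover have "I \<notin> minimizers d p w" using weight_constantD [OF v _ B, of I] I by auto
  ultimately show thesis using that by blast
qed

lemma weight_constant_uminus:
  "weight_constant u M \<Longrightarrow> weight_constant (\<lambda>i. - u i) M"
  unfolding weight_constant_def sum_negf neg_equal_iff_equal .

text \<open>A weight that is constant on a maximal cell cannot be used to enlarge it, nor can its
  negative; so it is constant on all sets of size \<open>d\<close>. Since 0 < d < n, some
  \<open>S\<close> can be extended by either \<open>e\<close> or \<open>f\<close>, which equates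
  their weights.\<close>

lemma maximal_minimizers_connected:
  fixes p :: "'n::finite set \<Rightarrow> real"
  assumes d: "0 < d" "d < CARD('n)"
    and max: "\<And>w'. \<not> minimizers d p w \<subset> minimizers d p w'"
  shows "connected_family (minimizers d p w)"
  unfolding connected_family_def
proof (intro allI impI, rule ccontr)
  fix u :: "'n \<Rightarrow> real" and e f
  assume u: "weight_constant u (minimizers d p w)" and ef: "u e \<noteq> u f"
  obtain B where B: "B \<in> minimizers d p w"
    using minimizers_nonempty [of d p w] d by auto
  have le: "sum u I \<le> sum u B" if "card I = d" for I
    using minimizers_enlarge [OF u B that] max by (meson linorder_not_less)
  have ge: "sum u B \<le> sum u I" if "card I = d" for I
    using minimizers_enlarge [OF weight_constant_uminus [OF u] B that] max
    by (simp add: sum_negf) (meson linorder_not_less)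
  have "e \<noteq> f" using ef by auto
  then have "card (UNIV - {e, f}) = CARD('n) - 2" by (subst card_Diff_subset) auto
  then have "d - 1 \<le> card (UNIV - {e, f})" using d by simp
  then obtain S where S: "S \<subseteq> UNIV - {e, f}" "card S = d - 1" by (meson obtain_subset_with_card_n)
  then have n: "e \<notin> S" "f \<notin> S" by auto
  then have "card (insert e S) = d" "card (insert f S) = d" using S d by auto
  then have "sum u (insert e S) = sum u (insert f S)" using le ge by (metis order_antisym)
  then show False using n ef by simp
qed

text \<open>On an inclusion-maximal cell the reduced costs at \<open>w'\<close> agree, so the costs
  at \<open>w\<close> differ there only by the linear term in \<open>w - w'\<close>.\<close>

lemma minimizers_face_of_connected:
  fixes p :: "'n::finite set \<Rightarrow> real"
  assumes d: "0 < d" "d < CARD('n)"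
  obtains w' where "minimizers d p w \<subseteq> minimizers d p w'" "connected_family (minimizers d p w')"
    "minimizers d p w = argmax_weight (\<lambda>i. w $ i - w' $ i) (minimizers d p w')"
proof -
  have "\<exists>M\<in>range (minimizers d p). minimizers d p w \<subseteq> M \<and> (\<forall>N\<in>range (minimizers d p). M \<subseteq> N \<longrightarrow> M = N)"
    by (rule finite_has_maximal2) auto
  then obtain M where M: "M \<in> range (minimizers d p)" "minimizers d p w \<subseteq> M"
    "\<forall>N\<in>range (minimizers d p). M \<subseteq> N \<longrightarrow> M = N" by (elim bexE conjE)
  obtain w' where Mw': "M = minimizers d p w'" using M(1) by (rule imageE)
  have w': "minimizers d p w \<subseteq> minimizers d p w'" using M(2) Mw' by simp
  have max: "minimizers d p w' = minimizers d p v" if "minimizers d p w' \<subseteq> minimizers d p v" for v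
    using M(3) that unfolding Mw' by simp
  have con: "connected_family (minimizers d p w')"
    by (rule maximal_minimizers_connected [OF d]) (use max in blast)
  obtain B where B: "B \<in> minimizers d p w"
    using minimizers_nonempty [of d p w] d by auto
  have rc: "reduced_cost p w I = reduced_cost p w' I - (\<Sum>i\<in>I. w $ i - w' $ i)" for I
    by (simp add: reduced_cost_def sum_subtractf)
  note const = minimizers_reduced_cost_eq [of _ d p w']
  have "minimizers d p w = argmax_weight (\<lambda>i. w $ i - w' $ i) (minimizers d p w')"
  proof (intro equalityI subsetI)
    fix I assume I: "I \<in> minimizers d p w"
    show "I \<in> argmax_weight (\<lambda>i. w $ i - w' $ i) (minimizers d p w')"
    proof (rule argmax_weightI)
      show I': "I \<in> minimizers d p w'" using I w' by blast
      fix J assume J: "J \<in> minimizers d p w'"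
      have "reduced_cost p w I \<le> reduced_cost p w J" using minimizersD [OF I] minimizersD(1) [OF J] by blast
      then show "(\<Sum>i\<in>J. w $ i - w' $ i) \<le> (\<Sum>i\<in>I. w $ i - w' $ i)"
        using const [OF I' J] unfolding rc by linarith
    qed
  next
    fix I assume I: "I \<in> argmax_weight (\<lambda>i. w $ i - w' $ i) (minimizers d p w')"
    have B': "B \<in> minimizers d p w'" and I': "I \<in> minimizers d p w'"
      using B w' argmax_weightD(1) [OF I] by auto
    have "reduced_cost p w I \<le> reduced_cost p w B"
      using argmax_weightD(2) [OF I B'] const [OF I' B'] unfolding rc by linarith
    then show "I \<in> minimizers d p w" using minimizers_le [OF B] minimizersD(1) [OF I'] by blast
  qed
  then show thesis using that w' con by blast
qed

section \<open>Cells of the regular subdivision as families of minimizers\<close>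

lemma inner_indicator_vec: "x \<bullet> indicator_vec I = (\<Sum>i\<in>I. x $ i)"
  by (simp add: indicator_vec_def inner_sum_right inner_axis)

lemma convex_hull_Int_supporting:
  fixes V :: "'a::euclidean_space set"
  assumes "finite V" "\<And>x. x \<in> V \<Longrightarrow> a \<bullet> x \<le> b"
  shows "convex hull V \<subseteq> {x. a \<bullet> x \<le> b}"
    and "convex hull V \<inter> {x. a \<bullet> x = b} = convex hull (V \<inter> {x. a \<bullet> x = b})"
proof -
  show sub: "convex hull V \<subseteq> {x. a \<bullet> x \<le> b}"
    by (rule hull_minimal) (use assms in \<open>auto simp: convex_halfspace_le\<close>)
  let ?F = "convex hull V \<inter> {x. a \<bullet> x = b}"
  have "?F face_of convex hull V"
    using sub by (intro face_of_Int_supporting_hyperplane_le) auto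
  then obtain S where S: "S \<subseteq> V" "?F = convex hull S"
    using face_of_convex_hull_subset [OF finite_imp_compact [OF assms(1)]] by blast
  have "S \<subseteq> ?F" unfolding S(2) by (rule hull_subset)
  then have "?F \<subseteq> convex hull (V \<inter> {x. a \<bullet> x = b})"
    using S by (metis (no_types, lifting) hull_mono le_inf_iff)
  moreover have "convex hull (V \<inter> {x. a \<bullet> x = b}) \<subseteq> ?F"
    by (intro Int_greatest hull_mono hull_minimal) (auto simp: convex_hyperplane)
  ultimately show "?F = convex hull (V \<inter> {x. a \<bullet> x = b})" by blast
qed

text \<open>On the lifted point of \<open>I\<close> the functional with normal
  \<open>(- c *\<^sub>R w, c)\<close> takes \<open>c\<close> times the reduced cost as value; as
  \<open>c\<close> is negative, its maxima are the minimizers.\<close>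

lemma lifted_lower_face:
  fixes p :: "'n::finite set \<Rightarrow> real"
  assumes "c < 0" "I0 \<in> minimizers d p w" "b = c * reduced_cost p w I0"
  shows "lifted_hypersimplex d p \<subseteq> {x. (- c *\<^sub>R w, c) \<bullet> x \<le> b}"
    and "fst ` (lifted_hypersimplex d p \<inter> {x. (- c *\<^sub>R w, c) \<bullet> x = b}) = matroid_polytope (minimizers d p w)"
proof -
  let ?V = "{(indicator_vec I, p I) | I. card I = d}" and ?a = "(- c *\<^sub>R w, c)"
  have in_V: "?a \<bullet> (indicator_vec I, p I) = c * reduced_cost p w I" for I
    by (simp add: inner_indicator_vec reduced_cost_def algebra_simps sum_negf sum_distrib_left)
  have fin: "finite ?V" by (rule finite_subset [of _ "range (\<lambda>I. (indicator_vec I, p I))"]) auto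
  have le: "?a \<bullet> x \<le> b" if "x \<in> ?V" for x
    using that minimizersD(2) [OF assms(2)] assms(1,3) in_V by (auto intro: mult_left_mono_neg)
  show "lifted_hypersimplex d p \<subseteq> {x. ?a \<bullet> x \<le> b}"
    unfolding lifted_hypersimplex_def by (rule convex_hull_Int_supporting(1) [OF fin le])
  have "?V \<inter> {x. ?a \<bullet> x = b} = (\<lambda>I. (indicator_vec I, p I)) ` minimizers d p w"
  proof (intro equalityI subsetI)
    fix x assume "x \<in> ?V \<inter> {x. ?a \<bullet> x = b}"
    then obtain I where I: "x = (indicator_vec I, p I)" "card I = d" "?a \<bullet> x = b" by blast
    then have "reduced_cost p w I = reduced_cost p w I0" using in_V assms(1,3) by simp
    then show "x \<in> (\<lambda>I. (indicator_vec I, p I)) ` minimizers d p w"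
      using minimizers_le [OF assms(2) I(2)] I(1) by auto
  next
    fix x assume "x \<in> (\<lambda>I. (indicator_vec I, p I)) ` minimizers d p w"
    then obtain I where I: "x = (indicator_vec I, p I)" "I \<in> minimizers d p w" by blast
    then have "reduced_cost p w I = reduced_cost p w I0"
      using assms(2) by (intro minimizers_reduced_cost_eq)
    then show "x \<in> ?V \<inter> {x. ?a \<bullet> x = b}"
      using I minimizersD(1) [OF I(2)] in_V [of I] assms(3) by auto
  qed
  then have "lifted_hypersimplex d p \<inter> {x. ?a \<bullet> x = b} =
      convex hull ((\<lambda>I. (indicator_vec I, p I)) ` minimizers d p w)"
    unfolding lifted_hypersimplex_def using convex_hull_Int_supporting(2) [OF fin le] by simp
  then show "fst ` (lifted_hypersimplex d p \<inter> {x. ?a \<bullet> x = b}) = matroid_polytope (minimizers d p w)"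
    by (simp add: matroid_polytope_def convex_hull_linear_image [OF linear_fst] image_image)
qed

lemma matroid_polytope_in_regular_subdivision:
  fixes p :: "'n::finite set \<Rightarrow> real"
  assumes "d \<le> CARD('n)"
  shows "matroid_polytope (minimizers d p w) \<in> regular_subdivision d p"
proof -
  obtain I0 where I0: "I0 \<in> minimizers d p w" using minimizers_nonempty [OF assms] by blast
  let ?b = "- 1 * reduced_cost p w I0" and ?a = "(- (- 1) *\<^sub>R w, - 1 :: real)"
  let ?F = "lifted_hypersimplex d p \<inter> {x. ?a \<bullet> x = ?b}"
  have F: "lifted_hypersimplex d p \<subseteq> {x. ?a \<bullet> x \<le> ?b}" "fst ` ?F = matroid_polytope (minimizers d p w)"
    using lifted_lower_face [OF _ I0 refl, of "- 1"] by auto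
  have "matroid_polytope (minimizers d p w) \<noteq> {}"
    using I0 by (auto simp: matroid_polytope_def)
  then have "?F \<noteq> {}" using F(2) by (metis image_is_empty)
  then have "lower_face ?F (lifted_hypersimplex d p)"
    unfolding lower_face_def using F(1) by (intro conjI exI [of _ ?a] exI [of _ ?b]) auto
  then show ?thesis unfolding regular_subdivision_def using F(2) by blast
qed

lemma regular_subdivision_cell:
  fixes p :: "'n::finite set \<Rightarrow> real"
  assumes "d \<le> CARD('n)" "C \<in> regular_subdivision d p"
  obtains w where "C = matroid_polytope (minimizers d p w)"
proof -
  obtain F where F: "C = fst ` F" "lower_face F (lifted_hypersimplex d p)"
    using assms(2) unfolding regular_subdivision_def by blast
  then obtain a b where a: "snd a < 0" "lifted_hypersimplex d p \<subseteq> {x. a \<bullet> x \<le> b}"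
    "F = lifted_hypersimplex d p \<inter> {x. a \<bullet> x = b}" "F \<noteq> {}"
    unfolding lower_face_def by blast
  define c where "c = snd a"
  \<comment> \<open>Scaling the normal so that its last coordinate becomes -1 turns its remaining
    part into \<open>w\<close>.\<close>
  define w where "w = (- 1 / c) *\<^sub>R fst a"
  have aw: "a = (- c *\<^sub>R w, c)" using a(1) by (simp add: w_def c_def prod_eq_iff)
  obtain I0 where I0: "I0 \<in> minimizers d p w" using minimizers_nonempty [OF assms(1)] by blast
  define b' where "b' = c * reduced_cost p w I0"
  note L = lifted_lower_face [OF _ I0 b'_def, folded aw]
  have c: "c < 0" using a(1) c_def by simp
  obtain x where x: "x \<in> lifted_hypersimplex d p" "a \<bullet> x = b" using a by blast
  then have "b \<le> b'" using L(1) [OF c] by auto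
  moreover have "(indicator_vec I0, p I0) \<in> lifted_hypersimplex d p"
    unfolding lifted_hypersimplex_def using minimizersD(1) [OF I0] by (intro hull_inc) blast
  then have "a \<bullet> (indicator_vec I0, p I0) \<le> b" using a(2) by blast
  then have "b' \<le> b"
    unfolding aw b'_def by (simp add: inner_indicator_vec reduced_cost_def algebra_simps sum_negf sum_distrib_left)
  ultimately have "b = b'" by simp
  then have "C = matroid_polytope (minimizers d p w)" using L(2) [OF c] F(1) a(3) by simp
  then show thesis by (rule that)
qed

text \<open>Only the inclusion of a cell in one with connected minimizers is used: maximality turns
  it into an equality of polytopes, so equality of the two families of bases need not be
  proved.\<close>

lemma series_parallel_tlsI:
  fixes p :: "'n::finite set \<Rightarrow> real"
  assumes "0 < d" "d < CARD('n)"
    and "\<And>w. connected_family (minimizers d p w) \<Longrightarrow> series_parallel_matroid (minimizers d p w)"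
  shows "series_parallel_tls d p"
  unfolding series_parallel_tls_def
proof (intro allI impI)
  fix C assume C: "maximal_cell d p C"
  then obtain w where w: "C = matroid_polytope (minimizers d p w)"
    using regular_subdivision_cell [of d C p] assms(2) by (auto simp: maximal_cell_def)
  obtain w' where w': "minimizers d p w \<subseteq> minimizers d p w'" "connected_family (minimizers d p w')"
    by (rule minimizers_face_of_connected [OF assms(1,2), of p w])
  have "C \<subseteq> matroid_polytope (minimizers d p w')"
    unfolding w matroid_polytope_def using w'(1) by (intro hull_mono image_mono)
  then have "C = matroid_polytope (minimizers d p w')"
    using C matroid_polytope_in_regular_subdivision [of d p w'] assms(2) by (auto simp: maximal_cell_def)
  then show "\<exists>M. series_parallel_matroid M \<and> C = matroid_polytope M" using assms(3) [OF w'(2)] by blast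
qed

section \<open>Strata of minimizers and transversality\<close>

definition constant_space :: "'n::finite set set \<Rightarrow> (real ^ 'n) set" where
  "constant_space M = {x. weight_constant (($) x) M}"

lemma subspace_constant_space: "subspace (constant_space M)"
proof (rule subspaceI)
  show "0 \<in> constant_space M" by (simp add: constant_space_def weight_constant_def)
next
  fix x y assume "x \<in> constant_space M" "y \<in> constant_space M"
  then have *: "weight_constant (($) x) M" "weight_constant (($) y) M" by (simp_all add: constant_space_def)
  have "sum (($) (x + y)) I = sum (($) (x + y)) J" if "I \<in> M" "J \<in> M" for I J
    using weight_constantD [OF *(1) that] weight_constantD [OF *(2) that] by (simp add: sum.distrib)
  then show "x + y \<in> constant_space M" unfolding constant_space_def weight_constant_def by blast
next
  fix c x assume "x \<in> constant_space M"
  then have *: "weight_constant (($) x) M" by (simp add: constant_space_def)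
  have "sum (($) (c *\<^sub>R x)) I = sum (($) (c *\<^sub>R x)) J" if "I \<in> M" "J \<in> M" for I J
    using weight_constantD [OF * that] by (simp add: sum_distrib_left [symmetric])
  then show "c *\<^sub>R x \<in> constant_space M" unfolding constant_space_def weight_constant_def by blast
qed

text \<open>A stratum is an affine space, given by the ties among the minimizers, intersected with
  an open set, given by the strict inequalities against all other sets. So it is relatively open,
  and its directions solve the homogeneous ties.\<close>

lemma minimizers_stratum:
  fixes p :: "'n::finite set \<Rightarrow> real" and d :: nat
  defines "M w \<equiv> minimizers d p w" and "C w \<equiv> {x. minimizers d p x = minimizers d p w}"
  assumes "d \<le> CARD('n)"
  shows "w \<in> rel_interior (closure (C w))" and "direction_space (closure (C w)) \<subseteq> constant_space (M w)"
proof -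
  have mw: "x \<in> C w \<longleftrightarrow> (\<forall>I\<in>M w. \<forall>J\<in>M w. (indicator_vec J - indicator_vec I) \<bullet> x = p J - p I) \<and>
      (\<forall>I\<in>M w. \<forall>J\<in>{J. card J = d \<and> J \<notin> M w}. (indicator_vec J - indicator_vec I) \<bullet> x < p J - p I)" (is "_ \<longleftrightarrow> ?R x")
    for x
  proof -
    have eq: "(indicator_vec J - indicator_vec I) \<bullet> x = p J - p I + (reduced_cost p x I - reduced_cost p x J)" for I J
      by (simp add: inner_diff_right inner_commute [of _ x] inner_indicator_vec reduced_cost_def)
    obtain B where B: "B \<in> M w" using minimizers_nonempty [OF assms(3)] unfolding M_def by blast
    show ?thesis
    proof
      assume "x \<in> C w"
      then have xM: "minimizers d p x = M w" by (simp add: C_def M_def)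
      have c: "reduced_cost p x I = reduced_cost p x J" if "I \<in> M w" "J \<in> M w" for I J
        using that unfolding xM [symmetric] by (rule minimizers_reduced_cost_eq)
      have l: "reduced_cost p x I < reduced_cost p x J" if "I \<in> M w" "card J = d" "J \<notin> M w" for I J
        using that minimizers_le [of I d p x J] unfolding xM [symmetric] by (meson not_le)
      show "?R x"
      proof (intro conjI ballI)
        fix I J assume "I \<in> M w" "J \<in> M w"
        then show "(indicator_vec J - indicator_vec I) \<bullet> x = p J - p I" unfolding eq using c [of I J] by simp
      next
        fix I J assume "I \<in> M w" "J \<in> {J. card J = d \<and> J \<notin> M w}"
        then show "(indicator_vec J - indicator_vec I) \<bullet> x < p J - p I" unfolding eq using l [of I J] by simp
      qed
    next
      assume R: "?R x"
      have c: "reduced_cost p x I = reduced_cost p x J" if "I \<in> M w" "J \<in> M w" for I J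
        using R [THEN conjunct1, rule_format, OF that] unfolding eq by linarith
      have l: "reduced_cost p x I < reduced_cost p x J" if "I \<in> M w" "card J = d" "J \<notin> M w" for I J
        using R [THEN conjunct2, rule_format, of I J] that unfolding eq by simp
      have cardM: "card I = d" if "I \<in> M w" for I using that minimizersD(1) unfolding M_def by blast
      have "minimizers d p x = M w"
      proof (intro equalityI subsetI)
        fix I assume I: "I \<in> minimizers d p x"
        show "I \<in> M w"
          using l [OF B minimizersD(1) [OF I]] minimizersD(2) [OF I cardM [OF B]] by (meson not_le)
      next
        fix I assume I: "I \<in> M w"
        have "reduced_cost p x I \<le> reduced_cost p x J" if "card J = d" for J
          using c [OF I, of J] l [OF I that] by (cases "J \<in> M w") auto
        then show "I \<in> minimizers d p x" using cardM [OF I] by (simp add: minimizers_iff)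
      qed
      then show "x \<in> C w" by (simp add: C_def M_def)
    qed
  qed
  define A where "A = (\<Inter>I\<in>M w. \<Inter>J\<in>M w. {x. (indicator_vec J - indicator_vec I) \<bullet> x = p J - p I})"
  define U where "U = (\<Inter>I\<in>M w. \<Inter>J\<in>{J. card J = d \<and> J \<notin> M w}. {x. (indicator_vec J - indicator_vec I) \<bullet> x < p J - p I})"
  have CAU: "C w = A \<inter> U" unfolding set_eq_iff mw A_def U_def by blast
  have affA: "affine A" unfolding A_def by (intro affine_Inter) (auto intro!: affine_Inter affine_hyperplane)
  have "open U" unfolding U_def by (intro open_INT) (auto intro!: open_INT open_halfspace_lt)
  have convU: "convex U" unfolding U_def by (intro convex_INT) (auto intro!: convex_INT convex_halfspace_lt)
  have conv: "convex (C w)" unfolding CAU using affine_imp_convex [OF affA] convU by (rule convex_Int)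
  have hull: "affine hull (C w) \<subseteq> A" by (rule hull_minimal) (use CAU affA in auto)
  have "C w = affine hull (C w) \<inter> U" using hull hull_subset [of "C w" affine] CAU by blast
  then have "openin (top_of_set (affine hull (C w))) (C w)" using \<open>open U\<close> by (metis openin_open_Int)
  then have "rel_interior (C w) = C w" by (rule rel_interior_openin)
  moreover have "w \<in> C w" by (simp add: C_def)
  ultimately show "w \<in> rel_interior (closure (C w))"
    using convex_rel_interior_closure [OF conv] by blast
  have "closure (C w) \<subseteq> A"
    by (rule closure_minimal) (use CAU affA affine_closed in auto)
  then have hull': "affine hull (closure (C w)) \<subseteq> A" using affA by (rule hull_minimal)
  show "direction_space (closure (C w)) \<subseteq> constant_space (M w)"
  proof
    fix z assume "z \<in> direction_space (closure (C w))"
    then obtain x y where xy: "z = x - y" "x \<in> A" "y \<in> A" using hull' unfolding direction_space_def by blast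
    have "sum (($) z) I = sum (($) z) J" if "I \<in> M w" "J \<in> M w" for I J
    proof -
      have "(indicator_vec J - indicator_vec I) \<bullet> x = p J - p I" "(indicator_vec J - indicator_vec I) \<bullet> y = p J - p I"
        using xy that unfolding A_def by auto
      then have "(indicator_vec J - indicator_vec I) \<bullet> z = 0" unfolding xy(1) by (simp add: inner_diff_right)
      then show ?thesis by (simp add: inner_diff_right inner_commute [of _ z] inner_indicator_vec)
    qed
    then show "z \<in> constant_space (M w)" unfolding constant_space_def weight_constant_def by blast
  qed
qed

text \<open>Looplessness puts both strata of \<open>w\<close> inside the linear spaces, so their
  closures are faces with \<open>w\<close> in both relative interiors. The spanning condition for
  these two faces decomposes every vector.\<close>

lemma transverse_constant_spaces:
  fixes p p' :: "'n::finite set \<Rightarrow> real"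
  assumes val: "valuated_matroid d p" "valuated_matroid d' p'"
    and dims: "d \<le> CARD('n)" "d' \<le> CARD('n)" and tr: "meet_transversely d p d' p'"
    and ll: "\<And>e. \<exists>I\<in>minimizers d p w. e \<in> I" "\<And>e. \<exists>I\<in>minimizers d' p' w. e \<in> I"
  obtains v v' where "x = v + v'" "weight_constant (($) v) (minimizers d p w)"
    "weight_constant (($) v') (minimizers d' p' w)"
proof -
  let ?C = "{x. minimizers d p x = minimizers d p w}" and ?C' = "{x. minimizers d' p' x = minimizers d' p' w}"
  have "?C \<subseteq> tropical_linear_space d p" "?C' \<subseteq> tropical_linear_space d' p'"
    using loopless_imp_mem [OF val(1)] loopless_imp_mem [OF val(2)] ll by auto
  then have "closure ?C \<in> tls_faces d p" "closure ?C' \<in> tls_faces d' p'"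
    unfolding tls_faces_def by blast+
  moreover have "w \<in> rel_interior (closure ?C) \<inter> rel_interior (closure ?C')"
    using minimizers_stratum(1) dims by blast
  ultimately have "span (direction_space (closure ?C) \<union> direction_space (closure ?C')) = UNIV"
    using tr unfolding meet_transversely_def by blast
  moreover have "span (direction_space (closure ?C) \<union> direction_space (closure ?C')) \<subseteq>
      span (constant_space (minimizers d p w) \<union> constant_space (minimizers d' p' w))"
    using minimizers_stratum(2) dims by (intro span_mono Un_mono) auto
  ultimately have "x \<in> span (constant_space (minimizers d p w) \<union> constant_space (minimizers d' p' w))"
    by blast
  then show thesis
    using that unfolding span_Un span_eq_iff [THEN iffD2, OF subspace_constant_space]
    by (auto simp: constant_space_def)
qed

subsection \<open>Cycle matroids of series-parallel graphs\<close>

text \<open>A loop is counted once, so parity describes cycles only in loopless graphs;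
  series-parallel graphs are loopless.\<close>

definition degree_in :: "('e \<Rightarrow> 'v set) \<Rightarrow> 'e set \<Rightarrow> 'v \<Rightarrow> nat" where
  "degree_in ends C x = card {e \<in> C. x \<in> ends e}"

text \<open>In a finite loopless graph these are the members of the cycle space over the field with
  two elements.\<close>

definition even_subgraph :: "('e \<Rightarrow> 'v set) \<Rightarrow> 'e set \<Rightarrow> bool" where
  "even_subgraph ends C \<longleftrightarrow> (\<forall>x. even (degree_in ends C x))"

definition loopless :: "('e \<Rightarrow> 'v set) \<Rightarrow> 'e set \<Rightarrow> bool" where
  "loopless ends A \<longleftrightarrow> (\<forall>e\<in>A. \<exists>u v. u \<noteq> v \<and> ends e = {u, v})"

lemma graph_cycle_even:
  assumes "graph_cycle ends C" "loopless ends C"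
  shows "even_subgraph ends C" "C \<noteq> {}"
proof -
  obtain es vs where es: "es \<noteq> []" "length vs = length es" "distinct es" "distinct vs" "set es = C"
    and ends: "\<And>i. i < length es \<Longrightarrow> ends (es ! i) = {vs ! i, vs ! (Suc i mod length es)}"
    using assms(1) unfolding graph_cycle_def by blast
  let ?l = "length es"
  show "C \<noteq> {}" using es by auto
  have "?l \<noteq> 1"
  proof
    assume l: "?l = 1"
    then have "ends (es ! 0) = {vs ! 0}" using ends [of 0] by simp
    moreover have "es ! 0 \<in> C" using es l by (metis nth_mem zero_less_one)
    ultimately show False using assms(2) unfolding loopless_def by (metis doubleton_eq_iff insert_absorb2)
  qed
  then have l: "2 \<le> ?l" using es(1) by (cases es; cases "tl es") auto
  have "even (degree_in ends C x)" for x
  proof (cases "x \<in> set vs")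
    case False
    have "x \<notin> ends e" if "e \<in> C" for e
    proof -
      obtain i where i: "i < ?l" "e = es ! i" using \<open>e \<in> C\<close> es(5) by (metis in_set_conv_nth)
      have "Suc i mod ?l < ?l" using l by (intro mod_less_divisor) linarith
      then have "vs ! i \<in> set vs" "vs ! (Suc i mod ?l) \<in> set vs" using i es(2) by auto
      then show ?thesis using ends [OF i(1)] i(2) False by auto
    qed
    then have "{e \<in> C. x \<in> ends e} = {}" by blast
    then have "degree_in ends C x = 0" unfolding degree_in_def by (metis card.empty)
    then show ?thesis by simp
  next
    case True
    then obtain k where k: "k < ?l" "x = vs ! k" using es(2) by (metis in_set_conv_nth)
    \<comment> \<open>The cyclic predecessor of \<open>k\<close>: the cycle enters vertex
      \<open>k\<close> through edge \<open>k'\<close> and leaves through edge \<open>k\<close>. They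
      differ because a loopless cycle has length at least 2.\<close>
    define k' where "k' = (if k = 0 then ?l - 1 else k - 1)"
    have k': "k' < ?l" "k' \<noteq> k" using k l by (auto simp: k'_def)
    have suc: "Suc i mod ?l = k \<longleftrightarrow> i = k'" if "i < ?l" for i
    proof (cases "Suc i = ?l")
      case True
      then show ?thesis using k by (auto simp: k'_def)
    next
      case False
      then have "Suc i mod ?l = Suc i" using that by simp
      then show ?thesis using False k that by (auto simp: k'_def)
    qed
    have inc: "x \<in> ends (es ! i) \<longleftrightarrow> i = k \<or> i = k'" if "i < ?l" for i
    proof -
      have "Suc i mod ?l < ?l" using l by (intro mod_less_divisor) linarith
      then have "x = vs ! i \<longleftrightarrow> i = k" "x = vs ! (Suc i mod ?l) \<longleftrightarrow> Suc i mod ?l = k"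
        using k that es(2,4) by (auto simp: nth_eq_iff_index_eq)
      then show ?thesis using ends [OF that] suc [OF that] by auto
    qed
    have "{e \<in> C. x \<in> ends e} = {es ! k, es ! k'}"
    proof (intro equalityI subsetI)
      fix e assume "e \<in> {e \<in> C. x \<in> ends e}"
      then obtain i where "i < ?l" "e = es ! i" "x \<in> ends (es ! i)" using es(5) by (auto simp: in_set_conv_nth)
      then show "e \<in> {es ! k, es ! k'}" using inc by auto
    next
      fix e assume "e \<in> {es ! k, es ! k'}"
      then show "e \<in> {e \<in> C. x \<in> ends e}" using inc k(1) k'(1) es(5) by auto
    qed
    moreover have "es ! k \<noteq> es ! k'" using k k' es(3) by (simp add: nth_eq_iff_index_eq)
    ultimately show ?thesis by (simp add: degree_in_def)
  qed
  then show "even_subgraph ends C" by (simp add: even_subgraph_def)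
qed

definition simple_path :: "('e \<Rightarrow> 'v set) \<Rightarrow> 'e set \<Rightarrow> 'e list \<Rightarrow> 'v list \<Rightarrow> bool" where
  "simple_path ends C es vs \<longleftrightarrow> length vs = Suc (length es) \<and> distinct vs \<and> set es \<subseteq> C \<and>
     (\<forall>i<length es. ends (es ! i) = {vs ! i, vs ! Suc i})"

lemma simple_path_distinct_edges:
  assumes "simple_path ends C es vs"
  shows "distinct es"
  unfolding distinct_conv_nth
proof (intro allI impI notI)
  fix i j assume ij: "i < length es" "j < length es" "i \<noteq> j" "es ! i = es ! j"
  then have "{vs ! i, vs ! Suc i} = {vs ! j, vs ! Suc j}" using assms unfolding simple_path_def by metis
  moreover have "distinct vs" "length vs = Suc (length es)" using assms by (auto simp: simple_path_def)
  ultimately show False using ij by (auto simp: doubleton_eq_iff nth_eq_iff_index_eq)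
qed

text \<open>A longest simple path closes up to a cycle at its first vertex, which has degree at least 2.\<close>

lemma even_subgraph_cycle:
  assumes "finite C" "loopless ends C" "C \<noteq> {}" "even_subgraph ends C"
  shows "\<exists>D\<subseteq>C. graph_cycle ends D"
proof -
  have finV: "finite (\<Union>(ends ` C))" using assms(1,2) by (auto simp: loopless_def)
  have bound: "length es \<le> card (\<Union>(ends ` C))" if sp: "simple_path ends C es vs" for es vs
  proof -
    have "set (tl vs) \<subseteq> \<Union>(ends ` C)"
    proof
      fix x assume "x \<in> set (tl vs)"
      then obtain i where "i < length es" "x = vs ! Suc i"
        using sp by (auto simp: in_set_conv_nth simple_path_def nth_tl)
      then show "x \<in> \<Union>(ends ` C)" using sp by (force simp: simple_path_def)
    qed
    then have "card (set (tl vs)) \<le> card (\<Union>(ends ` C))" using finV by (rule card_mono [rotated])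
    moreover have "card (set (tl vs)) = length es"
      using sp by (simp add: simple_path_def distinct_card distinct_tl)
    ultimately show ?thesis by simp
  qed
  obtain e0 where e0: "e0 \<in> C" using assms(3) by blast
  then obtain u v where "u \<noteq> v" "ends e0 = {u, v}" using assms(2) unfolding loopless_def by blast
  then have "simple_path ends C [e0] [u, v]" using e0 by (simp add: simple_path_def)
  then have start: "\<exists>es vs. simple_path ends C es vs \<and> length es = length [e0]" by blast
  define P where "P k \<longleftrightarrow> (\<exists>es vs. simple_path ends C es vs \<and> length es = k)" for k
  have "P 1" using start by (simp add: P_def)
  moreover have "\<forall>k. P k \<longrightarrow> k \<le> card (\<Union>(ends ` C))" using bound by (auto simp: P_def)
  ultimately obtain m where m: "P m" "\<And>k. P k \<Longrightarrow> k \<le> m"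
    using GreatestI_nat [of P 1] Greatest_le_nat [of P] by metis
  then obtain es vs where sp: "simple_path ends C es vs" "length es = m" by (auto simp: P_def)
  have "1 \<le> m" using m(2) \<open>P 1\<close> by blast
  then have len: "0 < length es" using sp by simp
  have vs: "length vs = Suc (length es)" "distinct vs" "set es \<subseteq> C"
    "\<And>i. i < length es \<Longrightarrow> ends (es ! i) = {vs ! i, vs ! Suc i}"
    using sp(1) by (auto simp: simple_path_def)
  have h0: "es ! 0 \<in> {e \<in> C. vs ! 0 \<in> ends e}" using vs len by auto
  have "\<exists>g\<in>C. vs ! 0 \<in> ends g \<and> g \<noteq> es ! 0"
  proof (rule ccontr)
    assume "\<not> ?thesis"
    then have "{e \<in> C. vs ! 0 \<in> ends e} = {es ! 0}" using h0 by blast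
    then have "degree_in ends C (vs ! 0) = 1" by (simp add: degree_in_def)
    then show False using assms(4) unfolding even_subgraph_def by (metis odd_one)
  qed
  then obtain g where g: "g \<in> C" "vs ! 0 \<in> ends g" "g \<noteq> es ! 0" by blast
  then obtain y where y: "ends g = {y, vs ! 0}" "y \<noteq> vs ! 0"
    using assms(2) unfolding loopless_def by (metis doubleton_eq_iff insertE singletonD)
  have "y \<in> set vs"
  proof (rule ccontr)
    assume "y \<notin> set vs"
    then have "simple_path ends C (g # es) (y # vs)"
      using vs g y by (auto simp: simple_path_def nth_Cons split: nat.splits)
    then have "P (Suc m)" using sp(2) by (auto simp: P_def)
    then show False using m(2) by fastforce
  qed
  then obtain i where i: "i < length vs" "y = vs ! i" by (metis in_set_conv_nth)
  then have il: "i \<le> length es" "i \<noteq> 0" using vs y by (auto intro: ccontr)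
  \<comment> \<open>The edge \<open>g\<close> leads from vertex \<open>i\<close> back to vertex 0
    and closes the initial segment with \<open>i\<close> edges. For \<open>i = 1\<close> it is
    parallel to the first edge.\<close>
  let ?es = "take i es @ [g]" and ?vs = "take (Suc i) vs"
  have "g \<notin> set (take i es)"
  proof
    assume "g \<in> set (take i es)"
    then obtain j where j: "j < length es" "g = es ! j" by (auto simp: in_set_conv_nth)
    then have "vs ! 0 = vs ! j \<or> vs ! 0 = vs ! Suc j" using g vs(4) by auto
    then have "j = 0" using vs j by (auto simp: nth_eq_iff_index_eq)
    then show False using g j by simp
  qed
  then have "distinct ?es" using simple_path_distinct_edges [OF sp(1)] by simp
  moreover have "length ?vs = length ?es" "distinct ?vs" using il vs by simp_all
  moreover have "ends (?es ! j) = {?vs ! j, ?vs ! (Suc j mod length ?es)}" if "j < length ?es" for j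
  proof -
    have l: "length ?es = Suc i" using il by simp
    show ?thesis
    proof (cases "j = i")
      case True
      then show ?thesis using il y i l by (simp add: nth_append)
    next
      case False
      then have "j < i" using that l by simp
      then show ?thesis using vs(4) [of j] il l by (simp add: nth_append)
    qed
  qed
  ultimately have "graph_cycle ends (set ?es)" unfolding graph_cycle_def by blast
  moreover have "set ?es \<subseteq> C" using vs(3) g(1) set_take_subset [of i es] by auto
  ultimately show ?thesis by blast
qed

text \<open>Replaces cyclic sequences by parity of degrees, which is easy to trace when an edge is
  doubled or subdivided.\<close>

lemma forest_iff_even:
  assumes "finite A" "loopless ends A"
  shows "forest ends A \<longleftrightarrow> (\<forall>C\<subseteq>A. even_subgraph ends C \<longrightarrow> C = {})"
proof -
  have sub: "finite C" "loopless ends C" if "C \<subseteq> A" for C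
    using assms that by (auto simp: loopless_def intro: finite_subset)
  show ?thesis
    unfolding forest_def
    using graph_cycle_even sub even_subgraph_cycle by (metis subset_trans)
qed

lemma even_subgraph_image:
  assumes "inj_on s C" "\<And>c. c \<in> C \<Longrightarrow> ends (s c) = ends' c"
  shows "even_subgraph ends (s ` C) \<longleftrightarrow> even_subgraph ends' C"
proof -
  have "degree_in ends (s ` C) x = degree_in ends' C x" for x
  proof -
    have "{c \<in> s ` C. x \<in> ends c} = s ` {c \<in> C. x \<in> ends' c}" using assms(2) by auto
    moreover have "inj_on s {c \<in> C. x \<in> ends' c}" using assms(1) by (rule inj_on_subset) auto
    ultimately show ?thesis by (simp add: degree_in_def card_image)
  qed
  then show ?thesis by (simp add: even_subgraph_def)
qed

lemma forest_image:
  assumes "finite A" "loopless ends' A" "inj_on s A" "\<And>c. c \<in> A \<Longrightarrow> ends (s c) = ends' c"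
  shows "forest ends (s ` A) \<longleftrightarrow> forest ends' A"
proof -
  have "loopless ends (s ` A)" using assms by (auto simp: loopless_def)
  moreover have "even_subgraph ends (s ` C) \<longleftrightarrow> even_subgraph ends' C" if "C \<subseteq> A" for C
    using that assms by (intro even_subgraph_image) (auto intro: inj_on_subset)
  ultimately show ?thesis
    using forest_iff_even [OF assms(1,2)] forest_iff_even [of "s ` A" ends] assms(1)
    by (simp add: all_subset_image)
qed

lemma forest_cong:
  assumes "finite A" "loopless ends' A" "\<And>c. c \<in> A \<Longrightarrow> ends c = ends' c"
  shows "forest ends A \<longleftrightarrow> forest ends' A"
  using forest_image [of A ends' "\<lambda>x. x" ends] assms by simp

lemma series_parallel_graph_loopless:
  "series_parallel_graph E ends \<Longrightarrow> finite E \<and> loopless ends E"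
proof (induction rule: series_parallel_graph.induct)
  case (single_edge u v ends e)
  then show ?case by (auto simp: loopless_def)
next
  case (parallel_extension E ends e f)
  then show ?case by (auto simp: loopless_def)
next
  case (series_extension E ends e f u v w)
  then have "u \<noteq> v" "u \<noteq> w" "w \<noteq> v" by (auto simp: loopless_def doubleton_eq_iff)
  then show ?case using series_extension by (auto simp: loopless_def)
qed

section \<open>Bases under parallel and series extension\<close>

definition maximal_sets :: "('a set \<Rightarrow> bool) \<Rightarrow> 'a set \<Rightarrow> 'a set set" where
  "maximal_sets P E = {B. B \<subseteq> E \<and> P B \<and> (\<forall>A. B \<subseteq> A \<longrightarrow> A \<subseteq> E \<longrightarrow> P A \<longrightarrow> A = B)}"

lemma maximal_setsD:
  "B \<in> maximal_sets P E \<Longrightarrow> B \<subseteq> E" "B \<in> maximal_sets P E \<Longrightarrow> P B"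
  "B \<in> maximal_sets P E \<Longrightarrow> B \<subseteq> A \<Longrightarrow> A \<subseteq> E \<Longrightarrow> P A \<Longrightarrow> A = B"
  by (simp_all add: maximal_sets_def)

lemma maximal_setsI:
  "B \<subseteq> E \<Longrightarrow> P B \<Longrightarrow> (\<And>A. B \<subseteq> A \<Longrightarrow> A \<subseteq> E \<Longrightarrow> P A \<Longrightarrow> A = B) \<Longrightarrow> B \<in> maximal_sets P E"
  by (simp add: maximal_sets_def)

text \<open>In the next lemmas \<open>P\<close> and \<open>P'\<close> stand for being a forest before and after
  the parallel or series extension of \<open>e\<close> by \<open>f\<close>.\<close>

lemma maximal_sets_parallel:
  assumes ef: "e \<in> E" "f \<notin> E"
    and P: "\<And>A. A \<subseteq> E \<Longrightarrow> P' A \<longleftrightarrow> P A"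
    and Pf: "\<And>A. A \<subseteq> E \<Longrightarrow> e \<notin> A \<Longrightarrow> P' (insert f A) \<longleftrightarrow> P (insert e A)"
    and Pef: "\<And>A. A \<subseteq> E \<Longrightarrow> e \<in> A \<Longrightarrow> \<not> P' (insert f A)"
  shows "maximal_sets P' (insert f E) =
    maximal_sets P E \<union> {insert f (B - {e}) | B. B \<in> maximal_sets P E \<and> e \<in> B}" (is "_ = _ \<union> ?S")
proof (intro equalityI subsetI)
  fix A assume A: "A \<in> maximal_sets P' (insert f E)"
  note m = maximal_setsD [OF A]
  show "A \<in> maximal_sets P E \<union> ?S"
  proof (cases "f \<in> A")
    case False
    then have "A \<subseteq> E" using m(1) by blast
    have "A \<in> maximal_sets P E"
    proof (rule maximal_setsI [OF \<open>A \<subseteq> E\<close>])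
      show "P A" using P [OF \<open>A \<subseteq> E\<close>] m(2) by simp
      fix D assume D: "A \<subseteq> D" "D \<subseteq> E" "P D"
      then show "D = A" using P [OF D(2)] by (intro m(3)) auto
    qed
    then show ?thesis by (rule UnI1)
  next
    case True
    then obtain A0 where A0: "A = insert f A0" "f \<notin> A0" by (meson mk_disjoint_insert)
    then have "A0 \<subseteq> E" using m(1) by blast
    moreover from this have "e \<notin> A0" using Pef m(2) A0 by blast
    ultimately have P0: "P (insert e A0)" using Pf m(2) A0 by blast
    have "insert e A0 \<in> maximal_sets P E"
    proof (rule maximal_setsI)
      show "insert e A0 \<subseteq> E" using \<open>A0 \<subseteq> E\<close> ef by blast
      show "P (insert e A0)" by (rule P0)
      fix D assume D: "insert e A0 \<subseteq> D" "D \<subseteq> E" "P D"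
      then have "P' (insert f (D - {e}))" using Pf [of "D - {e}"] by (auto simp: insert_absorb)
      then have "insert f (D - {e}) = A" using m(3) [of "insert f (D - {e})"] D A0 \<open>e \<notin> A0\<close> by blast
      moreover have "f \<notin> D - {e}" using D(2) ef(2) by auto
      ultimately have "D - {e} = A0" using A0 by (simp add: insert_ident)
      then show "D = insert e A0" using D by blast
    qed
    moreover have "A = insert f (insert e A0 - {e})" using A0 \<open>e \<notin> A0\<close> by simp
    ultimately show ?thesis by blast
  qed
next
  fix A assume "A \<in> maximal_sets P E \<union> ?S"
  then consider "A \<in> maximal_sets P E" | B where "A = insert f (B - {e})" "B \<in> maximal_sets P E" "e \<in> B" by blast
  then show "A \<in> maximal_sets P' (insert f E)"
  proof cases
    case 1
    note m = maximal_setsD [OF 1]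
    show ?thesis
    proof (rule maximal_setsI)
      show "A \<subseteq> insert f E" "P' A" using m P by auto
      fix D assume D: "A \<subseteq> D" "D \<subseteq> insert f E" "P' D"
      show "D = A"
      proof (cases "f \<in> D")
        case False
        then have "D \<subseteq> E" using D by blast
        then show ?thesis using m(3) D P by blast
      next
        case True
        then obtain D0 where D0: "D = insert f D0" "f \<notin> D0" by (meson mk_disjoint_insert)
        then have "D0 \<subseteq> E" "A \<subseteq> D0" using D m(1) ef by blast+
        moreover have "e \<notin> D0" using Pef D D0 \<open>D0 \<subseteq> E\<close> by blast
        ultimately have "insert e D0 = A" using Pf D D0 ef by (intro m(3)) auto
        then show ?thesis using \<open>e \<notin> D0\<close> \<open>A \<subseteq> D0\<close> by blast
      qed
    qed
  next
    case 2
    note m = maximal_setsD [OF 2(2)]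
    have fB: "f \<notin> B" using m(1) ef by blast
    show ?thesis
    proof (rule maximal_setsI)
      show "A \<subseteq> insert f E" using m 2 by auto
      show "P' A" using Pf [of "B - {e}"] m 2 by (auto simp: insert_absorb)
      fix D assume D: "A \<subseteq> D" "D \<subseteq> insert f E" "P' D"
      then obtain D0 where D0: "D = insert f D0" "f \<notin> D0" using 2(1) by (metis insert_subset mk_disjoint_insert)
      then have "D0 \<subseteq> E" using D by blast
      moreover have "e \<notin> D0" using Pef D D0 \<open>D0 \<subseteq> E\<close> by blast
      moreover have "B - {e} \<subseteq> D0" using D D0 2(1) fB by blast
      ultimately have "insert e D0 = B" using Pf D D0 ef by (intro m(3)) auto
      then show "D = A" using D0 2(1) \<open>e \<notin> D0\<close> by blast
    qed
  qed
qed

text \<open>Of the series pair, a single edge is free to add, like a pendant edge, and both together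
  behave like the old \<open>e\<close>. Hence a maximal set contains at least one of the two, and
  both exactly if the old one contains \<open>e\<close>.\<close>

lemma maximal_sets_series:
  assumes ef: "e \<in> E" "f \<notin> E"
    and P0: "\<And>A. A \<subseteq> E - {e} \<Longrightarrow> P' A \<longleftrightarrow> P A"
    and Pe: "\<And>A. A \<subseteq> E - {e} \<Longrightarrow> P' (insert e A) \<longleftrightarrow> P A"
    and Pf: "\<And>A. A \<subseteq> E - {e} \<Longrightarrow> P' (insert f A) \<longleftrightarrow> P A"
    and Pef: "\<And>A. A \<subseteq> E - {e} \<Longrightarrow> P' (insert e (insert f A)) \<longleftrightarrow> P (insert e A)"
  shows "maximal_sets P' (insert f E) =
    insert f ` maximal_sets P E \<union> {insert e B | B. B \<in> maximal_sets P E \<and> e \<notin> B}" (is "_ = _ \<union> ?S")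
proof (intro equalityI subsetI)
  fix A assume A: "A \<in> maximal_sets P' (insert f E)"
  note m = maximal_setsD [OF A]
  define A0 where "A0 = A - {e, f}"
  have A0: "A0 \<subseteq> E - {e}" "f \<notin> A0" "e \<notin> A0" using m(1) by (auto simp: A0_def)
  have max0: "A0 \<in> maximal_sets P E"
    if c: "c \<in> {e, f}" "A = insert c A0" and P: "P A0" and Pc: "\<And>A. A \<subseteq> E - {e} \<Longrightarrow> P' (insert c A) \<longleftrightarrow> P A" for c
  proof (rule maximal_setsI)
    show "A0 \<subseteq> E" "P A0" using A0 P by auto
    fix D assume D: "A0 \<subseteq> D" "D \<subseteq> E" "P D"
    show "D = A0"
    proof (cases "e \<in> D")
      case False
      then have "D \<subseteq> E - {e}" using D by blast
      then have "insert c D = A" using Pc D c ef by (intro m(3)) auto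
      moreover have "c \<notin> D" "c \<notin> A0" using c(1) A0 False D(2) ef(2) by auto
      ultimately show ?thesis using c(2) by (simp add: insert_ident)
    next
      case True
      then have "P' (insert e (insert f (D - {e})))" using Pef [of "D - {e}"] D by (auto simp: insert_absorb)
      then have "insert e (insert f (D - {e})) = A" using D c ef by (intro m(3)) auto
      then have "e \<in> A" "f \<in> A" by auto
      then show ?thesis using c A0 ef by auto
    qed
  qed
  consider "e \<notin> A" "f \<notin> A" | "e \<in> A" "f \<notin> A" | "e \<notin> A" "f \<in> A" | "e \<in> A" "f \<in> A" by blast
  then show "A \<in> insert f ` maximal_sets P E \<union> ?S"
  proof cases
    case 1
    then have "A = A0" by (auto simp: A0_def)
    then have "insert e A = A" using m(2) P0 Pe A0 ef m(1) by (intro m(3)) auto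
    then show ?thesis using 1 by blast
  next
    case 2
    then have AA: "A = insert e A0" by (auto simp: A0_def)
    then have "A0 \<in> maximal_sets P E" using m(2) Pe A0 by (intro max0 [of e]) auto
    then show ?thesis using AA A0 by blast
  next
    case 3
    then have AA: "A = insert f A0" by (auto simp: A0_def)
    then have "A0 \<in> maximal_sets P E" using m(2) Pf A0 by (intro max0 [of f]) auto
    then show ?thesis using AA by blast
  next
    case 4
    then have AA: "A = insert e (insert f A0)" by (auto simp: A0_def)
    have "insert e A0 \<in> maximal_sets P E"
    proof (rule maximal_setsI)
      show "insert e A0 \<subseteq> E" using A0 ef by blast
      show "P (insert e A0)" using Pef A0 m(2) AA by blast
      fix D assume D: "insert e A0 \<subseteq> D" "D \<subseteq> E" "P D"
      then have "P' (insert e (insert f (D - {e})))" using Pef [of "D - {e}"] by (auto simp: insert_absorb)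
      then have "insert e (insert f (D - {e})) = A" using D AA A0 ef by (intro m(3)) auto
      moreover have "f \<notin> D" using D(2) ef(2) by auto
      ultimately have "D - {e} = A0" unfolding A0_def by auto
      then show "D = insert e A0" using D by blast
    qed
    moreover have "A = insert f (insert e A0)" using AA by blast
    ultimately show ?thesis by blast
  qed
next
  fix A assume "A \<in> insert f ` maximal_sets P E \<union> ?S"
  then consider B where "A = insert f B" "B \<in> maximal_sets P E" "e \<in> B"
    | B c where "A = insert c B" "B \<in> maximal_sets P E" "e \<notin> B" "c = e \<or> c = f" by blast
  then show "A \<in> maximal_sets P' (insert f E)"
  proof cases
    case 1
    note m = maximal_setsD [OF 1(2)]
    have eqB: "insert e (B - {e}) = B" "insert e (insert f (B - {e})) = A" using 1 by auto
    show ?thesis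
    proof (rule maximal_setsI)
      show "A \<subseteq> insert f E" using m 1 by auto
      show "P' A" using Pef [of "B - {e}"] m 1 eqB by auto
      fix D assume D: "A \<subseteq> D" "D \<subseteq> insert f E" "P' D"
      have "insert e (insert f (D - {e, f})) = D" using D 1 by auto
      moreover have sub: "D - {e, f} \<subseteq> E - {e}" using D by auto
      ultimately have "P (insert e (D - {e, f}))" using Pef [OF sub] D(3) by simp
      then have "insert e (D - {e, f}) = B" using D 1 m(1) ef by (intro m(3)) auto
      then show "D = A" using D 1 by blast
    qed
  next
    case 2
    note m = maximal_setsD [OF 2(2)]
    have B: "B \<subseteq> E - {e}" "f \<notin> B" using m(1) 2 ef by auto
    have Pc: "P' (insert c X) \<longleftrightarrow> P X" if "X \<subseteq> E - {e}" for X using 2(4) Pe Pf that by blast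
    show ?thesis
    proof (rule maximal_setsI)
      show "A \<subseteq> insert f E" using m 2 ef by auto
      show "P' A" using Pc [OF B(1)] m(2) 2(1) by simp
      fix D assume D: "A \<subseteq> D" "D \<subseteq> insert f E" "P' D"
      have sub: "D - {e, f} \<subseteq> E - {e}" using D by auto
      have BD: "B \<subseteq> D - {e, f}" using B D 2 by auto
      show "D = A"
      proof (cases "e \<in> D \<and> f \<in> D")
        case True
        then have "insert e (insert f (D - {e, f})) = D" by auto
        then have "P (insert e (D - {e, f}))" using Pef [OF sub] D(3) by simp
        then have "insert e (D - {e, f}) = B" using BD sub ef by (intro m(3)) auto
        then show ?thesis using 2(3) by blast
      next
        case False
        then have eq: "insert c (D - {e, f}) = D" using 2 D by auto
        then have "P (D - {e, f})" using Pc [OF sub] D(3) by simp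
        then have "D - {e, f} = B" using BD sub by (intro m(3)) auto
        then show ?thesis using eq 2 by simp
      qed
    qed
  qed
qed

lemma cycle_matroid_bases_maximal: "cycle_matroid_bases E ends = maximal_sets (forest ends) E"
  by (simp add: cycle_matroid_bases_def maximal_sets_def)

lemma loopless_subset: "loopless ends E \<Longrightarrow> A \<subseteq> E \<Longrightarrow> loopless ends A"
  by (auto simp: loopless_def)

text \<open>In place of \<open>e\<close> the new edge \<open>f\<close> is merely another label,
  while \<open>e\<close> and \<open>f\<close> together form an even subgraph.\<close>

lemma forest_parallel:
  assumes fin: "finite E" and ll: "loopless ends E" and ef: "e \<in> E" "f \<notin> E" and A: "A \<subseteq> E"
  defines "ends' \<equiv> ends(f := ends e)"
  shows "forest ends' A \<longleftrightarrow> forest ends A"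
    and "e \<notin> A \<Longrightarrow> forest ends' (insert f A) \<longleftrightarrow> forest ends (insert e A)"
    and "e \<in> A \<Longrightarrow> \<not> forest ends' (insert f A)"
proof -
  have finA: "finite A" using A fin by (rule finite_subset)
  have fA: "f \<notin> A" using A ef by blast
  show "forest ends' A \<longleftrightarrow> forest ends A"
    using fA by (intro forest_cong finA loopless_subset [OF ll A]) (auto simp: ends'_def)
  have ll': "loopless ends' (insert f A)"
    using ll A ef by (auto simp: loopless_def ends'_def)
  {
    assume "e \<notin> A"
    let ?s = "id(f := e)"
    have "?s ` insert f A = insert e A" using fA by auto
    moreover have "inj_on ?s (insert f A)" using fA \<open>e \<notin> A\<close> by (auto simp: inj_on_def)
    ultimately show "forest ends' (insert f A) \<longleftrightarrow> forest ends (insert e A)"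
      using forest_image [of "insert f A" ends' ?s ends] finA ll' fA by (auto simp: ends'_def)
  next
    assume "e \<in> A"
    have ne: "e \<noteq> f" using ef by blast
    have "even_subgraph ends' {e, f}"
      unfolding even_subgraph_def
    proof
      fix x
      have "{c \<in> {e, f}. x \<in> ends' c} = (if x \<in> ends e then {e, f} else {})"
        using ne by (auto simp: ends'_def)
      then show "even (degree_in ends' {e, f} x)" using ne by (simp add: degree_in_def)
    qed
    moreover have "{e, f} \<subseteq> insert f A" using \<open>e \<in> A\<close> by blast
    ultimately show "\<not> forest ends' (insert f A)"
      unfolding forest_iff_even [OF finite.insertI [OF finA] ll'] by (metis insert_not_empty)
  }
qed

text \<open>The new vertex \<open>w\<close> meets only \<open>e\<close> and \<open>f\<close>, so
  evenness there couples them. At \<open>v\<close> the edge \<open>f\<close> takes over the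
  incidence of the old \<open>e\<close>, and all other degrees are unchanged.\<close>

lemma even_subgraph_series:
  assumes "finite E" and ll: "loopless ends E" and ef: "e \<in> E" "f \<notin> E"
    and uv: "ends e = {u, v}" and w: "w \<notin> \<Union>(ends ` E)" and C: "C \<subseteq> insert f E"
  shows "even_subgraph (ends(e := {u, w}, f := {w, v})) C \<longleftrightarrow>
    (e \<in> C \<longleftrightarrow> f \<in> C) \<and> even_subgraph ends (C - {f})"
proof -
  let ?ends = "ends(e := {u, w}, f := {w, v})"
  have ne: "e \<noteq> f" "u \<noteq> v" "w \<noteq> u" "w \<noteq> v"
    using ll ef uv w by (auto simp: loopless_def doubleton_eq_iff)
  have finC: "finite C" using C assms(1) by (meson finite.insertI finite_subset)
  have we: "w \<notin> ends c" if "c \<in> C" "c \<noteq> f" for c using that C w by blast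
  have w_set: "{c \<in> C. w \<in> ?ends c} = C \<inter> {e, f}" using we by auto
  have degw: "even (degree_in ?ends C w) \<longleftrightarrow> (e \<in> C \<longleftrightarrow> f \<in> C)"
    unfolding degree_in_def w_set using ne(1) by (cases "e \<in> C"; cases "f \<in> C") (auto simp: Int_insert_right)
  have "{c \<in> C - {f}. w \<in> ends c} = {}" using we by auto
  then have degw0: "degree_in ends (C - {f}) w = 0" unfolding degree_in_def by (metis card.empty)
  have deg: "degree_in ?ends C x = degree_in ends (C - {f}) x" if x: "x \<noteq> w" and iff: "e \<in> C \<longleftrightarrow> f \<in> C" for x
  proof (cases "x = v \<and> e \<in> C")
    case True
    let ?S = "{c \<in> C - {e, f}. v \<in> ends c}"
    have "{c \<in> C. v \<in> ?ends c} = insert f ?S" "{c \<in> C - {f}. v \<in> ends c} = insert e ?S"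
      using True iff ne uv by auto
    moreover have "card (insert f ?S) = card (insert e ?S)" using finC by simp
    ultimately show ?thesis using True unfolding degree_in_def by simp
  next
    case False
    then have "{c \<in> C. x \<in> ?ends c} = {c \<in> C - {f}. x \<in> ends c}"
      using iff ne uv x by auto
    then show ?thesis unfolding degree_in_def by simp
  qed
  show ?thesis
  proof
    assume L: "even_subgraph ?ends C"
    then have iff: "e \<in> C \<longleftrightarrow> f \<in> C" using degw unfolding even_subgraph_def by blast
    have "even (degree_in ends (C - {f}) x)" for x
      using L deg [OF _ iff, of x] degw0 unfolding even_subgraph_def by (cases "x = w") (simp, metis)
    then show "(e \<in> C \<longleftrightarrow> f \<in> C) \<and> even_subgraph ends (C - {f})" using iff unfolding even_subgraph_def by blast
  next
    assume R: "(e \<in> C \<longleftrightarrow> f \<in> C) \<and> even_subgraph ends (C - {f})"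
    have "even (degree_in ?ends C x)" for x
      using R deg [of x] degw unfolding even_subgraph_def by (cases "x = w") (blast, metis)
    then show "even_subgraph ?ends C" unfolding even_subgraph_def by blast
  qed
qed

lemma forest_series:
  assumes fin: "finite E" and ll: "loopless ends E" and ef: "e \<in> E" "f \<notin> E"
    and uv: "ends e = {u, v}" and w: "w \<notin> \<Union>(ends ` E)" and A: "A \<subseteq> E - {e}"
  defines "ends' \<equiv> ends(e := {u, w}, f := {w, v})"
  shows "forest ends' A \<longleftrightarrow> forest ends A"
    and "forest ends' (insert e A) \<longleftrightarrow> forest ends A"
    and "forest ends' (insert f A) \<longleftrightarrow> forest ends A"
    and "forest ends' (insert e (insert f A)) \<longleftrightarrow> forest ends (insert e A)"
proof -
  have finA: "finite A" using A fin by (meson finite_Diff finite_subset)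
  have nA: "e \<notin> A" "f \<notin> A" "e \<noteq> f" using A ef by auto
  have ne: "u \<noteq> v" "w \<noteq> u" "w \<noteq> v"
    using ll ef uv w by (auto simp: loopless_def doubleton_eq_iff)
  have ll': "loopless ends' (insert f E)" unfolding loopless_def
  proof
    fix c assume "c \<in> insert f E"
    then show "\<exists>u v. u \<noteq> v \<and> ends' c = {u, v}"
      using ne ll by (cases "c = f"; cases "c = e") (auto simp: ends'_def loopless_def)
  qed
  note ev = even_subgraph_series [OF fin ll ef uv w, folded ends'_def]
  have forest': "forest ends' X \<longleftrightarrow> (\<forall>C\<subseteq>X. (e \<in> C \<longleftrightarrow> f \<in> C) \<longrightarrow> even_subgraph ends (C - {f}) \<longrightarrow> C = {})"
    if X: "X \<subseteq> insert f E" for X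
  proof -
    have "finite X" "loopless ends' X"
      using X fin loopless_subset [OF ll' X] by (auto intro: finite_subset)
    then show ?thesis using forest_iff_even [of X ends'] ev X by (metis subset_trans)
  qed
  have forest0: "forest ends X \<longleftrightarrow> (\<forall>C\<subseteq>X. even_subgraph ends C \<longrightarrow> C = {})" if X: "X \<subseteq> E" for X
    by (rule forest_iff_even [OF finite_subset [OF X fin] loopless_subset [OF ll X]])
  have sub: "A \<subseteq> E" "A \<subseteq> insert f E" "insert e A \<subseteq> insert f E" "insert f A \<subseteq> insert f E"
    "insert e (insert f A) \<subseteq> insert f E" "insert e A \<subseteq> E" using A ef by auto
  have one: "forest ends' X \<longleftrightarrow> forest ends A" if X: "A \<subseteq> X" "X \<subseteq> insert e (insert f A)" "\<not> (e \<in> X \<and> f \<in> X)" for X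
  proof -
    have "(C \<subseteq> X \<and> (e \<in> C \<longleftrightarrow> f \<in> C)) \<longleftrightarrow> C \<subseteq> A" for C using X nA by blast
    moreover have "C - {f} = C" if "C \<subseteq> A" for C using that nA by blast
    moreover have "X \<subseteq> insert f E" using X sub by blast
    ultimately show ?thesis unfolding forest0 [OF sub(1)] using forest' by metis
  qed
  show "forest ends' A \<longleftrightarrow> forest ends A" using nA by (intro one) auto
  show "forest ends' (insert e A) \<longleftrightarrow> forest ends A" using nA by (intro one) auto
  show "forest ends' (insert f A) \<longleftrightarrow> forest ends A" using nA by (intro one) auto
  show "forest ends' (insert e (insert f A)) \<longleftrightarrow> forest ends (insert e A)"
    unfolding forest0 [OF sub(6)] forest' [OF sub(5)]
  proof (intro iffI allI impI)
    fix C assume *: "\<forall>C\<subseteq>insert e (insert f A). (e \<in> C \<longleftrightarrow> f \<in> C) \<longrightarrow> even_subgraph ends (C - {f}) \<longrightarrow> C = {}"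
      and C: "C \<subseteq> insert e A" "even_subgraph ends C"
    \<comment> \<open>An even subgraph through the old edge is lifted by following the
      subdivision.\<close>
    let ?D = "if e \<in> C then insert f C else C"
    have "?D \<subseteq> insert e (insert f A)" "e \<in> ?D \<longleftrightarrow> f \<in> ?D" "?D - {f} = C" using C nA by auto
    then have "?D = {}" using * C(2) by metis
    then show "C = {}" by (auto split: if_splits)
  next
    fix C assume *: "\<forall>C\<subseteq>insert e A. even_subgraph ends C \<longrightarrow> C = {}"
      and C: "C \<subseteq> insert e (insert f A)" "e \<in> C \<longleftrightarrow> f \<in> C" "even_subgraph ends (C - {f})"
    have "C - {f} \<subseteq> insert e A" using C by blast
    then have "C - {f} = {}" using * C(3) by blast
    then show "C = {}" using C(2) nA by blast
  qed
qed

lemma dprod_singleton_left: "A \<subseteq> Pow (- {e}) \<Longrightarrow> {{e}} \<otimes> A = insert e ` A"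
  unfolding dprod_def by blast

text \<open>With x and y for the edges \<open>e\<close> and \<open>f\<close>, the basis polynomial x
  P + R becomes (x + y) P + R: the variable x is replaced by x + y.\<close>

lemma cycle_matroid_bases_parallel:
  assumes sp: "series_parallel_graph E ends" and ef: "e \<in> E" "f \<notin> E"
    and cm: "cycle_matroid_bases E ends = {{e}} \<otimes> P \<union> R" and PR: "P \<subseteq> Pow (E - {e})" "R \<subseteq> Pow (E - {e})"
  shows "cycle_matroid_bases (insert f E) (ends(f := ends e)) = {{e}} \<otimes> P \<union> ({{f}} \<otimes> P \<union> R)"
proof -
  have fl: "finite E" "loopless ends E" using series_parallel_graph_loopless [OF sp] by auto
  have eP: "{{e}} \<otimes> P = insert e ` P" "{{f}} \<otimes> P = insert f ` P"
    using PR ef by (auto intro!: dprod_singleton_left)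
  have "cycle_matroid_bases (insert f E) (ends(f := ends e)) = cycle_matroid_bases E ends \<union>
      {insert f (B - {e}) | B. B \<in> cycle_matroid_bases E ends \<and> e \<in> B}"
    unfolding cycle_matroid_bases_maximal
    using forest_parallel [OF fl ef] by (intro maximal_sets_parallel ef) auto
  also have "{insert f (B - {e}) | B. B \<in> cycle_matroid_bases E ends \<and> e \<in> B} = insert f ` P"
  proof (intro equalityI subsetI)
    fix X assume "X \<in> {insert f (B - {e}) | B. B \<in> cycle_matroid_bases E ends \<and> e \<in> B}"
    then obtain B where B: "X = insert f (B - {e})" "B \<in> insert e ` P \<union> R" "e \<in> B"
      unfolding cm eP by blast
    then obtain Q where "Q \<in> P" "B = insert e Q" using PR by blast
    then show "X \<in> insert f ` P" using B PR by auto
  next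
    fix X assume "X \<in> insert f ` P"
    then obtain Q where Q: "Q \<in> P" "X = insert f Q" by blast
    then have "insert e Q - {e} = Q" using PR by auto
    then show "X \<in> {insert f (B - {e}) | B. B \<in> cycle_matroid_bases E ends \<and> e \<in> B}"
      unfolding cm eP using Q by (intro CollectI exI [of _ "insert e Q"]) auto
  qed
  finally show ?thesis unfolding cm eP by blast
qed

text \<open>With x and y for the edges \<open>e\<close> and \<open>f\<close>, the basis polynomial x
  P + R becomes x y P + (x + y) R: either both halves are taken in place of the old edge, or exactly
  one half is added.\<close>

lemma cycle_matroid_bases_series:
  assumes sp: "series_parallel_graph E ends" and ef: "e \<in> E" "f \<notin> E"
    and uv: "ends e = {u, v}" and w: "w \<notin> \<Union>(ends ` E)"
    and cm: "cycle_matroid_bases E ends = {{e}} \<otimes> P \<union> R" and PR: "P \<subseteq> Pow (E - {e})" "R \<subseteq> Pow (E - {e})"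
  shows "cycle_matroid_bases (insert f E) (ends(e := {u, w}, f := {w, v})) =
    {{e}} \<otimes> ({{f}} \<otimes> P \<union> R) \<union> {{f}} \<otimes> R"
proof -
  have fl: "finite E" "loopless ends E" using series_parallel_graph_loopless [OF sp] by auto
  have "{{e}} \<otimes> P \<subseteq> Pow (- {f})" "R \<subseteq> Pow (- {f})"
    using dprod_subset_Pow [of "{{e}}" "{e}" P "E - {e}"] PR ef by auto
  then have sub: "{{e}} \<otimes> P \<union> R \<subseteq> Pow (- {f})" by blast
  have "cycle_matroid_bases (insert f E) (ends(e := {u, w}, f := {w, v})) =
      insert f ` cycle_matroid_bases E ends \<union> {insert e B | B. B \<in> cycle_matroid_bases E ends \<and> e \<notin> B}"
    unfolding cycle_matroid_bases_maximal
    using forest_series [OF fl ef uv w] by (intro maximal_sets_series ef) auto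
  also have "{insert e B | B. B \<in> cycle_matroid_bases E ends \<and> e \<notin> B} = insert e ` R"
    unfolding cm using PR by (auto elim!: dprodE)
  also have "insert e ` R = {{e}} \<otimes> R"
    using PR by (intro dprod_singleton_left [symmetric]) auto
  also have "insert f ` cycle_matroid_bases E ends = {{f}} \<otimes> ({{e}} \<otimes> P \<union> R)"
    unfolding cm by (rule dprod_singleton_left [OF sub, symmetric])
  finally show ?thesis by (simp only: dprod_Un dprod_ac Un_ac)
qed

text \<open>The edge that the network is going to replace. Since it carries a label of the network
  itself, repeated substitution requires no relabelling.\<close>

primrec first_edge :: "'a net \<Rightarrow> 'a" where
  "first_edge (Edge e) = e"
| "first_edge (Par a b) = first_edge a"
| "first_edge (Ser a b) = first_edge a"

lemma first_edge_in: "first_edge a \<in> edges a"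
  by (induction a) auto

lemma first_edge_mem:
  assumes "(edges a \<union> edges b) \<inter> E = {first_edge a}" "edges a \<inter> edges b = {}"
  shows "first_edge a \<in> E" "first_edge b \<notin> E"
proof -
  show "first_edge a \<in> E" using assms(1) by blast
  show "first_edge b \<notin> E"
  proof
    assume "first_edge b \<in> E"
    then have "first_edge b \<in> (edges a \<union> edges b) \<inter> E" using first_edge_in [of b] by simp
    then have "first_edge b = first_edge a" unfolding assms(1) by simp
    then show False using first_edge_in [of a] first_edge_in [of b] assms(2) by auto
  qed
qed

text \<open>Substituting a network for an edge of a series-parallel graph: if the bases are
  \<open>x P + R\<close> with \<open>x\<close> the edge, they become \<open>T P + F R\<close> with \<open>T\<close>, \<open>F\<close> the trees and cuts
  of the network.\<close>

definition substitutable :: "'a net \<Rightarrow> bool" where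
  "substitutable a \<longleftrightarrow> (\<forall>E P R (ends :: 'a \<Rightarrow> nat set). series_parallel_graph E ends \<longrightarrow>
     edges a \<inter> E = {first_edge a} \<longrightarrow>
     cycle_matroid_bases E ends = {{first_edge a}} \<otimes> P \<union> R \<longrightarrow>
     P \<subseteq> Pow (E - {first_edge a}) \<longrightarrow> R \<subseteq> Pow (E - {first_edge a}) \<longrightarrow>
     (\<exists>ends' :: 'a \<Rightarrow> nat set. series_parallel_graph (E \<union> edges a) ends' \<and>
        cycle_matroid_bases (E \<union> edges a) ends' = trees a \<otimes> P \<union> cuts a \<otimes> R))"

lemma substitutableD:
  fixes ends :: "'a \<Rightarrow> nat set"
  assumes "substitutable a" "series_parallel_graph E ends" "edges a \<inter> E = {first_edge a}"
    "cycle_matroid_bases E ends = {{first_edge a}} \<otimes> P \<union> R"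
    "P \<subseteq> Pow (E - {first_edge a})" "R \<subseteq> Pow (E - {first_edge a})"
  shows "\<exists>ends' :: 'a \<Rightarrow> nat set. series_parallel_graph (E \<union> edges a) ends' \<and>
    cycle_matroid_bases (E \<union> edges a) ends' = trees a \<otimes> P \<union> cuts a \<otimes> R"
  using assms(1) [unfolded substitutable_def, rule_format, OF assms(2-6)] .

text \<open>The basis polynomial is of degree one in each of the two edge variables, with
  coefficients \<open>A\<close>, \<open>B\<close>, \<open>C\<close>, \<open>D\<close>. Substituting
  \<open>a\<close> for one edge leaves it of degree one in the other, so that \<open>b\<close> can
  be substituted next.\<close>

lemma substitute_two:
  fixes ends :: "'a \<Rightarrow> nat set"
  assumes ab: "substitutable a" "substitutable b" "edges a \<inter> edges b = {}"
    and sp: "series_parallel_graph (insert (first_edge b) E) ends" and int: "(edges a \<union> edges b) \<inter> E = {first_edge a}"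
    and cm: "cycle_matroid_bases (insert (first_edge b) E) ends =
      {{first_edge a}} \<otimes> ({{first_edge b}} \<otimes> A \<union> B) \<union> ({{first_edge b}} \<otimes> C \<union> D)"
    and sub: "A \<subseteq> Pow (E - {first_edge a})" "B \<subseteq> Pow (E - {first_edge a})" "C \<subseteq> Pow (E - {first_edge a})" "D \<subseteq> Pow (E - {first_edge a})"
  shows "\<exists>ends' :: 'a \<Rightarrow> nat set. series_parallel_graph (E \<union> (edges a \<union> edges b)) ends' \<and>
    cycle_matroid_bases (E \<union> (edges a \<union> edges b)) ends' =
      trees a \<otimes> (trees b \<otimes> A \<union> cuts b \<otimes> B) \<union> cuts a \<otimes> (trees b \<otimes> C \<union> cuts b \<otimes> D)"
proof -
  let ?e = "first_edge a" and ?f = "first_edge b"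
  have in_ab: "?e \<in> edges a" "?f \<in> edges b" by (rule first_edge_in)+
  have only: "x = ?e" if "x \<in> E" "x \<in> edges a \<union> edges b" for x using int that by blast
  have ef: "?e \<noteq> ?f" "?f \<notin> edges a" using in_ab ab(3) by auto
  note fE = first_edge_mem [OF int ab(3)]
  let ?E1 = "insert ?f E"
  have "{{?f}} \<otimes> X \<union> Y \<subseteq> Pow (?E1 - {?e})" if "X \<subseteq> Pow (E - {?e})" "Y \<subseteq> Pow (E - {?e})" for X Y
    using dprod_subset_Pow [of "{{?f}}" "{?f}" X "E - {?e}"] that ef by auto
  note sub1 = this [OF sub(1,2)] this [OF sub(3,4)]
  have i1: "edges a \<inter> ?E1 = {?e}" using only in_ab ab(3) ef fE(1) by blast
  obtain ends2 :: "'a \<Rightarrow> nat set" where sp2: "series_parallel_graph (?E1 \<union> edges a) ends2"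
    and cm2: "cycle_matroid_bases (?E1 \<union> edges a) ends2 =
      trees a \<otimes> ({{?f}} \<otimes> A \<union> B) \<union> cuts a \<otimes> ({{?f}} \<otimes> C \<union> D)"
    using substitutableD [OF ab(1) sp i1 cm sub1] by blast
  let ?E2 = "?E1 \<union> edges a"
  have cm2': "cycle_matroid_bases ?E2 ends2 =
      {{?f}} \<otimes> (trees a \<otimes> A \<union> cuts a \<otimes> C) \<union> (trees a \<otimes> B \<union> cuts a \<otimes> D)"
    unfolding cm2 by (simp add: dprod_Un dprod_ac Un_ac)
  have le: "edges a \<union> (E - {?e}) \<subseteq> ?E2 - {?f}" using ef fE by auto
  have sub2: "trees a \<otimes> X \<union> cuts a \<otimes> Y \<subseteq> Pow (?E2 - {?f})"
    if "X \<subseteq> Pow (E - {?e})" "Y \<subseteq> Pow (E - {?e})" for X Y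
    using dprod_subset_Pow [OF trees_subset that(1)] dprod_subset_Pow [OF cuts_subset that(2)] le by blast
  have i2: "edges b \<inter> ?E2 = {?f}" using only in_ab ab(3) by blast
  obtain ends3 :: "'a \<Rightarrow> nat set" where sp3: "series_parallel_graph (?E2 \<union> edges b) ends3"
    and cm3: "cycle_matroid_bases (?E2 \<union> edges b) ends3 =
      trees b \<otimes> (trees a \<otimes> A \<union> cuts a \<otimes> C) \<union> cuts b \<otimes> (trees a \<otimes> B \<union> cuts a \<otimes> D)"
    using substitutableD [OF ab(2) sp2 i2 cm2'
        sub2 [OF sub(1,3)] sub2 [OF sub(2,4)]] by blast
  have "?E2 \<union> edges b = E \<union> (edges a \<union> edges b)" using in_ab by auto
  moreover have "trees b \<otimes> (trees a \<otimes> A \<union> cuts a \<otimes> C) \<union> cuts b \<otimes> (trees a \<otimes> B \<union> cuts a \<otimes> D) =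
      trees a \<otimes> (trees b \<otimes> A \<union> cuts b \<otimes> B) \<union> cuts a \<otimes> (trees b \<otimes> C \<union> cuts b \<otimes> D)"
    by (simp add: dprod_Un dprod_ac Un_ac)
  ultimately show ?thesis using sp3 cm3 by (intro exI [of _ ends3]) simp
qed

text \<open>A parallel node doubles the edge and a series node subdivides it; each half is replaced
  by a child. The coefficients in \<open>substitute_two\<close> are \<open>{}\<close>,
  \<open>P\<close>, \<open>P\<close>, \<open>R\<close> for a parallel node and \<open>P\<close>,
  \<open>R\<close>, \<open>R\<close>, \<open>{}\<close> for a series node.\<close>

lemma net_substitutable: "wf_net a \<Longrightarrow> substitutable a"
proof (induction a)
  case (Edge x)
  show ?case
    unfolding substitutable_def
  proof (intro allI impI)
    fix E P R and ends :: "'a \<Rightarrow> nat set"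
    assume sp: "series_parallel_graph E ends" and "edges (Edge x) \<inter> E = {first_edge (Edge x)}"
      and cm: "cycle_matroid_bases E ends = {{first_edge (Edge x)}} \<otimes> P \<union> R"
    then have "E \<union> edges (Edge x) = E" by auto
    then show "\<exists>ends' :: 'a \<Rightarrow> nat set. series_parallel_graph (E \<union> edges (Edge x)) ends' \<and>
        cycle_matroid_bases (E \<union> edges (Edge x)) ends' = trees (Edge x) \<otimes> P \<union> cuts (Edge x) \<otimes> R"
      using sp cm by (intro exI [of _ ends]) simp
  qed
next
  case (Par a b)
  then have ab: "substitutable a" "substitutable b" "edges a \<inter> edges b = {}" by auto
  show ?case
    unfolding substitutable_def edges.simps first_edge.simps
  proof (intro allI impI)
    fix E P R and ends :: "'a \<Rightarrow> nat set"
    let ?e = "first_edge a" and ?f = "first_edge b"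
    assume sp: "series_parallel_graph E ends" and int: "(edges a \<union> edges b) \<inter> E = {?e}"
      and cm: "cycle_matroid_bases E ends = {{?e}} \<otimes> P \<union> R" and PR: "P \<subseteq> Pow (E - {?e})" "R \<subseteq> Pow (E - {?e})"
    note eE = first_edge_mem(1) [OF int ab(3)] and fE = first_edge_mem(2) [OF int ab(3)]
    have "cycle_matroid_bases (insert ?f E) (ends(?f := ends ?e)) =
        {{?e}} \<otimes> ({{?f}} \<otimes> {} \<union> P) \<union> ({{?f}} \<otimes> P \<union> R)"
      unfolding cycle_matroid_bases_parallel [OF sp eE fE cm PR] by simp
    from substitute_two [OF ab series_parallel_graph.parallel_extension [OF sp eE fE] int this _ PR(1,1,2)]
    show "\<exists>ends' :: 'a \<Rightarrow> nat set. series_parallel_graph (E \<union> (edges a \<union> edges b)) ends' \<and>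
        cycle_matroid_bases (E \<union> (edges a \<union> edges b)) ends' = trees (Par a b) \<otimes> P \<union> cuts (Par a b) \<otimes> R"
      by (simp add: dprod_Un dprod_ac Un_ac)
  qed
next
  case (Ser a b)
  then have ab: "substitutable a" "substitutable b" "edges a \<inter> edges b = {}" by auto
  show ?case
    unfolding substitutable_def edges.simps first_edge.simps
  proof (intro allI impI)
    fix E P R and ends :: "'a \<Rightarrow> nat set"
    let ?e = "first_edge a" and ?f = "first_edge b"
    assume sp: "series_parallel_graph E ends" and int: "(edges a \<union> edges b) \<inter> E = {?e}"
      and cm: "cycle_matroid_bases E ends = {{?e}} \<otimes> P \<union> R" and PR: "P \<subseteq> Pow (E - {?e})" "R \<subseteq> Pow (E - {?e})"
    note eE = first_edge_mem(1) [OF int ab(3)] and fE = first_edge_mem(2) [OF int ab(3)]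
    have fl: "finite E" "loopless ends E" using series_parallel_graph_loopless [OF sp] by auto
    obtain u v where uv: "ends ?e = {u, v}" using fl(2) eE unfolding loopless_def by blast
    have "finite (\<Union>(ends ` E))" using fl by (auto simp: loopless_def)
    then obtain w where w: "w \<notin> \<Union>(ends ` E)" using ex_new_if_finite [OF infinite_UNIV_nat] by blast
    have "cycle_matroid_bases (insert ?f E) (ends(?e := {u, w}, ?f := {w, v})) =
        {{?e}} \<otimes> ({{?f}} \<otimes> P \<union> R) \<union> ({{?f}} \<otimes> R \<union> {})"
      unfolding cycle_matroid_bases_series [OF sp eE fE uv w cm PR] by simp
    from substitute_two [OF ab series_parallel_graph.series_extension [OF sp eE fE uv w] int this PR(1,2,2)]
    show "\<exists>ends' :: 'a \<Rightarrow> nat set. series_parallel_graph (E \<union> (edges a \<union> edges b)) ends' \<and>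
        cycle_matroid_bases (E \<union> (edges a \<union> edges b)) ends' = trees (Ser a b) \<otimes> P \<union> cuts (Ser a b) \<otimes> R"
      by (simp add: dprod_Un dprod_ac Un_ac)
  qed
qed

text \<open>The network is substituted for the edge of a one-edge graph, whose basis polynomial is
  the edge variable: \<open>P\<close> is the unit and \<open>R\<close> is empty, so exactly the
  trees remain.\<close>

lemma trees_series_parallel_matroid:
  fixes a :: "'n::finite net"
  assumes "wf_net a" "edges a = UNIV"
  shows "series_parallel_matroid (trees a)"
proof -
  let ?e = "first_edge a"
  define ends0 :: "'n \<Rightarrow> nat set" where "ends0 = (\<lambda>_. {0, 1})"
  have sp: "series_parallel_graph {?e} ends0"
    by (rule series_parallel_graph.single_edge [of 0 1]) (auto simp: ends0_def)
  have "forest ends0 {?e}"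
  proof -
    have "\<not> even_subgraph ends0 {?e}"
    proof
      assume "even_subgraph ends0 {?e}"
      then have "even (degree_in ends0 {?e} 0)" unfolding even_subgraph_def by blast
      moreover have "{e \<in> {?e}. 0 \<in> ends0 e} = {?e}" by (auto simp: ends0_def)
      ultimately show False by (simp add: degree_in_def)
    qed
    then show ?thesis
      using forest_iff_even [of "{?e}" ends0] series_parallel_graph_loopless [OF sp]
      by (auto simp: subset_singleton_iff)
  qed
  then have "cycle_matroid_bases {?e} ends0 = {{?e}}"
    unfolding cycle_matroid_bases_def by (auto simp: subset_singleton_iff)
  then have "\<exists>ends' :: 'n \<Rightarrow> nat set. series_parallel_graph ({?e} \<union> edges a) ends' \<and>
      cycle_matroid_bases ({?e} \<union> edges a) ends' = trees a \<otimes> {{}} \<union> cuts a \<otimes> {}"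
    using first_edge_in [of a] by (intro substitutableD [OF net_substitutable [OF assms(1)] sp]) auto
  then show ?thesis
    unfolding series_parallel_matroid_def using assms(2) by auto
qed

subsection \<open>Constructible spaces\<close>

lemma exists_other_element:
  fixes e :: "'n::finite"
  assumes "2 \<le> CARD('n)"
  obtains f where "f \<noteq> e"
proof (rule ccontr)
  assume "\<not> thesis"
  then have "(UNIV :: 'n set) = {e}" using that by blast
  then have "CARD('n) = 1" by (metis is_singletonI is_singleton_altdef)
  then show False using assms by simp
qed

lemma sum_complement:
  fixes u :: "'n::finite \<Rightarrow> real"
  shows "sum u (- I) = sum u UNIV - sum u I"
  by (simp add: Compl_eq_Diff_UNIV sum_diff)

lemma weight_constant_complement:
  fixes u :: "'n::finite \<Rightarrow> real"
  shows "weight_constant u (uminus ` M) \<longleftrightarrow> weight_constant u M"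
  unfolding weight_constant_def ball_simps sum_complement by simp

lemma connected_family_complement:
  fixes M :: "'n::finite set set"
  shows "connected_family (uminus ` M) \<longleftrightarrow> connected_family M"
  unfolding connected_family_def weight_constant_complement ..

lemma argmax_weight_complement:
  fixes u :: "'n::finite \<Rightarrow> real"
  shows "uminus ` argmax_weight u A = argmax_weight (\<lambda>i. - u i) (uminus ` A)"
  unfolding argmax_weight_def by (auto simp: sum_negf sum_complement)

lemma block_complement:
  fixes x :: "'n::finite net"
  assumes "block x" "edges x = UNIV"
  obtains y where "block y" "edges y = UNIV" "trees y = uminus ` trees x"
proof -
  obtain a b where x: "x = Par a b" "wf_net (Par a b)" using assms(1) by (auto simp: block_def)
  have "edges a \<union> edges b = UNIV" using assms(2) x by simp
  then have "trees (Par (dual_net a) (dual_net b)) = uminus ` trees x"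
    using trees_Par_complement [OF x(2)] x(1) by (simp add: Compl_eq_Diff_UNIV [abs_def])
  then show thesis
    using that [of "Par (dual_net a) (dual_net b)"] x assms(2) by (auto simp: block_def)
qed

lemma dprod_F_nonempty:
  assumes "finite K" "\<And>a. a \<in> K \<Longrightarrow> wf_net a"
    and "\<And>a b. a \<in> K \<Longrightarrow> b \<in> K \<Longrightarrow> a \<noteq> b \<Longrightarrow> edges a \<inter> edges b = {}"
  shows "dprod.F trees K \<noteq> {}"
  using assms
proof (induction K rule: finite_induct)
  case (insert a K)
  have "edges a \<inter> edges b = {}" if "b \<in> K" for b using insert.prems(2) [of a b] insert.hyps(2) that by auto
  then have "edges a \<inter> \<Union>(edges ` K) = {}" by blast
  then have "trees a \<otimes> dprod.F trees K \<noteq> {}"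
    using insert trees_cuts_nonempty [of a]
    by (intro dprod_nonempty [OF trees_subset dprod_F_subset_Pow]) (auto simp: trees_subset)
  then show ?case using insert.hyps by simp
qed simp

lemma dprod_F_split:
  assumes "finite K" "a \<in> K" "\<And>a. a \<in> K \<Longrightarrow> wf_net a"
    and dis: "\<And>a b. a \<in> K \<Longrightarrow> b \<in> K \<Longrightarrow> a \<noteq> b \<Longrightarrow> edges a \<inter> edges b = {}"
  obtains N where "dprod.F trees K = trees a \<otimes> N" "N \<subseteq> Pow (- edges a)" "N \<noteq> {}"
proof -
  let ?N = "dprod.F trees (K - {a})"
  have "dprod.F trees K = trees a \<otimes> ?N" using assms(1,2) by (rule dprod.remove)
  moreover have "edges b \<subseteq> - edges a" if "b \<in> K - {a}" for b using dis [of a b] assms(2) that by auto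
  then have "?N \<subseteq> Pow (- edges a)"
    using dprod_F_subset_Pow [of "K - {a}" trees edges] assms(1) trees_subset by blast
  moreover have "?N \<noteq> {}" using assms by (intro dprod_F_nonempty) auto
  ultimately show thesis by (rule that)
qed

text \<open>The indicator of the edges of one summand has constant weight, namely the rank of the
  summand. Connectedness makes this indicator constant, so the summand covers everything. The empty
  sum is excluded by having two elements.\<close>

lemma connected_sum_single_block:
  fixes K :: "'n::finite net set"
  assumes K: "finite K" "\<And>a. a \<in> K \<Longrightarrow> block a"
    and dis: "\<And>a b. a \<in> K \<Longrightarrow> b \<in> K \<Longrightarrow> a \<noteq> b \<Longrightarrow> edges a \<inter> edges b = {}"
    and con: "connected_family (dprod.F trees K)" and n: "2 \<le> CARD('n)"
  shows "\<exists>a. block a \<and> edges a = UNIV \<and> dprod.F trees K = trees a"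
proof -
  obtain e f :: 'n where ef: "e \<noteq> f" using exists_other_element [OF n] by metis
  have "K \<noteq> {}"
  proof
    assume "K = {}"
    then have "weight_constant (\<lambda>x. of_bool (x = e)) (dprod.F trees K)" by (simp add: weight_constant_def)
    from connected_familyD [OF con this, of e f] show False using ef by simp
  qed
  then obtain a where a: "a \<in> K" by blast
  have wf: "wf_net b" if "b \<in> K" for b using K(2) [OF that] by (simp add: block_def)
  obtain N where N: "dprod.F trees K = trees a \<otimes> N" "N \<subseteq> Pow (- edges a)" "N \<noteq> {}"
    by (rule dprod_F_split [OF K(1) a wf dis])
  obtain r where r: "\<And>B. B \<in> trees a \<Longrightarrow> card B = Suc r" using trees_cuts_card [OF wf [OF a]] by blast
  let ?u = "\<lambda>x. of_bool (x \<in> edges a) :: real"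
  have "sum ?u I = real (Suc r)" if IN: "I \<in> trees a \<otimes> N" for I
  proof -
    obtain A B where AB: "I = A \<union> B" "A \<in> trees a" "B \<in> N" using IN by (rule dprodE)
    have AA: "A \<subseteq> edges a" "B \<inter> edges a = {}" using AB N(2) trees_subset [of a] by blast+
    then have "I \<inter> edges a = A" using AB by blast
    moreover have "sum ?u I = card (I \<inter> edges a)" by (simp add: of_bool_def sum.If_cases)
    ultimately show ?thesis using r [OF AB(2)] by simp
  qed
  then have "weight_constant ?u (dprod.F trees K)" unfolding N(1) weight_constant_def by simp
  then have const: "?u x = ?u y" for x y using connected_familyD [OF con] by blast
  obtain x0 where "x0 \<in> edges a" using edges_nonempty [of a] by blast
  then have "x \<in> edges a" for x using const [of x x0] by (simp split: if_splits)
  then have Ua: "edges a = UNIV" by blast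
  have "K = {a}"
  proof (rule ccontr)
    assume "K \<noteq> {a}"
    then obtain b where "b \<in> K" "b \<noteq> a" using a by blast
    then show False using dis [of a b] a Ua edges_nonempty [of b] by auto
  qed
  then show ?thesis using K(2) [OF a] Ua by (intro exI [of _ a]) simp
qed

text \<open>Only connected cells are constrained. For 0 < d < n every other cell is a face of one of
  these and is handled by \<open>sp_valuation_face\<close>.\<close>

definition sp_valuation :: "nat \<Rightarrow> ('n::finite set \<Rightarrow> real) \<Rightarrow> bool" where
  "sp_valuation d p \<longleftrightarrow> (\<forall>w. connected_family (minimizers d p w) \<longrightarrow>
     (\<exists>x. block x \<and> edges x = UNIV \<and> minimizers d p w = trees x))"

lemma sp_valuation_cong: "(\<And>w. minimizers d p w = minimizers d p' w) \<Longrightarrow> sp_valuation d p = sp_valuation d p'"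
  by (simp add: sp_valuation_def)

lemma minimizers_full:
  fixes p :: "'n::finite set \<Rightarrow> real"
  shows "minimizers CARD('n) p w = {UNIV}"
proof -
  have "card I = CARD('n) \<longleftrightarrow> I = UNIV" for I :: "'n set" by (metis card_subset_eq finite subset_UNIV)
  then show ?thesis by (auto simp: minimizers_iff)
qed

lemma sp_valuation_face:
  fixes p :: "'n::finite set \<Rightarrow> real"
  assumes "0 < d" "d \<le> CARD('n)" "d < CARD('n) \<Longrightarrow> sp_valuation d p"
  shows "sp_sum UNIV (uminus ` minimizers d p w)"
proof (cases "d = CARD('n)")
  case True
  then show ?thesis using sp_sum_unit by (simp add: minimizers_full)
next
  case False
  then have d: "d < CARD('n)" using assms(2) by simp
  obtain w' where w': "connected_family (minimizers d p w')"
    "minimizers d p w = argmax_weight (\<lambda>i. w $ i - w' $ i) (minimizers d p w')"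
    by (rule minimizers_face_of_connected [OF assms(1) d])
  obtain x where x: "block x" "edges x = UNIV" "minimizers d p w' = trees x"
    using assms(3) [OF d] w'(1) unfolding sp_valuation_def by blast
  obtain y where y: "block y" "edges y = UNIV" "trees y = uminus ` trees x"
    by (rule block_complement [OF x(1,2)])
  have "uminus ` minimizers d p w = argmax_weight (\<lambda>i. - (w $ i - w' $ i)) (trees y)"
    unfolding w'(2) x(3) y(3) by (rule argmax_weight_complement)
  then show ?thesis using sp_sum_face [of y] y by (simp add: block_def)
qed

lemma parallel_net:
  assumes "finite S" "S \<noteq> {}"
  shows "\<exists>a. wf_net a \<and> edges a = S \<and> trees a = (\<lambda>x. {x}) ` S \<and> cuts a = {{}}"
  using assms
proof (induction S rule: finite_ne_induct)
  case (singleton x)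
  then show ?case by (intro exI [of _ "Edge x"]) auto
next
  case (insert x S)
  then obtain a where "wf_net a" "edges a = S" "trees a = (\<lambda>x. {x}) ` S" "cuts a = {{}}" by blast
  then show ?case using insert by (intro exI [of _ "Par (Edge x) a"]) auto
qed

lemma series_net:
  assumes "finite S" "S \<noteq> {}"
  shows "\<exists>a. wf_net a \<and> edges a = S \<and> trees a = {S}"
  using assms
proof (induction S rule: finite_ne_induct)
  case (singleton x)
  then show ?case by (intro exI [of _ "Edge x"]) auto
next
  case (insert x S)
  then obtain a where "wf_net a" "edges a = S" "trees a = {S}" by blast
  then show ?case using insert by (intro exI [of _ "Ser (Edge x) a"]) (auto simp: dprod_def)
qed

text \<open>If the complement of \<open>j\<close> were missing from a connected cell, every member
  would contain \<open>j\<close>, and the indicator of \<open>j\<close> would be a nonconstant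
  weight that is constant on the cell. So all complements of points occur, and the dual is one
  parallel class.\<close>

lemma sp_valuation_hyperplane:
  fixes p :: "'n::finite set \<Rightarrow> real"
  assumes "2 \<le> CARD('n)"
  shows "sp_valuation (CARD('n) - 1) p"
  unfolding sp_valuation_def
proof (intro allI impI)
  fix w
  let ?M = "minimizers (CARD('n) - 1) p w"
  assume con: "connected_family ?M"
  have two: "\<exists>k. k \<noteq> j" for j :: 'n using exists_other_element [OF assms] by metis
  have single: "\<exists>i. I = - {i}" if "I \<in> ?M" for I
  proof -
    have "card (- I) = 1" using minimizersD(1) [OF that] assms by (simp add: card_complement)
    then obtain i where "- I = {i}" by (rule card_1_singletonE)
    then show ?thesis by (metis double_complement)
  qed
  have all: "- {j} \<in> ?M" for j
  proof (rule ccontr)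
    assume j: "- {j} \<notin> ?M"
    let ?u = "\<lambda>x. of_bool (x = j) :: real"
    have "sum ?u I = 1" if I: "I \<in> ?M" for I
    proof -
      obtain i where "I = - {i}" using single [OF I] by blast
      then have "j \<in> I" using j I by auto
      then show ?thesis by (simp add: of_bool_def)
    qed
    then have "weight_constant ?u ?M" by (simp add: weight_constant_def)
    moreover obtain k where "k \<noteq> j" using two by blast
    ultimately show False using connected_familyD [OF con, of ?u j k] by simp
  qed
  have M: "?M = uminus ` (\<lambda>x. {x}) ` UNIV"
  proof (intro equalityI subsetI)
    fix I assume "I \<in> ?M"
    then show "I \<in> uminus ` (\<lambda>x. {x}) ` UNIV" using single [of I] by blast
  next
    fix I :: "'n set" assume "I \<in> uminus ` (\<lambda>x. {x}) ` UNIV"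
    then obtain i where "I = - {i}" by blast
    then show "I \<in> ?M" using all [of i] by simp
  qed
  \<comment> \<open>An arbitrary element, split off so that the parallel class has a top node and
    thus is a block.\<close>
  define e :: 'n where "e = undefined"
  have "UNIV - {e} \<noteq> {}" using two [of e] by blast
  then obtain a where a: "wf_net a" "edges a = UNIV - {e}" "trees a = (\<lambda>x. {x}) ` (UNIV - {e})" "cuts a = {{}}"
    using parallel_net [of "UNIV - {e}"] by auto
  have "block (Par (Edge e) a)" "edges (Par (Edge e) a) = UNIV" using a by (auto simp: block_def)
  then obtain y where "block y" "edges y = UNIV" "trees y = uminus ` trees (Par (Edge e) a)"
    by (rule block_complement)
  moreover have "trees (Par (Edge e) a) = (\<lambda>x. {x}) ` UNIV" using a by auto
  ultimately show "\<exists>x. block x \<and> edges x = UNIV \<and> ?M = trees x" using M by metis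
qed

lemma sp_valuation_dual:
  fixes p :: "'n::finite set \<Rightarrow> real"
  assumes "d \<le> CARD('n)" "sp_valuation d p"
  shows "sp_valuation (CARD('n) - d) (dual_plucker p)"
  unfolding sp_valuation_def minimizers_dual [OF assms(1)] connected_family_complement
proof (intro allI impI)
  fix w assume "connected_family (minimizers d p (- w))"
  then obtain x where x: "block x" "edges x = UNIV" "minimizers d p (- w) = trees x"
    using assms(2) unfolding sp_valuation_def by blast
  show "\<exists>y. block y \<and> edges y = UNIV \<and> uminus ` minimizers d p (- w) = trees y"
    using block_complement [OF x(1,2)] x(3) by metis
qed

section \<open>Transverse cells have independent blocks\<close>

lemma zero_sum_constant:
  fixes v w :: "'n::finite \<Rightarrow> real"
  assumes "zero_sum E w" "\<And>x y. x \<in> E \<Longrightarrow> y \<in> E \<Longrightarrow> v x = v y"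
  shows "(\<Sum>x\<in>UNIV. w x * v x) = 0"
proof -
  have "(\<Sum>x\<in>UNIV. w x * v x) = (\<Sum>x\<in>E. w x * v x)"
    using assms(1) by (intro sum.mono_neutral_right) (auto simp: zero_sum_def)
  also have "\<dots> = 0"
  proof (cases "E = {}")
    case False
    then obtain y where y: "y \<in> E" by blast
    have "w x * v x = w x * v y" if "x \<in> E" for x using assms(2) [OF that y] by simp
    then have "(\<Sum>x\<in>E. w x * v x) = (\<Sum>x\<in>E. w x * v y)" by (rule sum.cong [OF refl])
    also have "\<dots> = sum w E * v y" by (simp add: sum_distrib_right)
    finally show ?thesis using assms(1) by (simp add: zero_sum_def)
  qed simp
  finally show ?thesis .
qed

lemma weight_constant_on_blocks:
  fixes K :: "'n::finite net set"
  assumes "finite K" "\<And>a. a \<in> K \<Longrightarrow> block a"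
    and "\<And>a b. a \<in> K \<Longrightarrow> b \<in> K \<Longrightarrow> a \<noteq> b \<Longrightarrow> edges a \<inter> edges b = {}"
    and "weight_constant v (dprod.F trees K)" "a \<in> K" "x \<in> edges a" "y \<in> edges a"
  shows "v x = v y"
proof -
  have wf: "wf_net b" if "b \<in> K" for b using assms(2) [OF that] by (simp add: block_def)
  obtain N where N: "dprod.F trees K = trees a \<otimes> N" "N \<subseteq> Pow (- edges a)" "N \<noteq> {}"
    by (rule dprod_F_split [OF assms(1,5) wf assms(3)])
  have "trees a \<noteq> {}" using trees_cuts_nonempty [OF wf [OF assms(5)]] by blast
  moreover have "weight_constant v (trees a \<otimes> N)" using assms(4) N(1) by simp
  ultimately have "weight_constant v (trees a)"
    using weight_constant_dprod(1) [OF _ trees_subset N(2) _ _ N(3)] by blast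
  then show ?thesis using block_connected [OF assms(2) [OF assms(5)]] assms(6,7) by blast
qed

text \<open>A vector that is a sum of zero-sum vectors on the blocks of both families is orthogonal to
  both spaces of constant weights, which together span everything.\<close>

lemma independent_blocks_transverse:
  fixes K K' :: "'n::finite net set"
  assumes K: "finite K" "\<And>a. a \<in> K \<Longrightarrow> block a"
      "\<And>a b. a \<in> K \<Longrightarrow> b \<in> K \<Longrightarrow> a \<noteq> b \<Longrightarrow> edges a \<inter> edges b = {}"
    and K': "finite K'" "\<And>a. a \<in> K' \<Longrightarrow> block a"
      "\<And>a b. a \<in> K' \<Longrightarrow> b \<in> K' \<Longrightarrow> a \<noteq> b \<Longrightarrow> edges a \<inter> edges b = {}"
    and tr: "\<And>u :: 'n \<Rightarrow> real. \<exists>v v'. (\<forall>x. u x = v x + v' x) \<and> weight_constant v (dprod.F trees K) \<and>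
      weight_constant v' (dprod.F trees K')"
  shows "independent_blocks (Inl ` K \<union> Inr ` K') (\<lambda>i. edges (case_sum id id i))"
  unfolding independent_blocks_def
proof (intro allI impI)
  fix w :: "'n net + 'n net \<Rightarrow> 'n \<Rightarrow> real"
  assume z: "\<forall>i\<in>Inl ` K \<union> Inr ` K'. zero_sum (edges (case_sum id id i)) (w i)"
    and s: "\<forall>x. (\<Sum>i\<in>Inl ` K \<union> Inr ` K'. w i x) = 0"
  define W where "W x = (\<Sum>a\<in>K. w (Inl a) x)" for x
  define W' where "W' x = (\<Sum>a\<in>K'. w (Inr a) x)" for x
  have z1: "zero_sum (edges a) (w (Inl a))" if "a \<in> K" for a using z that by force
  have z2: "zero_sum (edges a) (w (Inr a))" if "a \<in> K'" for a using z that by force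
  have WW: "W x + W' x = 0" for x
  proof -
    have "(\<Sum>i\<in>Inl ` K \<union> Inr ` K'. w i x) = W x + W' x"
      using K(1) K'(1) by (subst sum.union_disjoint) (auto simp: W_def W'_def sum.reindex)
    then show ?thesis using s by simp
  qed
  have "(\<Sum>x\<in>UNIV. W x * u x) = 0" for u
  proof -
    obtain v v' where v: "\<And>x. u x = v x + v' x" "weight_constant v (dprod.F trees K)"
      "weight_constant v' (dprod.F trees K')" using tr by blast
    have "(\<Sum>x\<in>UNIV. W x * v x) = (\<Sum>a\<in>K. \<Sum>x\<in>UNIV. w (Inl a) x * v x)"
      unfolding W_def sum_distrib_right by (rule sum.swap)
    also have "\<dots> = 0"
      by (intro sum.neutral ballI zero_sum_constant [OF z1]) (auto intro: weight_constant_on_blocks [OF K v(2)])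
    finally have 1: "(\<Sum>x\<in>UNIV. W x * v x) = 0" .
    have "(\<Sum>x\<in>UNIV. W' x * v' x) = (\<Sum>a\<in>K'. \<Sum>x\<in>UNIV. w (Inr a) x * v' x)"
      unfolding W'_def sum_distrib_right by (rule sum.swap)
    also have "\<dots> = 0"
      by (intro sum.neutral ballI zero_sum_constant [OF z2]) (auto intro: weight_constant_on_blocks [OF K' v(3)])
    finally have "(\<Sum>x\<in>UNIV. W' x * v' x) = 0" .
    moreover have "W' x = - W x" for x using WW [of x] by linarith
    ultimately have "(\<Sum>x\<in>UNIV. W x * v' x) = 0" by (simp add: sum_negf)
    then show ?thesis using 1 v(1) by (simp add: algebra_simps sum.distrib)
  qed
  \<comment> \<open>Orthogonality to every vector is used for \<open>W\<close> itself, which yields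
    a vanishing sum of squares.\<close>
  then have "(\<Sum>x\<in>UNIV. W x * W x) = 0" by blast
  then have W0: "W x = 0" for x by (simp add: sum_nonneg_eq_0_iff)
  then have W0': "W' x = 0" for x using WW [of x] by simp
  \<comment> \<open>Blocks within one family are disjoint, so on the edges of \<open>a\<close> the
    sum \<open>W\<close> has only the contribution of \<open>a\<close>.\<close>
  have "w (Inl a) x = 0" if "a \<in> K" for a x
  proof (cases "x \<in> edges a")
    case True
    have "w (Inl b) x = 0" if "b \<in> K - {a}" for b
      using z1 [of b] K(3) [of a b] \<open>a \<in> K\<close> that True by (auto simp: zero_sum_def)
    then have "(\<Sum>b\<in>K - {a}. w (Inl b) x) = 0" by (intro sum.neutral) blast
    then show ?thesis using W0 [of x] sum.remove [OF K(1) that, of "\<lambda>b. w (Inl b) x"] by (simp add: W_def)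
  qed (use z1 [OF that] in \<open>auto simp: zero_sum_def\<close>)
  moreover have "w (Inr a) x = 0" if "a \<in> K'" for a x
  proof (cases "x \<in> edges a")
    case True
    have "w (Inr b) x = 0" if "b \<in> K' - {a}" for b
      using z2 [of b] K'(3) [of a b] \<open>a \<in> K'\<close> that True by (auto simp: zero_sum_def)
    then have "(\<Sum>b\<in>K' - {a}. w (Inr b) x) = 0" by (intro sum.neutral) blast
    then show ?thesis using W0' [of x] sum.remove [OF K'(1) that, of "\<lambda>b. w (Inr b) x"] by (simp add: W'_def)
  qed (use z2 [OF that] in \<open>auto simp: zero_sum_def\<close>)
  ultimately show "\<forall>i\<in>Inl ` K \<union> Inr ` K'. \<forall>x. w i x = 0" by blast
qed

text \<open>A single-edge summand on the side of the complements is an element of every complement,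
  that is, a loop of \<open>M\<close>. Elements outside all summands are coloops of \<open>M\<close>
  and cause no trouble.\<close>

lemma loopless_sp_sum_blocks:
  fixes M :: "'n::finite set set"
  assumes "sp_sum UNIV (uminus ` M)" and ll: "\<And>e. \<exists>I\<in>M. e \<in> I"
  obtains K where "finite K" "\<And>a. a \<in> K \<Longrightarrow> block a"
    "\<And>a b. a \<in> K \<Longrightarrow> b \<in> K \<Longrightarrow> a \<noteq> b \<Longrightarrow> edges a \<inter> edges b = {}"
    "uminus ` M = dprod.F trees K"
proof -
  obtain K where K: "finite K" "\<forall>a\<in>K. block a \<or> (\<exists>e. a = Edge e)"
    "\<forall>a\<in>K. \<forall>b\<in>K. a \<noteq> b \<longrightarrow> edges a \<inter> edges b = {}" "uminus ` M = dprod.F trees K"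
    using assms(1) unfolding sp_sum_def by (elim exE conjE)
  have "Edge e \<notin> K" for e
  proof
    assume "Edge e \<in> K"
    then have "uminus ` M = {{e}} \<otimes> dprod.F trees (K - {Edge e})"
      unfolding K(4) using K(1) by (subst dprod.remove [of K "Edge e"]) auto
    then have all: "e \<in> B" if "B \<in> uminus ` M" for B using that by (auto elim!: dprodE)
    obtain I where "I \<in> M" "e \<in> I" using ll by blast
    then show False using all [of "- I"] by auto
  qed
  then have "block a" if "a \<in> K" for a using K(2) that by metis
  moreover have "edges a \<inter> edges b = {}" if "a \<in> K" "b \<in> K" "a \<noteq> b" for a b using K(3) that by metis
  ultimately show thesis using that [of K] K(1,4) by blast
qed

lemma sp_valuation_intersection:
  fixes p p' :: "'n::finite set \<Rightarrow> real"
  assumes val: "valuated_matroid d p" "valuated_matroid d' p'"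
    and dims: "d \<le> CARD('n)" "d' \<le> CARD('n)" "CARD('n) \<le> d + d'"
    and tr: "meet_transversely d p d' p'"
    and sp: "\<And>w. sp_sum UNIV (uminus ` minimizers d p w)" "\<And>w. sp_sum UNIV (uminus ` minimizers d' p' w)"
    and n: "2 \<le> CARD('n)"
  shows "sp_valuation (d + d' - CARD('n)) (stable_intersection d p d' p')"
  unfolding sp_valuation_def
proof (intro allI impI)
  fix w
  let ?M = "minimizers d p w" and ?M' = "minimizers d' p' w"
    and ?N = "minimizers (d + d' - CARD('n)) (stable_intersection d p d' p') w"
  assume con: "connected_family ?N"
  \<comment> \<open>An element in no member of the cell would have an indicator of constant weight
    0. Loops of a factor are loops of the intersection, so the cells of both factors at
    \<open>w\<close> are loopless as well.\<close>
  have llN: "\<exists>J\<in>?N. e \<in> J" for e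
  proof (rule ccontr)
    assume no: "\<not> ?thesis"
    let ?u = "\<lambda>x. of_bool (x = e) :: real"
    have "sum ?u J = 0" if "J \<in> ?N" for J using no that by (intro sum.neutral) auto
    then have "weight_constant ?u ?N" by (simp add: weight_constant_def)
    moreover obtain f where "f \<noteq> e" by (rule exists_other_element [OF n])
    ultimately show False using connected_familyD [OF con, of ?u e f] by simp
  qed
  have ll: "\<exists>I\<in>?M. e \<in> I" for e
    using llN [of e] loop_stable_intersection [OF dims val(1), of w e] by blast
  have dims': "CARD('n) \<le> d' + d" using dims(3) by simp
  have N': "?N = minimizers (d' + d - CARD('n)) (stable_intersection d' p' d p) w"
    by (simp add: stable_intersection_commute [of d p] add.commute)
  have ll': "\<exists>I\<in>?M'. e \<in> I" for e
    using llN [of e] loop_stable_intersection [OF dims(2,1) dims' val(2), of w e] unfolding N' by blast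
  obtain K where K: "finite K" "\<And>a. a \<in> K \<Longrightarrow> block a"
      "\<And>a b. a \<in> K \<Longrightarrow> b \<in> K \<Longrightarrow> a \<noteq> b \<Longrightarrow> edges a \<inter> edges b = {}" and MK: "uminus ` ?M = dprod.F trees K"
    by (rule loopless_sp_sum_blocks [OF sp(1) [of w] ll]) (rule that)
  obtain K' where K': "finite K'" "\<And>a. a \<in> K' \<Longrightarrow> block a"
      "\<And>a b. a \<in> K' \<Longrightarrow> b \<in> K' \<Longrightarrow> a \<noteq> b \<Longrightarrow> edges a \<inter> edges b = {}" and MK': "uminus ` ?M' = dprod.F trees K'"
    by (rule loopless_sp_sum_blocks [OF sp(2) [of w] ll']) (rule that)
  have "\<exists>v v'. (\<forall>x. u x = v x + v' x) \<and> weight_constant v (dprod.F trees K) \<and> weight_constant v' (dprod.F trees K')" for u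
  proof -
    obtain v v' where v: "(\<chi> i. u i) = v + v'" "weight_constant (($) v) ?M" "weight_constant (($) v') ?M'"
      by (rule transverse_constant_spaces [OF val dims(1,2) tr ll ll'])
    have "u x = v $ x + v' $ x" for x using arg_cong [OF v(1), of "\<lambda>z. z $ x"] by simp
    moreover have "weight_constant (($) v) (dprod.F trees K)" "weight_constant (($) v') (dprod.F trees K')"
      using v(2,3) unfolding MK [symmetric] MK' [symmetric] weight_constant_complement .
    ultimately show ?thesis by blast
  qed
  then have "independent_blocks (Inl ` K \<union> Inr ` K') (\<lambda>i. edges (case_sum id id i))"
    by (intro independent_blocks_transverse K K')
  then have "\<exists>L. finite L \<and> (\<forall>x\<in>L. block x) \<and> (\<forall>x\<in>L. \<forall>y\<in>L. x \<noteq> y \<longrightarrow> edges x \<inter> edges y = {}) \<and>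
      dprod.F trees L = dprod.F (\<lambda>i. trees (case_sum id id i)) (Inl ` K \<union> Inr ` K')"
    using K(1,2) K'(1,2) by (intro independent_blocks_dprod) auto
  then obtain L where L: "finite L" "\<And>x. x \<in> L \<Longrightarrow> block x"
      "\<And>x y. x \<in> L \<Longrightarrow> y \<in> L \<Longrightarrow> x \<noteq> y \<Longrightarrow> edges x \<inter> edges y = {}"
    and LF: "dprod.F trees L = dprod.F (\<lambda>i. trees (case_sum id id i)) (Inl ` K \<union> Inr ` K')" by metis
  have "dprod.F (\<lambda>i. trees (case_sum id id i)) (Inl ` K \<union> Inr ` K') = dprod.F trees K \<otimes> dprod.F trees K'"
    using K(1) K'(1) by (subst dprod.union_disjoint) (auto simp: dprod.reindex o_def)
  then have LM: "dprod.F trees L = uminus ` ?M \<otimes> uminus ` ?M'" using LF MK MK' by simp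
  \<comment> \<open>Nonemptiness of the merged product supplies minimizers with disjoint
    complements, that is, the covering pair from which \<open>minimizers_stable_intersection\<close>
    starts. Up to here the cell of the intersection has not been related to those of the factors
    beyond their loops.\<close>
  have "dprod.F trees L \<noteq> {}" using L(2) by (intro dprod_F_nonempty L) (auto simp: block_def)
  then obtain I I' where I: "I \<in> ?M" "I' \<in> ?M'" "(- I) \<inter> (- I') = {}"
    unfolding LM dprod_def by blast
  then have "I \<union> I' = UNIV" by blast
  then have N: "?N = {I \<inter> I' | I I'. I \<in> ?M \<and> I' \<in> ?M' \<and> I \<union> I' = UNIV}"
    using minimizers_stable_intersection [OF dims I(1,2)] by blast
  have "uminus ` ?N = uminus ` ?M \<otimes> uminus ` ?M'"
  proof (intro equalityI subsetI)
    fix X assume "X \<in> uminus ` ?N"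
    then obtain A A' where A: "X = - (A \<inter> A')" "A \<in> ?M" "A' \<in> ?M'" "A \<union> A' = UNIV" unfolding N by blast
    then have "X = (- A) \<union> (- A')" "(- A) \<inter> (- A') = {}" by auto
    then show "X \<in> uminus ` ?M \<otimes> uminus ` ?M'" using dprodI [of "- A" _ "- A'"] A(2,3) by simp
  next
    fix X assume "X \<in> uminus ` ?M \<otimes> uminus ` ?M'"
    then obtain A A' where A: "X = (- A) \<union> (- A')" "A \<in> ?M" "A' \<in> ?M'" "(- A) \<inter> (- A') = {}"
      by (elim dprodE imageE) blast
    then have "X = - (A \<inter> A')" "A \<union> A' = UNIV" by auto
    then show "X \<in> uminus ` ?N" unfolding N using A(2,3) by blast
  qed
  then have NL: "uminus ` ?N = dprod.F trees L" using LM by simp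
  then have "connected_family (dprod.F trees L)" using con connected_family_complement by metis
  then obtain x where x: "block x" "edges x = UNIV" "dprod.F trees L = trees x"
    using connected_sum_single_block [OF L _ n] by blast
  obtain y where y: "block y" "edges y = UNIV" "trees y = uminus ` trees x"
    by (rule block_complement [OF x(1,2)])
  have "?N = uminus ` uminus ` ?N" by (simp add: image_image)
  also have "\<dots> = trees y" using y(3) x(3) NL by simp
  finally show "\<exists>x. block x \<and> edges x = UNIV \<and> ?N = trees x" using y by blast
qed

section \<open>Induction over constructible spaces\<close>

lemma same_space:
  fixes p p' :: "'n::finite set \<Rightarrow> real"
  assumes "valuated_matroid d p" "d \<le> CARD('n)" "valuated_matroid d' p'" "d' \<le> CARD('n)"
    and eq: "tropical_linear_space d p = tropical_linear_space d' p'"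
  shows "d = d'" and "minimizers d p w = minimizers d' p' w"
proof -
  show d: "d = d'"
    using tropical_linear_space_rank [OF assms(1,2)] tropical_linear_space_rank [OF assms(3,4)] eq
    by (metis order_antisym order_refl)
  have "tropical_linear_space d' p' \<subseteq> tropical_linear_space d' p" using eq d by simp
  from tropical_linear_space_determines [OF assms(3) this]
  show "minimizers d p w = minimizers d' p' w" unfolding d by (rule minimizers_cong)
qed

text \<open>The claim is made for every \<open>d\<close>, \<open>p\<close> representing the set, and
  asks for the exchange axiom only, which duals and stable intersections are known to satisfy. The
  bounds 0 < d < n pass to the dual, and an intersection of positive rank has factors of positive
  rank. Factors of rank n are covered by \<open>sp_valuation_face\<close>.\<close>

lemma constructible_sp_valuation:
  fixes p :: "'n::finite set \<Rightarrow> real"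
  assumes "constructible L" "L = tropical_linear_space d p" "valuated_matroid d p" "0 < d" "d < CARD('n)"
  shows "sp_valuation d p"
  using assms
proof (induction L arbitrary: d p rule: constructible.induct)
  case (hyperplane p0)
  have "valuated_matroid (CARD('n) - 1) p0" by (rule tropical_plucker_valuated [OF hyperplane(1)])
  then have "d = CARD('n) - 1"
    using same_space(1) [of "CARD('n) - 1" p0 d p] hyperplane by auto
  then show ?case using sp_valuation_hyperplane [of p] hyperplane by simp
next
  case (dual d0 p0)
  have d0: "d0 \<le> CARD('n)" using dual(1) by (simp add: tropical_plucker_def)
  have v0: "valuated_matroid d0 p0" by (rule tropical_plucker_valuated [OF dual(1)])
  note vd = valuated_dual [OF v0 d0]
  have d: "CARD('n) - d0 = d" and m: "\<And>w. minimizers (CARD('n) - d0) (dual_plucker p0) w = minimizers d p w"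
    using same_space [OF vd _ dual.prems(2) _ dual.prems(1)] dual.prems(4) by auto
  have "sp_valuation d0 p0" using dual.IH [OF refl v0] d dual.prems(3,4) d0 by simp
  then have "sp_valuation (CARD('n) - d0) (dual_plucker p0)" by (rule sp_valuation_dual [OF d0])
  then show ?case using sp_valuation_cong [of d p "dual_plucker p0"] m d by simp
next
  case (transverse_intersection d1 p1 d2 p2)
  note tp = transverse_intersection.hyps(1,3)
  have dims: "d1 \<le> CARD('n)" "d2 \<le> CARD('n)" "CARD('n) \<le> d1 + d2"
    using tp transverse_intersection.hyps by (auto simp: tropical_plucker_def)
  have v: "valuated_matroid d1 p1" "valuated_matroid d2 p2"
    using tp by (simp_all add: tropical_plucker_valuated)
  note vq = stable_intersection_valuated [OF v dims]
  have d: "d1 + d2 - CARD('n) = d"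
    and m: "\<And>w. minimizers (d1 + d2 - CARD('n)) (stable_intersection d1 p1 d2 p2) w = minimizers d p w"
    using same_space [OF vq _ transverse_intersection.prems(2) _ transverse_intersection.prems(1)]
      transverse_intersection.prems(4) dims by auto
  have pos: "0 < d1" "0 < d2" using d dims transverse_intersection.prems(3) by auto
  have "sp_sum UNIV (uminus ` minimizers d1 p1 w)" for w
    using transverse_intersection.IH(1) [OF refl v(1) pos(1)] by (intro sp_valuation_face pos dims)
  moreover have "sp_sum UNIV (uminus ` minimizers d2 p2 w)" for w
    using transverse_intersection.IH(2) [OF refl v(2) pos(2)] by (intro sp_valuation_face pos dims)
  moreover have "2 \<le> CARD('n)" using transverse_intersection.prems(3,4) by linarith
  ultimately have "sp_valuation (d1 + d2 - CARD('n)) (stable_intersection d1 p1 d2 p2)"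
    using transverse_intersection.hyps by (intro sp_valuation_intersection v dims)
  then show ?case using sp_valuation_cong [of d p "stable_intersection d1 p1 d2 p2"] m d by simp
qed

theorem mainTheorem2:
  fixes p :: "'n::finite set \<Rightarrow> real" and d :: nat
  assumes "tropical_plucker d p"
    and "0 < d"
    and "constructible (tropical_linear_space d p)"
  shows "series_parallel_tls d p"
proof (cases "d = CARD('n)")
  case True
  \<comment> \<open>In full rank the hypersimplex is a point and the only basis is
    \<open>UNIV\<close>: the cycle matroid of a path, given by a network with series nodes
    only.\<close>
  obtain a :: "'n net" where "wf_net a" "edges a = UNIV" "trees a = {UNIV}"
    using series_net [of "UNIV :: 'n set"] by auto
  then have sp: "series_parallel_matroid {UNIV :: 'n set}"
    using trees_series_parallel_matroid [of a] by simp
  show ?thesis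
    unfolding series_parallel_tls_def
  proof (intro allI impI)
    fix C assume "maximal_cell d p C"
    then have "C \<in> regular_subdivision d p" by (simp add: maximal_cell_def)
    then obtain w where "C = matroid_polytope (minimizers d p w)"
      using regular_subdivision_cell [of d C p] True by auto
    then show "\<exists>M. series_parallel_matroid M \<and> C = matroid_polytope M"
      using sp True by (auto simp: minimizers_full)
  qed
next
  case False
  then have d: "d < CARD('n)" using assms(1) by (simp add: tropical_plucker_def)
  have "sp_valuation d p"
    using constructible_sp_valuation [OF assms(3) refl tropical_plucker_valuated [OF assms(1)] assms(2) d] .
  note sp = this [unfolded sp_valuation_def, rule_format]
  show ?thesis
  proof (rule series_parallel_tlsI [OF assms(2) d])
    fix w assume "connected_family (minimizers d p w)"
    then obtain x where "block x" "edges x = UNIV" "minimizers d p w = trees x" using sp by blast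
    then show "series_parallel_matroid (minimizers d p w)"
      using trees_series_parallel_matroid [of x] by (simp add: block_def)
  qed
qed

end
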